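(* The following properties of $q$-determinants hold. 1. (Linearity in columns and rows.) If some column (respectively row) of a square matrix $M$ over $\mathfrak R$ (not necessarily $q$-Manin) is presented as a sum of column-matrices (respectively row-matrices), then $\det_q M$ is equal to the sum of the $q$-determinants of the matrices obtained from $M$ by replacing the considered column (row) by the corresponding column-matrices (row-matrices). 2. (Permutation of columns.) If $M$ is a square matrix satisfying the cross relations (in particular, if $M$ is $q$-Manin) and $M^\sigma$ denotes the matrix obtained from $M$ by a permutation of columns, $M^\sigma_{ij}=M_{i\sigma(j)}$ with $\sigma\in\mathfrak S_n$, then $$\det\nolimits_q(M^\sigma)=(-q)^{-\mathrm{inv}(\sigma)}\det\nolimits_q M.$$ Note that $M^\sigma$ is not a $q$-Manin matrix in general (even if $M$ is $q$-Manin). A permutation of rows affects the $q$-determinant in a highly non-trivial way, since shuffling the rows destroys the property of being $q$-Manin. 3. (Matrices with coincident columns.) Let $M$ be a square $q$-Manin matrix. If two columns of $M$ coincide, then $\det_q M=0$. If $q\ne-1$, the same holds for any square $M$ satisfying the cross relations. Furthermore, if $M$ is a square $q$-Manin matrix and $\widetilde M$ is obtained from $M$ by substituting the $r$-th column for the $s$-th column (i.e. the $s$-th column is replaced by the $r$-th one), where $s\ne r$, then $\det_q\widetilde M=0$; note that if $|s-r|\ge2$ then $\widetilde M$ is not a $q$-Manin matrix in general. (Actually this last property holds under weaker conditions: the cross relations and the $q$-commutativity, i.e. the column relations, of the elements in the $r$-th column.) In particular, the coincidence of rows does not imply the vanishing of the $q$-determinant. 4. (Determinant multiplicativity and Cauchy–Binet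 formula.) Let $M$ and $N$ be two matrices over $\mathfrak R$ such that $[M_{ij},N_{kl}]=0$ for all possible indices $i,j,k,l$, and let $M$ be $q$-Manin. If these are $n\times n$ matrices, then $\det_q(MN)=\det_q(M)\det_q(N)$. More generally, if $M$ and $N$ are rectangular matrices (for which $MN$ makes sense) and $i_1<i_2<\ldots<i_r$, then $$\det\nolimits_q\big((MN)_{IJ}\big)=\sum_{L=(l_1<l_2<\ldots<l_r)}\det\nolimits_q(M_{IL})\det\nolimits_q(N_{LJ}),$$ where $I=(i_1,i_2,\ldots,i_r)$ and $J=(j_1,j_2,\ldots,j_r)$. In this case $MN$ is a $q$-Manin matrix if $N$ is also a $q$-Manin matrix. 5. (Column expansion.) For an arbitrary $n\times n$ matrix $M$ (not necessarily $q$-Manin), $$\det\nolimits_q(M)=\sum_{r=1}^n(-q)^{1-r}M_{r1}\det\nolimits_q(M_{\backslash r\backslash 1})=\sum_{r=1}^n(-q)^{r-n}\det\nolimits_q(M_{\backslash r\backslash n})M_{rn}.$$ For an $n\times n$ matrix $M$ satisfying the cross relations (in particular, if $M$ is $q$-Manin) and any $s=1,\ldots,n$, $$\det\nolimits_q(M)=\sum_{r=1}^n(-q)^{s-r}M_{rs}\det\nolimits_q(M_{\backslash r\backslash s})=\sum_{r=1}^n(-q)^{r-s}\det\nolimits_q(M_{\backslash r\backslash s})M_{rs}.$$ To the best of the authors' knowledge, there are no analogous formulae for the row expansion. 6. (Laplace expansion.) For an arbitrary $n\times n$ matrix $M$ (not necessarily $q$-Manin), $$\det\nolimits_q M=\sum_{K=(k_1,\ldots,k_m),\;1\le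 k_1<\ldots<k_m\le n}(-q)^{-\sum_{l=1}^m(k_l-l)}\det\nolimits_q M_{K,(1,\ldots,m)}\;\det\nolimits_q M_{\backslash K,(m+1,\ldots,n)}.$$ For an $n\times n$ $q$-Manin matrix $M$ and an arbitrary pair of multi-indices $I_1=(i_1,\ldots,i_m)$ and $I_2=(i_{m+1},\ldots,i_n)$, one can also write $$\varepsilon^q_{i_1,\ldots,i_n}\det\nolimits_q M=\sum_{K=(k_1<\ldots<k_m)}(-q)^{-\sum_{l=1}^m(k_l-l)}\det\nolimits_q M_{K,I_1}\;\det\nolimits_q M_{\backslash K,I_2}.$$ One can also write similar formulae with products of more determinants on the right hand side: for $r$ non-negative numbers $l_1,\ldots,l_r$ such that $l_1+l_2+\ldots+l_r=n$ and arbitrary multi-indices $I_j=(i_{j1},i_{j2},\ldots,i_{j,l_j})$, with $(i_1,\ldots,i_n)=I_1\oplus I_2\oplus\ldots\oplus I_r$, $$\varepsilon^q_{i_1,\ldots,i_n}\det\nolimits_q M=\sum_{K_1,\ldots,K_r}\varepsilon^q_{k_1,\ldots,k_n}\prod_{j=1}^r\det\nolimits_q M_{K_jI_j}$$ (factors ordered by increasing $j$ from left to right), where the sum is over all multi-indices $K_j=(k_{j1},k_{j2},\ldots,k_{j,l_j})$ such that $k_{j1}<k_{j2}<\ldots<k_{j,l_j}$, and $(k_1,\ldots,k_n)=K_1\oplus K_2\oplus\ldots\oplus K_r$. If $(i_1,\ldots,i_n)=(1,2,3,\ldots,n)$, then this last formula holds for an arbitrary square matrix; for $l_1=l_2=\ldots=l_n=1$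 it becomes the definition of the $q$-determinant. 7. (Non-centrality of the $q$-determinant.) Contrary to the case of quantum group theory, $\det_q(M)$ is not a central element in the algebra $\mathbb C[M_{ij}]$ generated over $\mathbb C$ by $M_{ij}$, $1\le i,j\le n$, with the $q$-Manin relations; moreover, in general $[\det_q(M),\mathrm{tr}(M)]\ne0$. This difference between $q$-Manin matrices and quantum matrices can be traced back to the fact that the commutation relations between the elements of a $q$-Manin matrix are more general than those satisfied by the elements of a quantum matrix.
   Context: Let $q$ be a nonzero complex number and $\mathfrak R$ an associative, in general non-commutative, algebra over $\mathbb C$. A matrix $M=(M_{ij})$ over $\mathfrak R$ is called $q$-Manin if the following $q$-Manin relations hold: (column relations, or $q$-commutativity within columns) $M_{ij}M_{kj}=q^{-1}M_{kj}M_{ij}$ for all $j$ and all $i<k$, and (cross relations) $M_{ij}M_{kl}-M_{kl}M_{ij}=q^{-1}M_{kj}M_{il}-q\,M_{il}M_{kj}$ for all $i<k$, $j<l$. A quantum matrix (matrix of the quantum group $Fun_q(GL_n)$) is a square matrix $T$ such that both $T$ and its transpose are $q$-Manin. The $q$-determinant of an arbitrary $n\times n$ matrix $M$ over $\mathfrak R$ is $\det_q M=\sum_{\tau\in\mathfrak S_n}(-q)^{-\mathrm{inv}(\tau)}M_{\tau(1)1}M_{\tau(2)2}\cdots M_{\tau(n)n}$, where $\mathfrak S_n$ is the group of permutations of $\{1,\ldots,n\}$ and $\mathrm{inv}(\tau)$ is the number of inversions of $\tau$ (the $q$-determinant of an empty matrix is $1$). For multi-indices $I=(i_1,\ldots,i_r)$,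 $J=(j_1,\ldots,j_r)$, $M_{IJ}$ (also written $M_{I,J}$) is the $r\times r$ matrix with entries $(M_{IJ})_{ab}=M_{i_aj_b}$. $M_{\backslash r\backslash s}$ is the $(n-1)\times(n-1)$ matrix obtained from $M$ by deleting the $r$-th row and the $s$-th column. $\backslash K$ is the multi-index obtained from $(1,2,\ldots,n)$ by deleting the entries of $K$, and $\oplus$ denotes concatenation of multi-indices. The symbol $\varepsilon^q_{i_1,\ldots,i_n}$ ($1\le i_l\le n$) is $0$ if two indices coincide, and $\varepsilon^q_{\sigma(1),\ldots,\sigma(n)}=(-q)^{-\mathrm{inv}(\sigma)}$ for $\sigma\in\mathfrak S_n$. $[a,b]=ab-ba$ and $\mathrm{tr}(M)=\sum_iM_{ii}$.
   Formalization: Remarks that fail as written are restricted: loss of the q-Manin property needs q²≠1; nonzero determinant with coincident rows q≠1, n≥2; non-centrality n≥2; centrality for quantum matrices q²≠-1. Remarks on row expansion, "highly non-trivial" and "traced back" are omitted. *)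

theory Defs
  imports Complex_Main "HOL-Combinatorics.Permutations" "HOL-Library.Poly_Mapping"
begin

section \<open>Associative unital algebras over the complex numbers\<close>

class complex_algebra_1 = ring_1 +
  fixes scaleC :: "complex \<Rightarrow> 'a \<Rightarrow> 'a"  (infixr "*\<^sub>C" 75)
  assumes scaleC_add_right: "c *\<^sub>C (x + y) = c *\<^sub>C x + c *\<^sub>C y"
    and scaleC_add_left: "(c + d) *\<^sub>C x = c *\<^sub>C x + d *\<^sub>C x"
    and scaleC_scaleC: "c *\<^sub>C d *\<^sub>C x = (c * d) *\<^sub>C x"
    and scaleC_one: "1 *\<^sub>C x = x"
    and mult_scaleC_left: "(c *\<^sub>C x) * y = c *\<^sub>C (x * y)"
    and mult_scaleC_right: "x * (c *\<^sub>C y) = c *\<^sub>C (x * y)"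

instantiation complex :: complex_algebra_1
begin

definition scaleC_complex :: "complex \<Rightarrow> complex \<Rightarrow> complex" where
  "scaleC_complex c x = c * x"

instance
  by standard (simp_all add: scaleC_complex_def algebra_simps)

end

definition commutator :: "'a::ring \<Rightarrow> 'a \<Rightarrow> 'a" where
  "commutator a b = a * b - b * a"

inductive_set generated_algebra :: "'a::complex_algebra_1 set \<Rightarrow> 'a set"
  for S :: "'a set" where
  gen: "x \<in> S \<Longrightarrow> x \<in> generated_algebra S"
| one: "1 \<in> generated_algebra S"
| scale: "x \<in> generated_algebra S \<Longrightarrow> c *\<^sub>C x \<in> generated_algebra S"
| add: "x \<in> generated_algebra S \<Longrightarrow> y \<in> generated_algebra S \<Longrightarrow> x + y \<in> generated_algebra S"
| mult: "x \<in> generated_algebra S \<Longrightarrow> y \<in> generated_algebra S \<Longrightarrow> x * y \<in> generated_algebra S"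


section \<open>Matrices over an algebra\<close>

text \<open>
  A matrix is a function \<open>nat \<Rightarrow> nat \<Rightarrow> 'a\<close> with rows and columns numbered from 1; its
  size is always passed separately and entries outside that range are ignored.
  A multi-index is a list, whose \<open>l\<close>-th entry (counted from 1) is \<open>I ! (l - 1)\<close>.
\<close>

type_synonym 'a matrix = "nat \<Rightarrow> nat \<Rightarrow> 'a"

definition entries :: "nat \<Rightarrow> 'a matrix \<Rightarrow> 'a set" where
  "entries n M = {M i j | i j. i \<in> {1..n} \<and> j \<in> {1..n}}"

definition mtrace :: "nat \<Rightarrow> 'a::comm_monoid_add matrix \<Rightarrow> 'a" where
  "mtrace n M = (\<Sum>i = 1..n. M i i)"

text \<open>Product of a matrix with \<open>p\<close> columns and a matrix with \<open>p\<close> rows.\<close>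

definition mmult :: "nat \<Rightarrow> 'a::semiring_0 matrix \<Rightarrow> 'a matrix \<Rightarrow> 'a matrix" where
  "mmult p M N = (\<lambda>i k. \<Sum>j = 1..p. M i j * N j k)"

definition mtranspose :: "'a matrix \<Rightarrow> 'a matrix" where
  "mtranspose M = (\<lambda>i j. M j i)"

definition replace_column :: "nat \<Rightarrow> (nat \<Rightarrow> 'a) \<Rightarrow> 'a matrix \<Rightarrow> 'a matrix" where
  "replace_column s v M = (\<lambda>i j. if j = s then v i else M i j)"

definition replace_row :: "nat \<Rightarrow> (nat \<Rightarrow> 'a) \<Rightarrow> 'a matrix \<Rightarrow> 'a matrix" where
  "replace_row r v M = (\<lambda>i j. if i = r then v j else M i j)"

definition submat :: "'a matrix \<Rightarrow> nat list \<Rightarrow> nat list \<Rightarrow> 'a matrix" where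
  "submat M I J = (\<lambda>a b. M (I ! (a - 1)) (J ! (b - 1)))"

definition delete_row_col :: "nat \<Rightarrow> nat \<Rightarrow> 'a matrix \<Rightarrow> 'a matrix" where
  "delete_row_col r s M =
     (\<lambda>i j. M (if i < r then i else i + 1) (if j < s then j else j + 1))"

definition increasing_multi_indices :: "nat \<Rightarrow> nat \<Rightarrow> nat list set" where
  "increasing_multi_indices n m =
     {K. length K = m \<and> sorted_wrt (<) K \<and> set K \<subseteq> {1..n}}"

definition complement_multi_index :: "nat \<Rightarrow> nat list \<Rightarrow> nat list" where
  "complement_multi_index n K = filter (\<lambda>k. k \<notin> set K) [1..<Suc n]"


section \<open>The \<open>q\<close>-determinant\<close>

definition inversions :: "nat \<Rightarrow> (nat \<Rightarrow> nat) \<Rightarrow> nat" where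
  "inversions n \<sigma> =
     card {(i, j). i \<in> {1..n} \<and> j \<in> {1..n} \<and> i < j \<and> \<sigma> j < \<sigma> i}"

definition qdet :: "complex \<Rightarrow> nat \<Rightarrow> 'a::complex_algebra_1 matrix \<Rightarrow> 'a" where
  "qdet q n M =
     (\<Sum>\<tau> | \<tau> permutes {1..n}.
        ((- q) powi (- int (inversions n \<tau>))) *\<^sub>C prod_list (map (\<lambda>j. M (\<tau> j) j) [1..<Suc n]))"

text \<open>\<open>q_epsilon q n I\<close> is only meant for \<open>I\<close> of length \<open>n\<close> with entries in \<open>{1..n}\<close>.\<close>

definition q_epsilon :: "complex \<Rightarrow> nat \<Rightarrow> nat list \<Rightarrow> complex" where
  "q_epsilon q n I =
     (if distinct I then (- q) powi (- int (inversions n (\<lambda>l. I ! (l - 1)))) else 0)"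


section \<open>\<open>q\<close>-Manin matrices and quantum matrices\<close>

definition column_q_commutes :: "complex \<Rightarrow> nat \<Rightarrow> 'a::complex_algebra_1 matrix \<Rightarrow> nat \<Rightarrow> bool" where
  "column_q_commutes q m M j \<longleftrightarrow>
     (\<forall>i\<in>{1..m}. \<forall>k\<in>{1..m}. i < k \<longrightarrow> M i j * M k j = inverse q *\<^sub>C (M k j * M i j))"

definition column_relations :: "complex \<Rightarrow> nat \<Rightarrow> nat \<Rightarrow> 'a::complex_algebra_1 matrix \<Rightarrow> bool" where
  "column_relations q m n M \<longleftrightarrow> (\<forall>j\<in>{1..n}. column_q_commutes q m M j)"

definition cross_relations :: "complex \<Rightarrow> nat \<Rightarrow> nat \<Rightarrow> 'a::complex_algebra_1 matrix \<Rightarrow> bool" where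
  "cross_relations q m n M \<longleftrightarrow>
     (\<forall>i\<in>{1..m}. \<forall>k\<in>{1..m}. \<forall>j\<in>{1..n}. \<forall>l\<in>{1..n}. i < k \<longrightarrow> j < l \<longrightarrow>
        M i j * M k l - M k l * M i j
          = inverse q *\<^sub>C (M k j * M i l) - q *\<^sub>C (M i l * M k j))"

text \<open>\<open>M\<close> is an \<open>m \<times> n\<close> matrix.\<close>

definition q_manin :: "complex \<Rightarrow> nat \<Rightarrow> nat \<Rightarrow> 'a::complex_algebra_1 matrix \<Rightarrow> bool" where
  "q_manin q m n M \<longleftrightarrow> column_relations q m n M \<and> cross_relations q m n M"

definition quantum_matrix :: "complex \<Rightarrow> nat \<Rightarrow> 'a::complex_algebra_1 matrix \<Rightarrow> bool" where
  "quantum_matrix q n T \<longleftrightarrow> q_manin q n n T \<and> q_manin q n n (mtranspose T)"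


section \<open>The algebra defined by the \<open>q\<close>-Manin relations\<close>

text \<open>
  Words under concatenation, so that \<open>'g word \<Rightarrow>\<^sub>0 complex\<close> with the convolution product of
  \<open>Poly_Mapping\<close> is the free associative unital algebra on \<open>'g\<close>.
\<close>

datatype 'g word = Word (letters: "'g list")

instantiation word :: (type) monoid_add
begin

definition zero_word :: "'a word" where
  "zero_word = Word []"

definition plus_word :: "'a word \<Rightarrow> 'a word \<Rightarrow> 'a word" where
  "plus_word u v = Word (letters u @ letters v)"

instance
  by standard (simp_all add: zero_word_def plus_word_def)

end

type_synonym 'g free_algebra = "'g word \<Rightarrow>\<^sub>0 complex"

definition free_scalar :: "complex \<Rightarrow> 'g free_algebra" where
  "free_scalar c = Poly_Mapping.single 0 c"

definition free_gen :: "'g \<Rightarrow> 'g free_algebra" where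
  "free_gen g = Poly_Mapping.single (Word [g]) 1"

inductive_set two_sided_ideal :: "'r::ring_1 set \<Rightarrow> 'r set"
  for S :: "'r set" where
  gen: "x \<in> S \<Longrightarrow> x \<in> two_sided_ideal S"
| zero: "0 \<in> two_sided_ideal S"
| add: "x \<in> two_sided_ideal S \<Longrightarrow> y \<in> two_sided_ideal S \<Longrightarrow> x + y \<in> two_sided_ideal S"
| mult_left: "x \<in> two_sided_ideal S \<Longrightarrow> r * x \<in> two_sided_ideal S"
| mult_right: "x \<in> two_sided_ideal S \<Longrightarrow> x * r \<in> two_sided_ideal S"

definition q_manin_relators :: "complex \<Rightarrow> nat \<Rightarrow> (nat \<times> nat) free_algebra set" where
  "q_manin_relators q n = (let X = (\<lambda>i j. free_gen (i, j)) in
     {X i j * X k j - free_scalar (inverse q) * (X k j * X i j) | i j k.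
        i \<in> {1..n} \<and> j \<in> {1..n} \<and> k \<in> {1..n} \<and> i < k} \<union>
     {X i j * X k l - X k l * X i j
        - (free_scalar (inverse q) * (X k j * X i l) - free_scalar q * (X i l * X k j)) | i j k l.
        i \<in> {1..n} \<and> j \<in> {1..n} \<and> k \<in> {1..n} \<and> l \<in> {1..n} \<and> i < k \<and> j < l})"

text \<open>The homomorphism from the free algebra that sends the generator \<open>(i, j)\<close> to \<open>M i j\<close>.\<close>

definition evaluate :: "'a::complex_algebra_1 matrix \<Rightarrow> (nat \<times> nat) free_algebra \<Rightarrow> 'a" where
  "evaluate M f =
     (\<Sum>w\<in>Poly_Mapping.keys f.
        Poly_Mapping.lookup f w *\<^sub>C prod_list (map (\<lambda>(i, j). M i j) (letters w)))"

text \<open>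
  The \<open>q\<close>-Manin relations hold for \<open>M\<close> and imply every other relation between its entries.
  Equivalently, the kernel of \<^term>\<open>evaluate M\<close> on the free algebra on
  \<open>{1..n} \<times> {1..n}\<close> is the two-sided ideal of that algebra generated by the relators,
  that is, \<^term>\<open>generated_algebra (entries n M)\<close> is the algebra generated over the complex
  numbers by the \<open>M i j\<close> with the \<open>q\<close>-Manin relations as its defining relations.
  (Enlarging the free algebra by the other generators does not change the ideal membership
  of an \<open>f\<close> not involving them, since they can be mapped to 0.)
\<close>

definition generic_q_manin :: "complex \<Rightarrow> nat \<Rightarrow> 'a::complex_algebra_1 matrix \<Rightarrow> bool" where
  "generic_q_manin q n M \<longleftrightarrow> q_manin q n n M \<and>
     (\<forall>f. (\<forall>w\<in>Poly_Mapping.keys f. set (letters w) \<subseteq> {1..n} \<times> {1..n}) \<longrightarrow>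
        evaluate M f = 0 \<longrightarrow> f \<in> two_sided_ideal (q_manin_relators q n))"


section \<open>Algebras of linear operators\<close>

text \<open>
  The algebra of all linear operators on the complex vector space with basis \<open>'k\<close>; a supply
  of noncommutative algebras, for assertions that some matrix exists.
\<close>

definition vscale :: "complex \<Rightarrow> ('k \<Rightarrow>\<^sub>0 complex) \<Rightarrow> ('k \<Rightarrow>\<^sub>0 complex)" where
  "vscale c v = Poly_Mapping.map (\<lambda>x. c * x) v"

lemma lookup_vscale: "Poly_Mapping.lookup (vscale c v) k = c * Poly_Mapping.lookup v k"
  by (simp add: vscale_def Poly_Mapping.map.rep_eq when_def)

lemma vscale_simps:
  "vscale c (u + v) = vscale c u + vscale c v"
  "vscale c (- u) = - vscale c u"
  "vscale c (u - v) = vscale c u - vscale c v"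
  "vscale (c + d) u = vscale c u + vscale d u"
  "vscale c (vscale d u) = vscale (c * d) u"
  "vscale c 0 = 0"
  "vscale 1 u = u"
  by (rule poly_mapping_eqI; simp add: lookup_vscale lookup_add lookup_minus algebra_simps)+

typedef 'k linop =
  "{T :: ('k \<Rightarrow>\<^sub>0 complex) \<Rightarrow> ('k \<Rightarrow>\<^sub>0 complex).
      (\<forall>u v. T (u + v) = T u + T v) \<and> (\<forall>c v. T (vscale c v) = vscale c (T v))}"
  morphisms apply_linop Linop
  by (rule exI[of _ "\<lambda>v. v"]) simp

setup_lifting type_definition_linop

instantiation linop :: (type) complex_algebra_1
begin

lift_definition zero_linop :: "'a linop" is "\<lambda>v. 0"
  by (simp add: vscale_simps)

lift_definition one_linop :: "'a linop" is "\<lambda>v. v"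
  by simp

lift_definition plus_linop :: "'a linop \<Rightarrow> 'a linop \<Rightarrow> 'a linop" is "\<lambda>S T v. S v + T v"
  by (simp add: vscale_simps)

lift_definition uminus_linop :: "'a linop \<Rightarrow> 'a linop" is "\<lambda>T v. - T v"
  by (simp add: vscale_simps)

lift_definition minus_linop :: "'a linop \<Rightarrow> 'a linop \<Rightarrow> 'a linop" is "\<lambda>S T v. S v - T v"
  by (simp add: vscale_simps)

lift_definition times_linop :: "'a linop \<Rightarrow> 'a linop \<Rightarrow> 'a linop" is "\<lambda>S T v. S (T v)"
  by simp

lift_definition scaleC_linop :: "complex \<Rightarrow> 'a linop \<Rightarrow> 'a linop" is "\<lambda>c T v. vscale c (T v)"
  by (simp add: vscale_simps mult.commute)

instance
proof
  fix a b c :: "'a linop" and x y :: complex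
  show "a * b * c = a * (b * c)" by transfer simp
  show "1 * a = a" "a * 1 = a" by (transfer, simp)+
  show "a + b + c = a + (b + c)" by transfer (simp add: add.assoc)
  show "a + b = b + a" by transfer (simp add: add.commute)
  show "0 + a = a" "- a + a = 0" by (transfer, simp)+
  show "a - b = a + - b" by transfer simp
  show "(a + b) * c = a * c + b * c" "a * (b + c) = a * b + a * c" by (transfer, simp)+
  show "x *\<^sub>C (a + b) = x *\<^sub>C a + x *\<^sub>C b" by transfer (simp add: vscale_simps)
  show "(x + y) *\<^sub>C a = x *\<^sub>C a + y *\<^sub>C a" by transfer (simp add: vscale_simps)
  show "x *\<^sub>C y *\<^sub>C a = (x * y) *\<^sub>C a" by transfer (simp add: vscale_simps)
  show "1 *\<^sub>C a = a" by transfer (simp add: vscale_simps)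
  show "(x *\<^sub>C a) * b = x *\<^sub>C (a * b)" "a * (x *\<^sub>C b) = x *\<^sub>C (a * b)" by (transfer, simp)+
  have "(Poly_Mapping.single k 1 :: 'a \<Rightarrow>\<^sub>0 complex) \<noteq> 0" for k
    by (metis lookup_single_eq lookup_zero zero_neq_one)
  then have "(\<lambda>v. 0) \<noteq> (\<lambda>v :: 'a \<Rightarrow>\<^sub>0 complex. v)"
    by metis
  then show "(0 :: 'a linop) \<noteq> 1"
    by transfer
qed

end

end

theory Submission
  imports Defs "HOL-Combinatorics.Multiset_Permutations"
begin

text \<open>
  Everything is derived from minors \<open>minor p M A J\<close> whose rows form a set \<open>A\<close> and whose columns
  form a word \<open>J\<close>, with \<open>p = (-q)\<^sup>-\<^sup>1\<close>; permutations become words without repeated letters.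
  Cutting a word in two splits its inversions into those of the two pieces and those between them.
  This gives the Laplace expansion \<open>minor_laplace\<close>, in which the factors keep their order, so that
  it holds for every matrix. The expansions along the first and the last column are special cases,
  and expansions with many blocks are iterations of it.

  The cross relations say exactly that two-row minors satisfy
  \<open>minor {i, k} [l, j] = p minor {i, k} [j, l]\<close> for \<open>j < l\<close>, and the column relations that
  \<open>minor {i, k} [j, j] = 0\<close>. By the Laplace expansion both properties pass from two-row minors to
  two adjacent columns of arbitrary minors. Bubble sort then evaluates a minor with permuted
  columns (\<open>minor_sort_columns\<close>), and moving two degenerate columns next to each other shows that
  the minor vanishes (\<open>minor_degenerate_columns\<close>). The Cauchy--Binet formula follows by expanding a
  minor of \<open>M N\<close> over words of summation indices, and its two-row case shows that \<open>M N\<close> is again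
  a Manin matrix.

  For a quantum matrix \<open>T\<close> the entries on antidiagonals of two-by-two blocks commute, hence \<open>T\<close>
  and its transpose have the same minors. The column expansions of \<open>T\<close> and of its transpose
  therefore involve one and the same adjugate \<open>A\<close>, with \<open>A T = det 1\<close> and \<open>T A = det 1\<close>, and
  associativity of \<open>T A T\<close> makes the determinant central.

  A generic Manin matrix satisfies only those relations that hold for all Manin matrices. So the
  determinant and the trace of a generic matrix do not commute as soon as those of a single Manin
  matrix do not; \<open>noncentral_matrix\<close> is one, with operators of finite rank in a block
  of size two. A generic matrix itself is obtained by letting the generators act on a complement of
  the ideal of relations in the free algebra.
\<close>


section \<open>Linear combinations in a complex algebra\<close>

lemma scaleC_zero_right [simp]: "c *\<^sub>C (0::'a::complex_algebra_1) = 0"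
  using scaleC_add_right[of c "0::'a" 0] by simp

lemma scaleC_zero_left [simp]: "0 *\<^sub>C (x::'a::complex_algebra_1) = 0"
  using scaleC_add_left[of 0 0 x] by simp

lemma scaleC_minus_right: "c *\<^sub>C (- x) = - (c *\<^sub>C (x::'a::complex_algebra_1))"
  using scaleC_add_right[of c x "- x"] by (simp add: eq_neg_iff_add_eq_0 add.commute)

lemma scaleC_minus_left: "(- c) *\<^sub>C x = - (c *\<^sub>C (x::'a::complex_algebra_1))"
  using scaleC_add_left[of "c" "- c" x] by (simp add: eq_neg_iff_add_eq_0 add.commute)

lemma scaleC_diff_right: "c *\<^sub>C (x - y) = c *\<^sub>C x - c *\<^sub>C (y::'a::complex_algebra_1)"
  using scaleC_add_right[of c x "- y"] by (simp add: scaleC_minus_right)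

lemma scaleC_sum_right: "c *\<^sub>C sum f A = (\<Sum>x\<in>A. c *\<^sub>C (f x :: 'a::complex_algebra_1))"
  by (induction A rule: infinite_finite_induct) (simp_all add: scaleC_add_right)

lemma scaleC_cancel:
  assumes "c \<noteq> 0" "c *\<^sub>C x = c *\<^sub>C (y::'a::complex_algebra_1)"
  shows "x = y"
proof -
  have "inverse c *\<^sub>C c *\<^sub>C x = inverse c *\<^sub>C c *\<^sub>C y"
    using assms(2) by simp
  then show ?thesis
    using assms(1) by (simp add: scaleC_scaleC scaleC_one)
qed

lemma scaleC_eq_0_iff: "c *\<^sub>C x = (0::'a::complex_algebra_1) \<longleftrightarrow> c = 0 \<or> x = 0"
  using scaleC_cancel[of c x 0] by auto

lemmas scaleC_algebra =
  scaleC_add_right scaleC_add_left scaleC_minus_right scaleC_minus_left scaleC_diff_right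
  scaleC_scaleC scaleC_one mult_scaleC_left mult_scaleC_right


section \<open>Inversions of words\<close>

text \<open>
  Counting the set of smaller later letters is adequate because only words without repeated
  letters are ever weighted by their inversions.
\<close>

fun word_inversions :: "nat list \<Rightarrow> nat" where
  "word_inversions [] = 0"
| "word_inversions (x # xs) = card {y \<in> set xs. y < x} + word_inversions xs"

text \<open>
  The inversions created by writing the letters of \<open>A\<close> in front of those of \<open>B\<close>; they do not
  depend on the order within \<open>A\<close> and within \<open>B\<close>, which makes them the coefficients of Laplace
  expansions.
\<close>

definition cross_inversions :: "nat set \<Rightarrow> nat set \<Rightarrow> nat" where
  "cross_inversions A B = (\<Sum>a\<in>A. card {b\<in>B. b < a})"

lemma word_inversions_append:
  assumes "distinct (xs @ ys)"
  shows "word_inversions (xs @ ys) =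
    word_inversions xs + word_inversions ys + cross_inversions (set xs) (set ys)"
  using assms
proof (induction xs)
  case (Cons x xs)
  have "{y \<in> set (xs @ ys). y < x} = {y \<in> set xs. y < x} \<union> {y \<in> set ys. y < x}"
    by auto
  moreover have "card \<dots> = card {y \<in> set xs. y < x} + card {y \<in> set ys. y < x}"
    using Cons.prems by (intro card_Un_disjoint) auto
  ultimately show ?case
    using Cons by (simp add: cross_inversions_def)
qed (simp add: cross_inversions_def)

lemma word_inversions_strict_sorted: "sorted_wrt (<) xs \<Longrightarrow> word_inversions xs = 0"
  by (induction xs) auto

lemma word_inversions_map_strict_mono:
  assumes "strict_mono_on A g" "set xs \<subseteq> A"
  shows "word_inversions (map g xs) = word_inversions xs"
  using assms(2)
proof (induction xs)
  case (Cons x xs)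
  have "{y \<in> set (map g xs). y < g x} = g ` {y \<in> set xs. y < x}"
    using Cons.prems strict_mono_on_less[OF assms(1)] by (auto simp: image_iff)
  moreover have "card \<dots> = card {y \<in> set xs. y < x}"
    using Cons.prems strict_mono_on_imp_inj_on[OF assms(1)]
    by (intro card_image) (auto intro: inj_on_subset)
  ultimately show ?case
    using Cons by simp
qed simp

lemma word_inversions_eq_card:
  assumes "distinct xs"
  shows "word_inversions xs = card {(i, j). i < j \<and> j < length xs \<and> xs ! j < xs ! i}"
  using assms
proof (induction xs)
  case (Cons x xs)
  let ?I = "\<lambda>xs::nat list. {(i, j). i < j \<and> j < length xs \<and> xs ! j < xs ! i}"
  let ?N = "{j. j < length xs \<and> xs ! j < x}"
  have fin: "finite (?I xs)" for xs :: "nat list"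
    by (rule finite_subset[of _ "{..<length xs} \<times> {..<length xs}"]) auto
  have "?I (x # xs) = (\<lambda>j. (0, Suc j)) ` ?N \<union> (\<lambda>(i, j). (Suc i, Suc j)) ` ?I xs"
  proof (intro set_eqI iffI)
    fix z assume "z \<in> ?I (x # xs)"
    then obtain i j where z: "z = (i, j)" "i < j" "j < length (x # xs)" "(x # xs) ! j < (x # xs) ! i"
      by auto
    then obtain j' where "j = Suc j'"
      by (cases j) auto
    with z show "z \<in> (\<lambda>j. (0, Suc j)) ` ?N \<union> (\<lambda>(i, j). (Suc i, Suc j)) ` ?I xs"
      by (cases i) auto
  qed auto
  moreover have "card ((\<lambda>j. (0::nat, Suc j)) ` ?N) = card ?N"
    by (intro card_image) (auto simp: inj_on_def)
  moreover have "card ((\<lambda>(i, j). (Suc i, Suc j)) ` ?I xs) = card (?I xs)"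
    by (intro card_image) (auto simp: inj_on_def)
  moreover have "card ?N = card {y \<in> set xs. y < x}"
  proof -
    have "{y \<in> set xs. y < x} = (!) xs ` ?N"
      by (auto simp: in_set_conv_nth)
    moreover have "card \<dots> = card ?N"
      using Cons.prems by (intro card_image) (auto simp: inj_on_def nth_eq_iff_index_eq)
    ultimately show ?thesis
      by simp
  qed
  moreover have "card ((\<lambda>j. (0, Suc j)) ` ?N \<union> (\<lambda>(i, j). (Suc i, Suc j)) ` ?I xs) =
      card ((\<lambda>j. (0::nat, Suc j)) ` ?N) + card ((\<lambda>(i, j). (Suc i, Suc j)) ` ?I xs)"
    by (intro card_Un_disjoint finite_imageI) (use fin[of xs] in auto)
  ultimately show ?case
    using Cons by simp
qed simp

lemma inversions_eq_word_inversions: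
  assumes "inj_on f {1..n}"
  shows "inversions n f = word_inversions (map f [1..<Suc n])"
proof -
  let ?xs = "map f [1..<Suc n]"
  have "distinct ?xs"
    using assms by (simp add: distinct_map atLeastLessThanSuc_atLeastAtMost del: upt_Suc)
  then have "word_inversions ?xs = card {(i, j). i < j \<and> j < length ?xs \<and> ?xs ! j < ?xs ! i}"
    by (rule word_inversions_eq_card)
  also have "\<dots> = inversions n f"
    unfolding inversions_def
  proof (rule bij_betw_same_card[of "\<lambda>(i, j). (Suc i, Suc j)"], rule bij_betwI')
    fix z assume "z \<in> {(i, j). i \<in> {1..n} \<and> j \<in> {1..n} \<and> i < j \<and> f j < f i}"
    then obtain i j where z: "z = (i, j)" "i \<in> {1..n}" "j \<in> {1..n}" "i < j" "f j < f i"
      by auto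
    then have "(i - 1, j - 1) \<in> {(i, j). i < j \<and> j < length ?xs \<and> ?xs ! j < ?xs ! i}"
      by (auto simp: nth_upt simp del: upt_Suc)
    moreover have "z = (case (i - 1, j - 1) of (i, j) \<Rightarrow> (Suc i, Suc j))"
      using z by auto
    ultimately show "\<exists>x\<in>{(i, j). i < j \<and> j < length ?xs \<and> ?xs ! j < ?xs ! i}.
        z = (case x of (i, j) \<Rightarrow> (Suc i, Suc j))"
      by blast
  qed (auto simp: nth_upt simp del: upt_Suc)
  finally show ?thesis ..
qed

lemma powi_minus_of_nat: "(c::complex) powi (- int k) = inverse c ^ k"
  by (simp add: power_int_minus power_inverse)

lemma q_epsilon_eq:
  "q_epsilon q (length I) I = (if distinct I then inverse (- q) ^ word_inversions I else 0)"
proof -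
  have "map (\<lambda>l. I ! (l - 1)) [1..<Suc (length I)] = I"
    by (intro nth_equalityI) (auto simp: nth_upt simp del: upt_Suc)
  moreover have "inj_on (\<lambda>l. I ! (l - 1)) {1..length I}" if "distinct I"
    using that by (auto simp: inj_on_def nth_eq_iff_index_eq)
  ultimately show ?thesis
    unfolding q_epsilon_def
    using inversions_eq_word_inversions[of "\<lambda>l. I ! (l - 1)" "length I"]
    by (simp add: powi_minus_of_nat del: upt_Suc)
qed


section \<open>Minors indexed by a set of rows and a word of columns\<close>

text \<open>
  The rows are a set, since their order is summed over, but the columns are a word, since columns
  in the wrong order and repeated columns are what the antisymmetry statements are about.
  The weight \<open>p\<close> stands for \<open>(-q)\<^sup>-\<^sup>1\<close>.
\<close>

definition minor :: "complex \<Rightarrow> 'a::complex_algebra_1 matrix \<Rightarrow> nat set \<Rightarrow> nat list \<Rightarrow> 'a" where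
  "minor p M A J = (\<Sum>ys\<in>permutations_of_set A. p ^ word_inversions ys *\<^sub>C prod_list (map2 M ys J))"

text \<open>
  An increasing renumbering of the rows preserves inversions. Hence determinants of submatrices,
  and of matrices with a row and a column deleted, are minors of the original matrix.
\<close>

lemma minor_map:
  assumes "strict_mono_on A g"
  shows "minor p M (g ` A) (map h J) = minor p (\<lambda>i j. M (g i) (h j)) A J"
proof -
  have inj: "inj_on g A"
    using assms by (rule strict_mono_on_imp_inj_on)
  have "inj_on (map g) (permutations_of_set A)"
    using inj by (intro inj_onI) (metis inj_on_map_eq_map permutations_of_setD(1) Un_absorb)
  moreover have "map2 M (map g ys) (map h J) = map2 (\<lambda>i j. M (g i) (h j)) ys J" for ys
    by (simp add: zip_map_map case_prod_beta comp_def)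
  ultimately show ?thesis
    unfolding minor_def permutations_of_set_image_inj[OF inj]
    by (subst sum.reindex)
       (auto intro!: sum.cong simp: word_inversions_map_strict_mono[OF assms]
         dest: permutations_of_setD)
qed

text \<open>
  Surjectivity is obtained by counting: there are \<open>n!\<close> permutations and \<open>n!\<close> words.
\<close>

lemma bij_betw_permutes_words:
  "bij_betw (\<lambda>\<tau>. map \<tau> [1..<Suc n]) {\<tau>. \<tau> permutes {1..n}} (permutations_of_set {1..n})"
proof (rule bij_betw_imageI)
  show "inj_on (\<lambda>\<tau>. map \<tau> [1..<Suc n]) {\<tau>. \<tau> permutes {1..n}}"
  proof (rule inj_onI)
    fix \<sigma> \<tau> :: "nat \<Rightarrow> nat"
    assume *: "\<sigma> \<in> {\<tau>. \<tau> permutes {1..n}}" "\<tau> \<in> {\<tau>. \<tau> permutes {1..n}}"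
      "map \<sigma> [1..<Suc n] = map \<tau> [1..<Suc n]"
    then have "\<sigma> j = \<tau> j" if "j \<in> {1..n}" for j
      using that by (simp add: atLeastLessThanSuc_atLeastAtMost del: upt_Suc)
    moreover have "\<sigma> j = \<tau> j" if "j \<notin> {1..n}" for j
      using *(1,2) that by (simp add: permutes_not_in)
    ultimately show "\<sigma> = \<tau>"
      by blast
  qed
  have "inj_on (\<lambda>\<tau>. map \<tau> [1..<Suc n]) {\<tau>. \<tau> permutes {1..n}}"
    by fact
  then have "card ((\<lambda>\<tau>. map \<tau> [1..<Suc n]) ` {\<tau>. \<tau> permutes {1..n}}) =
      card (permutations_of_set {1..n})"
    by (simp add: card_image card_permutations)
  moreover have "(\<lambda>\<tau>. map \<tau> [1..<Suc n]) ` {\<tau>. \<tau> permutes {1..n}} \<subseteq> permutations_of_set {1..n}"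
    by (auto simp: permutations_of_set_def distinct_map atLeastLessThanSuc_atLeastAtMost
        permutes_image permutes_inj_on simp del: upt_Suc)
  ultimately show "(\<lambda>\<tau>. map \<tau> [1..<Suc n]) ` {\<tau>. \<tau> permutes {1..n}} = permutations_of_set {1..n}"
    by (intro card_subset_eq) auto
qed

lemma qdet_eq_minor: "qdet q n M = minor (inverse (- q)) M {1..n} [1..<Suc n]"
proof -
  have "map2 M (map \<tau> [1..<Suc n]) [1..<Suc n] = map (\<lambda>j. M (\<tau> j) j) [1..<Suc n]" for \<tau>
    by (rule nth_equalityI) (auto simp del: upt_Suc)
  then have "qdet q n M = (\<Sum>\<tau> | \<tau> permutes {1..n}.
      (\<lambda>ys. inverse (- q) ^ word_inversions ys *\<^sub>C prod_list (map2 M ys [1..<Suc n]))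
        (map \<tau> [1..<Suc n]))"
    unfolding qdet_def
    by (intro sum.cong)
       (auto simp: inversions_eq_word_inversions permutes_inj_on powi_minus_of_nat
         simp del: upt_Suc)
  also have "\<dots> = minor (inverse (- q)) M {1..n} [1..<Suc n]"
    unfolding minor_def by (rule sum.reindex_bij_betw[OF bij_betw_permutes_words])
  finally show ?thesis .
qed

lemma qdet_map_eq_minor:
  assumes "strict_mono_on {1..n} g"
  shows "qdet q n (\<lambda>i j. M (g i) (h j)) = minor (inverse (- q)) M (g ` {1..n}) (map h [1..<Suc n])"
  by (simp only: qdet_eq_minor minor_map[OF assms])

lemma strict_mono_on_nth:
  assumes "sorted_wrt (<) (K :: nat list)"
  shows "strict_mono_on {1..length K} (\<lambda>a. K ! (a - 1))"
  using assms by (auto simp: strict_mono_on_def sorted_wrt_nth_less)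

lemma qdet_submat:
  assumes "sorted_wrt (<) K" "length K = r" "length J = r"
  shows "qdet q r (submat M K J) = minor (inverse (- q)) M (set K) J"
proof -
  have "map (\<lambda>l. L ! (l - 1)) [1..<Suc r] = L" if "length L = r" for L :: "nat list"
    using that by (intro nth_equalityI) (auto simp: nth_upt simp del: upt_Suc)
  note this[OF assms(2)] this[OF assms(3)]
  moreover have "(\<lambda>l. K ! (l - 1)) ` {1..r} = set (map (\<lambda>l. K ! (l - 1)) [1..<Suc r])"
    by (simp add: atLeastLessThanSuc_atLeastAtMost del: upt_Suc)
  ultimately show ?thesis
    using qdet_map_eq_minor[of r "\<lambda>l. K ! (l - 1)" q M "\<lambda>l. J ! (l - 1)"] strict_mono_on_nth[OF assms(1)]
      assms(2)
    by (simp add: submat_def del: upt_Suc)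
qed

lemma qdet_delete_row_col:
  assumes "r \<in> {1..n}" "s \<in> {1..n}"
  shows "qdet q (n - 1) (delete_row_col r s M) =
    minor (inverse (- q)) M ({1..n} - {r}) ([1..<s] @ [Suc s..<Suc n])"
proof -
  let ?g = "\<lambda>r i. if i < r then i else i + 1 :: nat"
  have "strict_mono_on {1..n-1} (?g r)"
    by (auto simp: strict_mono_on_def)
  moreover have "?g r ` {1..n-1} = {1..n} - {r}"
  proof (intro set_eqI iffI)
    fix x assume "x \<in> {1..n} - {r}"
    then show "x \<in> ?g r ` {1..n-1}"
      using assms by (intro image_eqI[of _ _ "if x < r then x else x - 1"]) auto
  qed (use assms in auto)
  moreover have "map (?g s) [1..<Suc (n-1)] = [1..<s] @ [Suc s..<Suc n]"
    using assms by (intro nth_equalityI) (auto simp: nth_append nth_upt simp del: upt_Suc)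
  ultimately show ?thesis
    using qdet_map_eq_minor[of "n-1" "?g r" q M "?g s"]
    by (simp add: delete_row_col_def del: upt_Suc)
qed


section \<open>Laplace expansion for arbitrary matrices\<close>

lemma set_drop_eq_diff_take: "distinct xs \<Longrightarrow> set (drop n xs) = set xs - set (take n xs)"
  using set_take_disj_set_drop_if_distinct[of xs n n] set_append[of "take n xs" "drop n xs"]
  by auto

text \<open>
  Each word of rows is cut after \<open>length J1\<close> letters, and the words are grouped by the set \<open>B\<close> of
  letters of the first piece. Inversions between the pieces depend on \<open>B\<close> only.
\<close>

theorem minor_laplace:
  assumes "finite A" "card A = length J1 + length J2"
  shows "minor p M A (J1 @ J2) =
    (\<Sum>B | B \<subseteq> A \<and> card B = length J1.
      p ^ cross_inversions B (A - B) *\<^sub>C (minor p M B J1 * minor p M (A - B) J2))"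
proof -
  let ?t = "\<lambda>J ys. p ^ word_inversions ys *\<^sub>C prod_list (map2 M ys J)"
  let ?S = "{B. B \<subseteq> A \<and> card B = length J1}"
  have fin: "finite ?S"
    using assms(1) by simp
  have "(\<Sum>B\<in>?S. p ^ cross_inversions B (A - B) *\<^sub>C (minor p M B J1 * minor p M (A - B) J2)) =
    (\<Sum>B\<in>?S. \<Sum>(ys, zs)\<in>permutations_of_set B \<times> permutations_of_set (A - B). ?t (J1 @ J2) (ys @ zs))"
  proof (intro sum.cong refl)
    fix B assume B: "B \<in> ?S"
    have "?t (J1 @ J2) (ys @ zs) = p ^ cross_inversions B (A - B) *\<^sub>C (?t J1 ys * ?t J2 zs)"
      if "ys \<in> permutations_of_set B" "zs \<in> permutations_of_set (A - B)" for ys zs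
    proof -
      note ys = permutations_of_setD[OF that(1)] and zs = permutations_of_setD[OF that(2)]
      have "length ys = length J1"
        using B ys distinct_card by fastforce
      moreover have "word_inversions (ys @ zs) =
          word_inversions ys + word_inversions zs + cross_inversions B (A - B)"
        using ys zs by (subst word_inversions_append) auto
      ultimately show ?thesis
        by (simp add: scaleC_algebra power_add mult_ac)
    qed
    then show "p ^ cross_inversions B (A - B) *\<^sub>C (minor p M B J1 * minor p M (A - B) J2) =
      (\<Sum>(ys, zs)\<in>permutations_of_set B \<times> permutations_of_set (A - B). ?t (J1 @ J2) (ys @ zs))"
      unfolding minor_def
      by (simp add: sum_product scaleC_sum_right sum.cartesian_product)
         (auto intro!: sum.cong)
  qed
  also have "\<dots> = (\<Sum>(B, ys, zs)\<in>(SIGMA B:?S. permutations_of_set B \<times> permutations_of_set (A - B)).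
      ?t (J1 @ J2) (ys @ zs))"
    using fin by (subst sum.Sigma) (auto simp: case_prod_beta)
  also have "\<dots> = (\<Sum>xs\<in>permutations_of_set A. ?t (J1 @ J2) xs)"
    by (rule sum.reindex_bij_witness[of _
          "\<lambda>xs. (set (take (length J1) xs), take (length J1) xs, drop (length J1) xs)"
          "\<lambda>(B, ys, zs). ys @ zs"])
       (use assms in \<open>auto simp: permutations_of_set_def distinct_card set_drop_eq_diff_take
           dest: in_set_takeD\<close>)
  finally show ?thesis
    by (simp add: minor_def)
qed

section \<open>Exchanging columns\<close>

text \<open>
  The cross relations for the rows \<open>A\<close> and the columns \<open>C\<close>, in terms of two-row minors.
\<close>

definition minors_antisymmetric ::
    "complex \<Rightarrow> 'a::complex_algebra_1 matrix \<Rightarrow> nat set \<Rightarrow> nat set \<Rightarrow> bool" where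
  "minors_antisymmetric p M A C \<longleftrightarrow>
     (\<forall>i\<in>A. \<forall>k\<in>A. \<forall>j\<in>C. \<forall>l\<in>C. i < k \<longrightarrow> j < l \<longrightarrow>
        minor p M {i, k} [l, j] = p *\<^sub>C minor p M {i, k} [j, l])"

lemma minors_antisymmetric_mono:
  "minors_antisymmetric p M A C \<Longrightarrow> A' \<subseteq> A \<Longrightarrow> C' \<subseteq> C \<Longrightarrow> minors_antisymmetric p M A' C'"
  unfolding minors_antisymmetric_def by blast

lemma minor_empty [simp]: "minor p M {} [] = 1"
  by (simp add: minor_def scaleC_one)

lemma minor_singleton [simp]: "minor p M {i} [j] = M i j"
  by (simp add: minor_def scaleC_one)

lemma minor_two_rows:
  assumes "i < k"
  shows "minor p M {i, k} [j, l] = M i j * M k l + p *\<^sub>C (M k j * M i l)"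
proof -
  have "word_inversions [i, k] = 0"
    using assms by (simp add: word_inversions_strict_sorted del: word_inversions.simps)
  moreover have "{y. y = i \<and> y < k} = {i}"
    using assms by auto
  then have "word_inversions [k, i] = 1"
    by simp
  ultimately show ?thesis
    using assms by (simp add: minor_def permutations_of_set_doubleton scaleC_one
        del: word_inversions.simps)
qed

lemma cross_relations_iff_minors:
  assumes "q \<noteq> 0"
  shows "cross_relations q m n M \<longleftrightarrow> minors_antisymmetric (inverse (- q)) M {1..m} {1..n}"
proof -
  have "M i j * M k l - M k l * M i j = inverse q *\<^sub>C (M k j * M i l) - q *\<^sub>C (M i l * M k j) \<longleftrightarrow>
      minor (inverse (- q)) M {i, k} [l, j] = inverse (- q) *\<^sub>C minor (inverse (- q)) M {i, k} [j, l]"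
    (is "?cross \<longleftrightarrow> ?anti") if "i < k" for i j k l
  proof -
    \<comment> \<open>Clearing the denominator turns the antisymmetry of two-row minors into the cross relation.\<close>
    have "?anti \<longleftrightarrow> (- q) *\<^sub>C minor (inverse (- q)) M {i, k} [l, j] = minor (inverse (- q)) M {i, k} [j, l]"
      using assms scaleC_cancel[of "- q" "minor (inverse (- q)) M {i, k} [l, j]"
          "inverse (- q) *\<^sub>C minor (inverse (- q)) M {i, k} [j, l]"]
      by (auto simp: scaleC_scaleC scaleC_one)
    also have "\<dots> \<longleftrightarrow> ?cross"
      using assms that by (simp add: minor_two_rows scaleC_algebra) (auto simp: algebra_simps)
    finally show ?thesis ..
  qed
  then show ?thesis
    unfolding cross_relations_def minors_antisymmetric_def by blast
qed

lemma column_q_commutes_iff_minors: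
  "column_q_commutes q m M j \<longleftrightarrow>
     (\<forall>i\<in>{1..m}. \<forall>k\<in>{1..m}. i < k \<longrightarrow> minor (inverse (- q)) M {i, k} [j, j] = 0)"
  by (auto simp: column_q_commutes_def minor_two_rows scaleC_minus_left)

text \<open>
  A Laplace expansion into the columns before, at and after two adjacent positions isolates these
  positions in a two-row minor. Exchanging columns uses \<open>c = p\<close> or \<open>c = p\<^sup>-\<^sup>1\<close>; the value \<open>c = 0\<close>
  expresses that a pair of adjacent columns annihilates the minor.
\<close>

lemma minor_adjacent_columns:
  assumes "finite A" "card A = length J1 + 2 + length J2"
    and exchange: "\<And>i k. i \<in> A \<Longrightarrow> k \<in> A \<Longrightarrow> i < k \<Longrightarrow>
      minor p M {i, k} [b, a] = c *\<^sub>C minor p M {i, k} [a, b]"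
  shows "minor p M A (J1 @ b # a # J2) = c *\<^sub>C minor p M A (J1 @ a # b # J2)"
proof -
  have two: "minor p M B ([b, a] @ J2) = c *\<^sub>C minor p M B ([a, b] @ J2)"
    if B: "B \<subseteq> A" "card B = 2 + length J2" for B
  proof -
    have fin: "finite B"
      using B(1) assms(1) by (rule finite_subset)
    have "minor p M K [b, a] = c *\<^sub>C minor p M K [a, b]" if "K \<subseteq> B" "card K = 2" for K
    proof -
      obtain i k where "K = {i, k}" "i \<noteq> k"
        using \<open>card K = 2\<close> by (auto simp: card_2_iff)
      then show ?thesis
        using exchange[of i k] exchange[of k i] that B by (auto simp: insert_commute neq_iff)
    qed
    then show ?thesis
      using B fin by (simp only: minor_laplace list.size)
        (auto simp: scaleC_sum_right scaleC_algebra mult_ac intro!: sum.cong)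
  qed
  have "minor p M (A - B) (b # a # J2) = c *\<^sub>C minor p M (A - B) (a # b # J2)"
    if "B \<subseteq> A" "card B = length J1" for B
    using two[of "A - B"] that assms(1,2) finite_subset[of B A] by (simp add: card_Diff_subset)
  then show ?thesis
    using assms(1,2)
    by (subst (1 2) minor_laplace)
       (auto simp: scaleC_sum_right scaleC_algebra mult_ac intro!: sum.cong)
qed

lemma not_strict_sorted_decomp:
  "distinct J \<Longrightarrow> \<not> sorted_wrt (<) J \<Longrightarrow> \<exists>J1 a b J2. J = J1 @ b # a # J2 \<and> a < (b :: nat)"
proof (induction J)
  case (Cons x J)
  show ?case
  proof (cases "sorted_wrt (<) J")
    case False
    with Cons obtain J1 a b J2 where "J = J1 @ b # a # J2" "a < b"
      by auto
    then show ?thesis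
      by (intro exI[of _ "x # J1"]) auto
  next
    case True
    then obtain y J' where J: "J = y # J'"
      using Cons.prems by (cases J) auto
    with True Cons.prems have "y < x"
      by (auto simp: not_less_iff_gr_or_eq)
    with J show ?thesis
      by (intro exI[of _ "[]"]) auto
  qed
qed simp

lemma word_inversions_descent:
  assumes "distinct (J1 @ b # a # J2)" "a < b"
  shows "word_inversions (J1 @ b # a # J2) = Suc (word_inversions (J1 @ a # b # J2))"
  using assms(1)
proof (induction J1)
  case Nil
  have "{y \<in> set (a # J2). y < b} = insert a {y \<in> set J2. y < b}"
    "{y \<in> set (b # J2). y < a} = {y \<in> set J2. y < a}"
    using assms(2) by auto
  then show ?case
    using Nil by simp
next
  case (Cons x J1)
  have "set (J1 @ b # a # J2) = set (J1 @ a # b # J2)"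
    by auto
  with Cons show ?case
    by simp
qed

text \<open>
  Bubble sort: removing a descent lowers the number of inversions by one and costs one factor \<open>p\<close>.
\<close>

theorem minor_sort_columns:
  assumes "finite A" "card A = length J" "distinct J" "minors_antisymmetric p M A (set J)"
  shows "minor p M A J = p ^ word_inversions J *\<^sub>C minor p M A (sorted_list_of_set (set J))"
  using assms(2-)
proof (induction "word_inversions J" arbitrary: J rule: less_induct)
  case less
  show ?case
  proof (cases "sorted_wrt (<) J")
    case True
    then have "sorted_list_of_set (set J) = J"
      by (simp add: sorted_list_of_set.idem_if_sorted_distinct strict_sorted_iff)
    with True show ?thesis
      by (simp add: word_inversions_strict_sorted scaleC_one)
  next
    case False
    with less.prems obtain J1 a b J2 where J: "J = J1 @ b # a # J2" "a < b"
      using not_strict_sorted_decomp by blast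
    let ?J' = "J1 @ a # b # J2"
    have sets: "set ?J' = set J"
      using J by auto
    have "minor p M A J = p *\<^sub>C minor p M A ?J'"
      unfolding J(1) using less.prems J assms(1)
      by (intro minor_adjacent_columns) (auto simp: minors_antisymmetric_def)
    also have "minor p M A ?J' = p ^ word_inversions ?J' *\<^sub>C minor p M A (sorted_list_of_set (set ?J'))"
      using less.prems J sets word_inversions_descent[of J1 b a J2]
      by (intro less.hyps) auto
    finally have "minor p M A J =
        p ^ Suc (word_inversions ?J') *\<^sub>C minor p M A (sorted_list_of_set (set J))"
      unfolding sets by (simp add: scaleC_scaleC)
    moreover have "word_inversions J = Suc (word_inversions ?J')"
      using less.prems J by (simp only: word_inversions_descent)
    ultimately show ?thesis
      by (simp only:)
  qed
qed

text \<open>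
  The column \<open>s\<close> is moved to the left, one exchange at a time, until it stands next to \<open>r\<close>. Each
  exchange multiplies the minor by a scalar, and the minor with \<open>r\<close> and \<open>s\<close> adjacent vanishes.
  The columns \<open>r\<close> and \<open>s\<close> may carry the same number, or different numbers and equal entries.
\<close>

theorem minor_degenerate_columns:
  assumes "finite A" "card A = length J1 + length J2 + length J3 + 2" "p \<noteq> 0"
    and "minors_antisymmetric p M A (insert r (insert s (set J2)))"
    and vanish: "\<And>i k. i \<in> A \<Longrightarrow> k \<in> A \<Longrightarrow> i < k \<Longrightarrow> minor p M {i, k} [r, s] = 0"
  shows "minor p M A (J1 @ r # J2 @ s # J3) = 0"
  using assms(2,4)
proof (induction J2 arbitrary: J3 rule: rev_induct)
  case Nil
  then show ?case
    using minor_adjacent_columns[of A J1 J3 p M r s 0] assms(1) vanish by simp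
next
  case (snoc b J2)
  have IH: "minor p M A (J1 @ r # J2 @ s # b # J3) = 0"
    using snoc.prems by (intro snoc.IH) (auto elim: minors_antisymmetric_mono)
  show ?case
  proof (cases "b = s")
    case True
    then show ?thesis
      using IH by simp
  next
    case False
    \<comment> \<open>Antisymmetry is stated for increasing pairs of columns only, so the factor depends on the order of \<open>s\<close> and \<open>b\<close>.\<close>
    define c where "c = (if s < b then p else inverse p)"
    have "minor p M {i, k} [b, s] = c *\<^sub>C minor p M {i, k} [s, b]" if "i \<in> A" "k \<in> A" "i < k" for i k
    proof (cases "s < b")
      case True
      then show ?thesis
        using snoc.prems that by (auto simp: minors_antisymmetric_def c_def)
    next
      case False
      then have "minor p M {i, k} [s, b] = p *\<^sub>C minor p M {i, k} [b, s]"
        using snoc.prems that \<open>b \<noteq> s\<close> by (auto simp: minors_antisymmetric_def)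
      then show ?thesis
        using False \<open>p \<noteq> 0\<close> by (simp add: c_def scaleC_scaleC scaleC_one)
    qed
    then have "minor p M A ((J1 @ r # J2) @ b # s # J3) = c *\<^sub>C minor p M A ((J1 @ r # J2) @ s # b # J3)"
      using snoc.prems assms(1) by (intro minor_adjacent_columns) auto
    with IH show ?thesis
      by simp
  qed
qed

section \<open>Cauchy--Binet formula\<close>

text \<open>
  Multiplying out the entries of a product matrix; the commutation of \<open>M\<close> with \<open>N\<close> collects the
  entries of \<open>M\<close> on the left.
\<close>

lemma prod_list_matrix_product:
  fixes M N X :: "'a::complex_algebra_1 matrix"
  assumes "finite C" "length ys = length J"
    and "\<And>i j. i \<in> set ys \<Longrightarrow> j \<in> set J \<Longrightarrow> X i j = (\<Sum>l\<in>C. M i l * N l j)"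
    and comm: "\<And>i l l' j. i \<in> set ys \<Longrightarrow> l \<in> C \<Longrightarrow> l' \<in> C \<Longrightarrow> j \<in> set J \<Longrightarrow> M i l * N l' j = N l' j * M i l"
  shows "prod_list (map2 X ys J) =
    (\<Sum>zs | set zs \<subseteq> C \<and> length zs = length J.
       prod_list (map2 M ys zs) * prod_list (map2 N zs J))"
  using assms(2-)
proof (induction ys J rule: list_induct2)
  case Nil
  have "{zs. set zs \<subseteq> C \<and> length zs = length []} = {[]}"
    by auto
  then show ?case
    by simp
next
  case (Cons y ys j J)
  let ?Z = "\<lambda>n. {zs. set zs \<subseteq> C \<and> length zs = n}"
  let ?M = "\<lambda>zs. prod_list (map2 M ys zs)" and ?N = "\<lambda>zs. prod_list (map2 N zs J)"
  have *: "M i v * N l j = N l j * M i v" if "i \<in> set ys" "v \<in> C" "l \<in> C" for i v l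
    using Cons.prems(2) that by simp
  have comm_prod: "?M zs * N l j = N l j * ?M zs" if "l \<in> C" "zs \<in> ?Z (length J)" for l zs
  proof -
    have "prod_list (map2 M us vs) * N l j = N l j * prod_list (map2 M us vs)"
      if "length us = length vs" "set us \<subseteq> set ys" "set vs \<subseteq> C" for us vs
      using that
    proof (induction us vs rule: list_induct2)
      case (Cons u us v vs)
      have "M u v * N l j = N l j * M u v"
        using Cons.prems \<open>l \<in> C\<close> by (intro *) auto
      with Cons show ?case
        by (simp add: mult.assoc) (metis mult.assoc)
    qed simp
    then show ?thesis
      using that Cons.hyps by auto
  qed
  have "prod_list (map2 X (y # ys) (j # J)) =
      (\<Sum>l\<in>C. M y l * N l j) * (\<Sum>zs\<in>?Z (length J). ?M zs * ?N zs)"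
    using Cons by simp
  also have "\<dots> = (\<Sum>l\<in>C. \<Sum>zs\<in>?Z (length J). (M y l * ?M zs) * (N l j * ?N zs))"
    unfolding sum_product
  proof (intro sum.cong refl)
    fix l zs assume "l \<in> C" "zs \<in> ?Z (length J)"
    then have "M y l * (N l j * ?M zs) * ?N zs = M y l * (?M zs * N l j) * ?N zs"
      using comm_prod by simp
    then show "M y l * N l j * (?M zs * ?N zs) = (M y l * ?M zs) * (N l j * ?N zs)"
      by (simp add: mult.assoc)
  qed
  also have "\<dots> = (\<Sum>(zs, l)\<in>?Z (length J) \<times> C. (M y l * ?M zs) * (N l j * ?N zs))"
    by (subst sum.swap) (simp add: sum.cartesian_product)
  also have "\<dots> = (\<Sum>zs\<in>?Z (length (j # J)).
      prod_list (map2 M (y # ys) zs) * prod_list (map2 N zs (j # J)))"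
  proof -
    have "inj_on (\<lambda>(zs, l). l # zs) (?Z (length J) \<times> C)"
      by (auto simp: inj_on_def)
    moreover have "?Z (length (j # J)) = (\<lambda>(zs, l). l # zs) ` (?Z (length J) \<times> C)"
      by (simp only: lists_length_Suc_eq list.size add_0_right add_Suc_right One_nat_def)
    ultimately show ?thesis
      by (simp only: sum.reindex) (simp add: case_prod_beta)
  qed
  finally show ?case .
qed

text \<open>
  A minor of the product is the sum over all words \<open>zs\<close> of summation indices of
  \<open>minor p M A zs\<close> times a product of entries of \<open>N\<close>. Words with a repeated letter contribute
  nothing. Sorting the columns of the other minors gives the weights \<open>p ^ word_inversions zs\<close>,
  and the words with a given set \<open>L\<close> of letters add up to a minor of \<open>N\<close> on the rows \<open>L\<close>.
\<close>

theorem minor_cauchy_binet: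
  fixes M N X :: "'a::complex_algebra_1 matrix"
  assumes fin: "finite A" "finite C" and card: "card A = length J" and "p \<noteq> 0"
    and anti: "minors_antisymmetric p M A C"
    and diag: "\<And>i k l. i \<in> A \<Longrightarrow> k \<in> A \<Longrightarrow> i < k \<Longrightarrow> l \<in> C \<Longrightarrow> minor p M {i, k} [l, l] = 0"
    and X: "\<And>i j. i \<in> A \<Longrightarrow> j \<in> set J \<Longrightarrow> X i j = (\<Sum>l\<in>C. M i l * N l j)"
    and comm: "\<And>i l l' j. i \<in> A \<Longrightarrow> l \<in> C \<Longrightarrow> l' \<in> C \<Longrightarrow> j \<in> set J \<Longrightarrow> M i l * N l' j = N l' j * M i l"
  shows "minor p X A J =
    (\<Sum>L | L \<subseteq> C \<and> card L = length J. minor p M A (sorted_list_of_set L) * minor p N L J)"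
proof -
  let ?Z = "{zs. set zs \<subseteq> C \<and> length zs = length J}"
  let ?N = "\<lambda>zs. prod_list (map2 N zs J)"
  have finZ: "finite ?Z"
    using fin(2) by (rule finite_lists_length_eq)
  have "prod_list (map2 X ys J) = (\<Sum>zs\<in>?Z. prod_list (map2 M ys zs) * ?N zs)"
    if "ys \<in> permutations_of_set A" for ys
    using that card fin X comm
    by (intro prod_list_matrix_product) (auto simp: permutations_of_set_def distinct_card)
  then have "minor p X A J =
      (\<Sum>ys\<in>permutations_of_set A. \<Sum>zs\<in>?Z. p ^ word_inversions ys *\<^sub>C prod_list (map2 M ys zs) * ?N zs)"
    unfolding minor_def by (simp add: scaleC_sum_right mult_scaleC_left)
  also have "\<dots> = (\<Sum>zs\<in>?Z. minor p M A zs * ?N zs)"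
    unfolding minor_def by (subst sum.swap) (simp add: sum_distrib_right)
  also have "\<dots> = (\<Sum>zs\<in>{zs\<in>?Z. distinct zs}. minor p M A zs * ?N zs)"
  proof (intro sum.mono_neutral_right finZ ballI)
    fix zs assume zs: "zs \<in> ?Z - {zs\<in>?Z. distinct zs}"
    then obtain J1 J2 J3 r where "zs = J1 @ [r] @ J2 @ [r] @ J3"
      using not_distinct_decomp by blast
    moreover have "minor p M A (J1 @ r # J2 @ r # J3) = 0"
      using zs calculation card fin \<open>p \<noteq> 0\<close> diag
      by (intro minor_degenerate_columns minors_antisymmetric_mono[OF anti]) auto
    ultimately show "minor p M A zs * ?N zs = 0"
      by simp
  qed auto
  also have "\<dots> = (\<Sum>zs\<in>{zs\<in>?Z. distinct zs}.
      minor p M A (sorted_list_of_set (set zs)) * (p ^ word_inversions zs *\<^sub>C ?N zs))"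
  proof (intro sum.cong refl)
    fix zs assume "zs \<in> {zs\<in>?Z. distinct zs}"
    then have "minor p M A zs = p ^ word_inversions zs *\<^sub>C minor p M A (sorted_list_of_set (set zs))"
      using fin card by (intro minor_sort_columns minors_antisymmetric_mono[OF anti]) auto
    then show "minor p M A zs * ?N zs =
        minor p M A (sorted_list_of_set (set zs)) * (p ^ word_inversions zs *\<^sub>C ?N zs)"
      by (simp add: scaleC_algebra)
  qed
  also have "\<dots> = (\<Sum>(L, zs)\<in>(SIGMA L:{L. L \<subseteq> C \<and> card L = length J}. permutations_of_set L).
      minor p M A (sorted_list_of_set L) * (p ^ word_inversions zs *\<^sub>C ?N zs))"
    by (rule sum.reindex_bij_witness[of _ snd "\<lambda>zs. (set zs, zs)"])
       (auto simp: permutations_of_set_def distinct_card)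
  also have "\<dots> = (\<Sum>L | L \<subseteq> C \<and> card L = length J. minor p M A (sorted_list_of_set L) * minor p N L J)"
    unfolding minor_def sum_distrib_left
    using fin by (subst sum.Sigma) auto
  finally show ?thesis .
qed

section \<open>Linearity\<close>

text \<open>
  From here on statements concern intervals starting at \<open>1\<close> and powers of \<open>inverse (- q)\<close>; both
  are kept in this form by the simplifier.
\<close>

declare One_nat_def [simp del] inverse_minus_eq [simp del] upt_Suc [simp del]

lemma prod_list_sum_factor:
  fixes f :: "nat \<Rightarrow> 'a::ring_1"
  assumes "distinct xs" "s \<in> set xs" "f s = (\<Sum>t\<in>T. F t s)"
    and "\<And>t x. t \<in> T \<Longrightarrow> x \<in> set xs \<Longrightarrow> x \<noteq> s \<Longrightarrow> F t x = f x"
  shows "prod_list (map f xs) = (\<Sum>t\<in>T. prod_list (map (F t) xs))"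
  using assms(1,2,4)
proof (induction xs)
  case (Cons x xs)
  show ?case
  proof (cases "x = s")
    case True
    then have "prod_list (map (F t) xs) = prod_list (map f xs)" if "t \<in> T" for t
      using Cons.prems that by (intro arg_cong[of _ _ prod_list] map_cong) auto
    with True show ?thesis
      by (simp add: assms(3) sum_distrib_right)
  next
    case False
    with Cons show ?thesis
      by (simp add: sum_distrib_left)
  qed
qed simp

text \<open>
  Each monomial of the determinant has exactly one factor in a given column and exactly one in a
  given row. The position \<open>s\<close> of the factor that is a sum may therefore depend on the permutation,
  which covers columns and rows at once.
\<close>

lemma qdet_sum:
  assumes "\<And>\<tau>. \<tau> permutes {1..n} \<Longrightarrow> \<exists>s\<in>{1..n}. M (\<tau> s) s = (\<Sum>t\<in>T. F t (\<tau> s) s) \<and>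
    (\<forall>t\<in>T. \<forall>j\<in>{1..n}. j \<noteq> s \<longrightarrow> F t (\<tau> j) j = M (\<tau> j) j)"
  shows "qdet q n M = (\<Sum>t\<in>T. qdet q n (F t))"
proof -
  have "prod_list (map (\<lambda>j. M (\<tau> j) j) [1..<Suc n]) =
      (\<Sum>t\<in>T. prod_list (map (\<lambda>j. F t (\<tau> j) j) [1..<Suc n]))" if \<tau>: "\<tau> permutes {1..n}" for \<tau>
  proof -
    obtain s where "s \<in> {1..n}" "M (\<tau> s) s = (\<Sum>t\<in>T. F t (\<tau> s) s)"
      "\<forall>t\<in>T. \<forall>j\<in>{1..n}. j \<noteq> s \<longrightarrow> F t (\<tau> j) j = M (\<tau> j) j"
      using assms[OF \<tau>] by blast
    then show ?thesis
      by (intro prod_list_sum_factor[of _ s])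
        (auto simp: atLeastLessThanSuc_atLeastAtMost)
  qed
  then show ?thesis
    unfolding qdet_def by (subst sum.swap) (simp add: scaleC_sum_right)
qed

lemma qdet_column_sum:
  assumes "s \<in> {1..n}" "\<forall>i\<in>{1..n}. M i s = (\<Sum>t\<in>T. v t i)"
  shows "qdet q n M = (\<Sum>t\<in>T. qdet q n (replace_column s (v t) M))"
proof (rule qdet_sum)
  fix \<tau> assume "\<tau> permutes {1..n}"
  then have "\<tau> s \<in> {1..n}"
    using assms(1) permutes_in_image by metis
  then show "\<exists>s'\<in>{1..n}. M (\<tau> s') s' = (\<Sum>t\<in>T. replace_column s (v t) M (\<tau> s') s') \<and>
      (\<forall>t\<in>T. \<forall>j\<in>{1..n}. j \<noteq> s' \<longrightarrow> replace_column s (v t) M (\<tau> j) j = M (\<tau> j) j)"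
    using assms by (intro bexI[of _ s]) (auto simp: replace_column_def)
qed

lemma qdet_row_sum:
  assumes "r \<in> {1..n}" "\<forall>j\<in>{1..n}. M r j = (\<Sum>t\<in>T. v t j)"
  shows "qdet q n M = (\<Sum>t\<in>T. qdet q n (replace_row r (v t) M))"
proof (rule qdet_sum)
  fix \<tau> assume \<tau>: "\<tau> permutes {1..n}"
  then have "inv \<tau> r \<in> {1..n}"
    using assms(1) permutes_in_image permutes_inv by metis
  moreover have "\<tau> j = r \<longleftrightarrow> j = inv \<tau> r" for j
    using \<tau> by (metis permutes_inverses)
  ultimately show "\<exists>s'\<in>{1..n}. M (\<tau> s') s' = (\<Sum>t\<in>T. replace_row r (v t) M (\<tau> s') s') \<and>
      (\<forall>t\<in>T. \<forall>j\<in>{1..n}. j \<noteq> s' \<longrightarrow> replace_row r (v t) M (\<tau> j) j = M (\<tau> j) j)"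
    using assms by (intro bexI[of _ "inv \<tau> r"]) (auto simp: replace_row_def permutes_inverses(1)[OF \<tau>])
qed


section \<open>Permuted and coincident columns\<close>

lemma upt_split: "a \<le> b \<Longrightarrow> b \<le> c \<Longrightarrow> [a..<c] = [a..<b] @ [b..<c]"
  by (metis le_Suc_ex upt_add_eq_append)

lemma upt_split_at: "s \<in> {1..n} \<Longrightarrow> [1..<Suc n] = [1..<s] @ s # [Suc s..<Suc n]"
  using upt_split[of 1 s "Suc n"] by (simp add: upt_conv_Cons)

lemma sorted_list_of_interval: "sorted_list_of_set {1..n} = [1..<Suc n]"
  by (metis atLeastLessThanSuc_atLeastAtMost sorted_list_of_set_range)

lemma qdet_map_columns:
  "qdet q n (\<lambda>i j. M i (h j)) = minor (inverse (- q)) M {1..n} (map h [1..<Suc n])"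
  using qdet_map_eq_minor[of n "\<lambda>i. i" q M h] by (simp add: strict_mono_on_def)

text \<open>
  The determinant of a matrix with its columns listed in the order \<open>J\<close>.
\<close>

lemma minor_eq_epsilon_qdet:
  assumes "q \<noteq> 0" "cross_relations q n n M" "set J = {1..n}" "length J = n"
  shows "minor (inverse (- q)) M {1..n} J = q_epsilon q n J *\<^sub>C qdet q n M"
proof -
  have "distinct J"
    using assms by (simp add: card_distinct)
  then show ?thesis
    using assms minor_sort_columns[of "{1..n}" J "inverse (- q)" M] q_epsilon_eq[of q J]
    by (simp add: cross_relations_iff_minors qdet_eq_minor sorted_list_of_interval)
qed

lemma qdet_permute_columns:
  assumes "q \<noteq> 0" "cross_relations q n n M" "\<sigma> permutes {1..n}"
  shows "qdet q n (\<lambda>i j. M i (\<sigma> j)) = ((- q) powi (- int (inversions n \<sigma>))) *\<^sub>C qdet q n M"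
proof -
  let ?J = "map \<sigma> [1..<Suc n]"
  have J: "set ?J = {1..n}" "length ?J = n" "distinct ?J"
    using assms(3) by (simp_all add: atLeastLessThanSuc_atLeastAtMost permutes_image distinct_map
        permutes_inj_on)
  have "q_epsilon q n ?J = inverse (- q) ^ word_inversions ?J"
    using q_epsilon_eq[of q ?J] J by (simp)
  also have "\<dots> = (- q) powi (- int (inversions n \<sigma>))"
    using assms(3) by (simp add: powi_minus_of_nat inversions_eq_word_inversions permutes_inj_on)
  finally show ?thesis
    using minor_eq_epsilon_qdet[OF assms(1,2) J(1,2)] by (simp add: qdet_map_columns)
qed

text \<open>
  Replacing or permuting columns is a map \<open>h\<close> on column indices; the two-row minors that have to
  vanish are those of the columns that end up in positions \<open>r\<close> and \<open>s\<close>.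
\<close>

lemma qdet_map_degenerate_columns:
  assumes "q \<noteq> 0" "cross_relations q n n M" "h ` {1..n} \<subseteq> {1..n}"
    and "1 \<le> r" "r < s" "s \<le> n"
    and vanish: "\<And>i k. i \<in> {1..n} \<Longrightarrow> k \<in> {1..n} \<Longrightarrow> i < k \<Longrightarrow>
      minor (inverse (- q)) M {i, k} [h r, h s] = 0"
  shows "qdet q n (\<lambda>i j. M i (h j)) = 0"
proof -
  have "[1..<Suc n] = [1..<r] @ r # [Suc r..<s] @ s # [Suc s..<Suc n]"
    using assms(4-6) upt_split_at[of r n] upt_split[of "Suc r" s "Suc n"]
    by (simp add: upt_conv_Cons)
  then have J: "map h [1..<Suc n] =
      map h [1..<r] @ h r # map h [Suc r..<s] @ h s # map h [Suc s..<Suc n]"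
    by (metis list.map(2) map_append)
  have "insert (h r) (insert (h s) (set (map h [Suc r..<s]))) \<subseteq> {1..n}"
    using assms(3-6) by (auto simp: image_subset_iff)
  then show ?thesis
    unfolding qdet_map_columns J using assms
    by (intro minor_degenerate_columns)
      (auto simp: cross_relations_iff_minors elim!: minors_antisymmetric_mono)
qed

lemma qdet_degenerate_columns:
  assumes "q \<noteq> 0" "cross_relations q n n M" "1 \<le> r" "r < s" "s \<le> n"
    and "\<And>i k. i \<in> {1..n} \<Longrightarrow> k \<in> {1..n} \<Longrightarrow> i < k \<Longrightarrow>
      minor (inverse (- q)) M {i, k} [r, s] = 0"
  shows "qdet q n M = 0"
  using qdet_map_degenerate_columns[of q n M "\<lambda>j. j" r s] assms by simp

lemma qdet_replace_column_by_commuting: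
  assumes "q \<noteq> 0" "cross_relations q n n M" "r \<in> {1..n}" "s \<in> {1..n}" "r \<noteq> s"
    and "column_q_commutes q n M r"
  shows "qdet q n (replace_column s (\<lambda>i. M i r) M) = 0"
proof -
  have *: "replace_column s (\<lambda>i. M i r) M = (\<lambda>i j. M i (if j = s then r else j))"
    by (intro ext) (simp add: replace_column_def)
  show ?thesis
    unfolding * using assms
    by (intro qdet_map_degenerate_columns[of q n M _ "min r s" "max r s"])
       (auto simp: column_q_commutes_iff_minors min_def max_def)
qed

lemma minor_coincident_columns:
  assumes "i < k" "M i r = M i s" "M k r = M k s"
  shows "minor p M {i, k} [r, s] = minor p M {i, k} [r, r]"
    and "minor p M {i, k} [s, r] = minor p M {i, k} [r, r]"
  using assms by (simp_all add: minor_two_rows)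

text \<open>
  Two-row minors of coincident columns are insensitive to exchanging the columns, so
  antisymmetry forces \<open>(1 - p) x = 0\<close> for such a minor \<open>x\<close>. This leaves only \<open>q = -1\<close>, where the
  column relation is what makes \<open>x\<close> vanish.
\<close>

lemma qdet_coincident_columns:
  assumes "q \<noteq> 0" "cross_relations q n n M" "r \<in> {1..n}" "s \<in> {1..n}" "r \<noteq> s"
    and "\<forall>i\<in>{1..n}. M i r = M i s"
    and "column_q_commutes q n M r \<or> q \<noteq> - 1"
  shows "qdet q n M = 0"
proof (rule qdet_degenerate_columns)
  let ?p = "inverse (- q)"
  fix i k assume ik: "i \<in> {1..n}" "k \<in> {1..n}" "i < k"
  note eq = minor_coincident_columns[of i k M r s, OF ik(3)]
    minor_coincident_columns[of i k M s r, OF ik(3)]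
  have "minor ?p M {i, k} [r, r] = 0"
  proof (cases "column_q_commutes q n M r")
    case True
    with ik show ?thesis
      by (auto simp: column_q_commutes_iff_minors)
  next
    case False
    have "minor ?p M {i, k} [max r s, min r s] = ?p *\<^sub>C minor ?p M {i, k} [min r s, max r s]"
      using assms ik by (auto simp: cross_relations_iff_minors minors_antisymmetric_def min_def max_def)
    then have "minor ?p M {i, k} [r, r] = ?p *\<^sub>C minor ?p M {i, k} [r, r]"
      using eq assms(6) ik by (auto simp: min_def max_def split: if_splits)
    then have "(1 - ?p) *\<^sub>C minor ?p M {i, k} [r, r] = 0"
      using scaleC_add_left[of 1 "- ?p" "minor ?p M {i, k} [r, r]"]
      by (simp add: scaleC_one scaleC_minus_left del: minus_add_distrib)
    moreover have "1 - ?p \<noteq> 0"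
    proof
      assume "1 - ?p = 0"
      then have "- q = 1"
        by simp
      then show False
        using assms(7) False by (simp add: minus_equation_iff)
    qed
    ultimately show ?thesis
      by (simp add: scaleC_eq_0_iff)
  qed
  then show "minor ?p M {i, k} [min r s, max r s] = 0"
    using eq assms(6) ik by (auto simp: min_def max_def)
qed (use assms in \<open>auto simp: min_def max_def\<close>)


section \<open>Products of matrices\<close>

lemma bij_betw_set_increasing:
  "bij_betw set (increasing_multi_indices n m) {C. C \<subseteq> {1..n} \<and> card C = m}"
proof (rule bij_betw_byWitness[of _ sorted_list_of_set])
  show "sorted_list_of_set ` {C. C \<subseteq> {1..n} \<and> card C = m} \<subseteq> increasing_multi_indices n m"
  proof safe
    fix C assume "C \<subseteq> {1..n}"
    moreover from this have "finite C"
      by (rule finite_subset) simp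
    ultimately show "sorted_list_of_set C \<in> increasing_multi_indices n (card C)"
      by (simp add: increasing_multi_indices_def)
  qed
  show "\<forall>C\<in>{C. C \<subseteq> {1..n} \<and> card C = m}. set (sorted_list_of_set C) = C"
    using finite_subset[of _ "{1..n}"] by auto
qed (auto simp: increasing_multi_indices_def sorted_list_of_set.idem_if_sorted_distinct
    strict_sorted_iff distinct_card)

lemma qdet_cauchy_binet:
  fixes M N :: "'a::complex_algebra_1 matrix"
  assumes "q \<noteq> 0" "q_manin q m p M"
    and "\<forall>i\<in>{1..m}. \<forall>j\<in>{1..p}. \<forall>k\<in>{1..p}. \<forall>l\<in>{1..n}. commutator (M i j) (N k l) = 0"
    and "A \<subseteq> {1..m}" "card A = length J" "set J \<subseteq> {1..n}"
  shows "minor (inverse (- q)) (mmult p M N) A J =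
    (\<Sum>L | L \<subseteq> {1..p} \<and> card L = length J.
       minor (inverse (- q)) M A (sorted_list_of_set L) * minor (inverse (- q)) N L J)"
proof (rule minor_cauchy_binet)
  show "minors_antisymmetric (inverse (- q)) M A {1..p}"
    using assms(1,2,4) unfolding q_manin_def
    by (auto simp: cross_relations_iff_minors elim: minors_antisymmetric_mono)
  show "minor (inverse (- q)) M {i, k} [l, l] = 0"
    if "i \<in> A" "k \<in> A" "i < k" "l \<in> {1..p}" for i k l
    using assms(2,4) that unfolding q_manin_def column_relations_def column_q_commutes_iff_minors
    by blast
  show "M i l * N l' j = N l' j * M i l"
    if "i \<in> A" "l \<in> {1..p}" "l' \<in> {1..p}" "j \<in> set J" for i l l' j
  proof -
    have "commutator (M i l) (N l' j) = 0"
      using assms(3,4,6) that by blast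
    then show ?thesis
      by (simp add: commutator_def)
  qed
  show "finite A"
    using assms(4) by (rule finite_subset) simp
qed (use assms(1,5) in \<open>simp_all add: mmult_def\<close>)

lemma qdet_submat_mmult:
  fixes M N :: "'a::complex_algebra_1 matrix"
  assumes "q \<noteq> 0" "q_manin q m p M"
    and "\<forall>i\<in>{1..m}. \<forall>j\<in>{1..p}. \<forall>k\<in>{1..p}. \<forall>l\<in>{1..n}. commutator (M i j) (N k l) = 0"
    and I: "I \<in> increasing_multi_indices m r" and J: "length J = r" "set J \<subseteq> {1..n}"
  shows "qdet q r (submat (mmult p M N) I J) =
    (\<Sum>L\<in>increasing_multi_indices p r. qdet q r (submat M I L) * qdet q r (submat N L J))"
proof -
  have I': "sorted_wrt (<) I" "length I = r" "set I \<subseteq> {1..m}" "card (set I) = r"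
    using I by (auto simp: increasing_multi_indices_def strict_sorted_iff distinct_card)
  have "qdet q r (submat (mmult p M N) I J) = (\<Sum>L | L \<subseteq> {1..p} \<and> card L = r.
      minor (inverse (- q)) M (set I) (sorted_list_of_set L) * minor (inverse (- q)) N L J)"
    using I' J by (simp add: qdet_submat qdet_cauchy_binet[OF assms(1-3)])
  also have "\<dots> = (\<Sum>L\<in>increasing_multi_indices p r.
      minor (inverse (- q)) M (set I) (sorted_list_of_set (set L)) * minor (inverse (- q)) N (set L) J)"
    by (rule sum.reindex_bij_betw[OF bij_betw_set_increasing, symmetric])
  also have "\<dots> = (\<Sum>L\<in>increasing_multi_indices p r. qdet q r (submat M I L) * qdet q r (submat N L J))"
    using I' J by (intro sum.cong) (auto simp: increasing_multi_indices_def qdet_submat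
        sorted_list_of_set.idem_if_sorted_distinct strict_sorted_iff)
  finally show ?thesis .
qed

lemma qdet_mmult:
  fixes M N :: "'a::complex_algebra_1 matrix"
  assumes "q \<noteq> 0" "q_manin q n n M"
    and "\<forall>i\<in>{1..n}. \<forall>j\<in>{1..n}. \<forall>k\<in>{1..n}. \<forall>l\<in>{1..n}. commutator (M i j) (N k l) = 0"
  shows "qdet q n (mmult n M N) = qdet q n M * qdet q n N"
proof -
  have "{L. L \<subseteq> {1..n} \<and> card L = n} = {{1..n}}"
    using card_subset_eq[of "{1..n}"] by auto
  then show ?thesis
    using qdet_cauchy_binet[OF assms, of "{1..n}" "[1..<Suc n]"]
    by (simp add: qdet_eq_minor sorted_list_of_interval atLeastLessThanSuc_atLeastAtMost)
qed

text \<open>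
  The Cauchy--Binet formula writes two-row minors of \<open>M N\<close> as combinations of two-row minors of
  \<open>N\<close> with coefficients from \<open>M\<close> on the left, and the Manin relations are linear conditions on
  two-row minors.
\<close>

lemma q_manin_mmult:
  fixes M N :: "'a::complex_algebra_1 matrix"
  assumes "q \<noteq> 0" "q_manin q m p M" "q_manin q p n N"
    and "\<forall>i\<in>{1..m}. \<forall>j\<in>{1..p}. \<forall>k\<in>{1..p}. \<forall>l\<in>{1..n}. commutator (M i j) (N k l) = 0"
  shows "q_manin q m n (mmult p M N)"
proof -
  let ?p = "inverse (- q)"
  have len: "length [j, l] = 2" for j l :: nat
    by simp
  have expand: "minor ?p (mmult p M N) {i, k} [j, l] = (\<Sum>L | L \<subseteq> {1..p} \<and> card L = 2.
      minor ?p M {i, k} (sorted_list_of_set L) * minor ?p N L [j, l])"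
    if "i \<in> {1..m}" "k \<in> {1..m}" "i < k" "j \<in> {1..n}" "l \<in> {1..n}" for i k j l
    using that qdet_cauchy_binet[OF assms(1,2,4), of "{i, k}" "[j, l]"] unfolding len by simp
  have pair: "\<exists>a b. L = {a, b} \<and> a < b \<and> a \<in> {1..p} \<and> b \<in> {1..p}"
    if "L \<subseteq> {1..p}" "card L = 2" for L
  proof -
    obtain a b where "L = {a, b}" "a \<noteq> b"
      using \<open>card L = 2\<close> by (auto simp: card_2_iff)
    moreover from this have "L = {b, a}" "a < b \<or> b < a"
      by auto
    ultimately show ?thesis
      using \<open>L \<subseteq> {1..p}\<close> by blast
  qed
  have N: "minors_antisymmetric ?p N {1..p} {1..n}"
    "\<And>j. j \<in> {1..n} \<Longrightarrow> column_q_commutes q p N j"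
    using assms(1,3) by (auto simp: q_manin_def column_relations_def cross_relations_iff_minors)
  have "minor ?p N L [j, j] = 0" if "j \<in> {1..n}" "L \<subseteq> {1..p}" "card L = 2" for j L
    using pair[OF that(2,3)] N(2)[OF that(1)] unfolding column_q_commutes_iff_minors by blast
  then have "minor ?p (mmult p M N) {i, k} [j, j] = 0"
    if "i \<in> {1..m}" "k \<in> {1..m}" "i < k" "j \<in> {1..n}" for i k j
    unfolding expand[OF that that(4)] using that(4) by (intro sum.neutral) simp
  then have "column_relations q m n (mmult p M N)"
    unfolding column_relations_def column_q_commutes_iff_minors by blast
  moreover have *: "minor ?p N L [l, j] = ?p *\<^sub>C minor ?p N L [j, l]"
    if "j \<in> {1..n}" "l \<in> {1..n}" "j < l" "L \<subseteq> {1..p}" "card L = 2" for j l L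
    using pair[OF that(4,5)] N(1) that(1-3) unfolding minors_antisymmetric_def by blast
  have "minor ?p (mmult p M N) {i, k} [l, j] = ?p *\<^sub>C minor ?p (mmult p M N) {i, k} [j, l]"
    if "i \<in> {1..m}" "k \<in> {1..m}" "i < k" "j \<in> {1..n}" "l \<in> {1..n}" "j < l" for i k j l
    unfolding expand[OF that(1-5)] expand[OF that(1-3,5,4)] scaleC_sum_right mult_scaleC_right[symmetric]
    using that(4-6) * by (intro sum.cong) auto
  then have "minors_antisymmetric ?p (mmult p M N) {1..m} {1..n}"
    unfolding minors_antisymmetric_def by blast
  then have "cross_relations q m n (mmult p M N)"
    using assms(1) by (simp add: cross_relations_iff_minors)
  ultimately show ?thesis
    by (simp add: q_manin_def)
qed


section \<open>Column expansion\<close>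

lemma card_below_singleton: "card {b\<in>{i}. b < (a::nat)} = (if i < a then 1 else 0)"
proof (cases "i < a")
  case True
  then have "{b\<in>{i}. b < a} = {i}"
    by auto
  with True show ?thesis
    by simp
next
  case False
  then have "{b\<in>{i}. b < a} = {}"
    by auto
  with False show ?thesis
    by (simp only: card.empty if_False)
qed

lemma minor_Cons:
  assumes "finite A" "card A = Suc (length J)"
  shows "minor p M A (j # J) =
    (\<Sum>i\<in>A. p ^ card {k\<in>A. k < i} *\<^sub>C (M i j * minor p M (A - {i}) J))"
proof -
  have "{B. B \<subseteq> A \<and> card B = length [j]} = (\<lambda>i. {i}) ` A"
    by (auto elim: card_1_singletonE simp flip: One_nat_def)
  moreover have "cross_inversions {i} (A - {i}) = card {k\<in>A. k < i}" for i
  proof -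
    have "{k\<in>A - {i}. k < i} = {k\<in>A. k < i}"
      by auto
    then show ?thesis
      by (simp add: cross_inversions_def)
  qed
  ultimately show ?thesis
    using minor_laplace[of A "[j]" J p M] assms by (simp add: sum.reindex inj_on_def)
qed

lemma minor_snoc:
  assumes "finite A" "card A = Suc (length J)"
  shows "minor p M A (J @ [j]) =
    (\<Sum>i\<in>A. p ^ card {k\<in>A. i < k} *\<^sub>C (minor p M (A - {i}) J * M i j))"
proof -
  have "B \<in> (\<lambda>i. A - {i}) ` A" if "B \<subseteq> A" "card B = length J" for B
  proof -
    have "card (A - B) = 1"
      using that assms by (simp add: card_Diff_subset finite_subset)
    then obtain i where "A - B = {i}"
      using card_1_singletonE by blast
    with that show ?thesis
      by (intro image_eqI[of _ _ i]) auto
  qed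
  then have "{B. B \<subseteq> A \<and> card B = length J} = (\<lambda>i. A - {i}) ` A"
    using assms by auto
  moreover have "inj_on (\<lambda>i. A - {i}) A"
    by (auto simp: inj_on_def)
  moreover have "cross_inversions (A - {i}) {i} = card {k\<in>A. i < k}" for i
  proof -
    have "cross_inversions (A - {i}) {i} = card {k\<in>A - {i}. i < k}"
      unfolding cross_inversions_def card_below_singleton using assms(1)
      by (simp add: sum.If_cases Int_def)
    also have "{k\<in>A - {i}. i < k} = {k\<in>A. i < k}"
      by auto
    finally show ?thesis .
  qed
  moreover have "A - (A - {i}) = {i}" if "i \<in> A" for i
    using that by auto
  ultimately show ?thesis
    using minor_laplace[of A J "[j]" p M] assms by (simp add: sum.reindex)
qed

text \<open>
  The column \<open>t\<close> put in front need not be the deleted column \<open>s\<close>: for \<open>t = s\<close> this becomes the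
  expansion along column \<open>s\<close>, and for \<open>t \<noteq> s\<close> the vanishing sum behind the adjugate matrix.
\<close>

lemma minor_front_column:
  assumes "s \<in> {1..n}"
  shows "minor (inverse (- q)) M {1..n} (t # [1..<s] @ [Suc s..<Suc n]) =
    (\<Sum>r = 1..n. inverse (- q) ^ (r - 1) *\<^sub>C (M r t * qdet q (n - 1) (delete_row_col r s M)))"
proof -
  have "card {k \<in> {1..n}. k < r} = r - 1" if "r \<in> {1..n}" for r
  proof -
    have "{k \<in> {1..n}. k < r} = {1..<r}"
      using that by auto
    then show ?thesis
      by simp
  qed
  with assms show ?thesis
    by (subst minor_Cons) (auto simp: qdet_delete_row_col intro!: sum.cong)
qed

lemma minor_back_column:
  assumes "s \<in> {1..n}"
  shows "minor (inverse (- q)) M {1..n} (([1..<s] @ [Suc s..<Suc n]) @ [t]) =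
    (\<Sum>r = 1..n. inverse (- q) ^ (n - r) *\<^sub>C (qdet q (n - 1) (delete_row_col r s M) * M r t))"
proof -
  have "card {k \<in> {1..n}. r < k} = n - r" if "r \<in> {1..n}" for r
  proof -
    have "{k \<in> {1..n}. r < k} = {r<..n}"
      using that by auto
    then show ?thesis
      by simp
  qed
  with assms show ?thesis
    by (subst minor_snoc) (auto simp: qdet_delete_row_col intro!: sum.cong)
qed

lemma qdet_expand_first_column:
  assumes "n \<ge> 1"
  shows "qdet q n M =
    (\<Sum>r = 1..n. ((- q) powi (1 - int r)) *\<^sub>C (M r 1 * qdet q (n - 1) (delete_row_col r 1 M)))"
proof -
  have "(- q) powi (1 - int r) = inverse (- q) ^ (r - 1)" if "r \<ge> 1" for r
    using that powi_minus_of_nat[of "- q" "r - 1"] by (simp add: of_nat_diff)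
  then show ?thesis
    using minor_front_column[of 1 n q M 1] upt_split_at[of 1 n] assms
    by (simp add: qdet_eq_minor[of q n])
qed

lemma qdet_expand_last_column:
  assumes "n \<ge> 1"
  shows "qdet q n M =
    (\<Sum>r = 1..n. ((- q) powi (int r - int n)) *\<^sub>C (qdet q (n - 1) (delete_row_col r n M) * M r n))"
proof -
  have "(- q) powi (int r - int n) = inverse (- q) ^ (n - r)" if "r \<le> n" for r
    using that powi_minus_of_nat[of "- q" "n - r"] by (simp add: of_nat_diff)
  then show ?thesis
    using minor_back_column[of n n q M n] upt_split_at[of n n] assms
    by (simp add: qdet_eq_minor[of q n])
qed

text \<open>
  Moving column \<open>s\<close> to the front crosses \<open>s - 1\<close> columns, moving it to the end crosses \<open>n - s\<close>.
\<close>

lemma minor_move_column: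
  assumes "q \<noteq> 0" "cross_relations q n n M" "s \<in> {1..n}"
  shows "minor (inverse (- q)) M {1..n} (s # [1..<s] @ [Suc s..<Suc n]) =
      inverse (- q) ^ (s - 1) *\<^sub>C qdet q n M"
    and "minor (inverse (- q)) M {1..n} (([1..<s] @ [Suc s..<Suc n]) @ [s]) =
      inverse (- q) ^ (n - s) *\<^sub>C qdet q n M"
proof -
  define J where "J = [1..<s] @ [Suc s..<Suc n]"
  have J: "set J = {1..n} - {s}" "sorted_wrt (<) J" "distinct J"
  proof -
    have "sorted_wrt (<) ([1..<s] @ s # [Suc s..<Suc n])"
      unfolding upt_split_at[OF assms(3), symmetric] by (rule sorted_wrt_upt)
    then show "sorted_wrt (<) J"
      unfolding J_def sorted_wrt_append by simp
    then show "distinct J"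
      by (simp add: strict_sorted_iff)
    have "set J = {1..<s} \<union> {Suc s..<Suc n}"
      by (simp add: J_def)
    with assms(3) show "set J = {1..n} - {s}"
      by auto
  qed
  have inv0: "word_inversions J = 0"
    using J(2) by (rule word_inversions_strict_sorted)
  have perm: "set (s # J) = {1..n}" "distinct (s # J)" "set (J @ [s]) = {1..n}" "distinct (J @ [s])"
    unfolding list.set set_append distinct.simps distinct_append J(1) using J(3) assms(3) by auto
  then have len: "length (s # J) = n" "length (J @ [s]) = n"
    using distinct_card[OF perm(2)] distinct_card[OF perm(4)] by simp_all
  have "{y \<in> set J. y < s} = {1..<s}"
    unfolding J(1) using assms(3) by auto
  then have "word_inversions (s # J) = s - 1"
    using inv0 by simp
  then have "q_epsilon q n (s # J) = inverse (- q) ^ (s - 1)"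
    using q_epsilon_eq[of q "s # J"] perm(2) unfolding len by presburger
  then show "minor (inverse (- q)) M {1..n} (s # [1..<s] @ [Suc s..<Suc n]) =
      inverse (- q) ^ (s - 1) *\<^sub>C qdet q n M"
    using minor_eq_epsilon_qdet[OF assms(1,2) perm(1) len(1)] unfolding J_def[symmetric] by metis
  have "word_inversions (J @ [s]) = n - s"
  proof -
    have "cross_inversions (set J) (set [s]) = card {y \<in> set J. s < y}"
      unfolding cross_inversions_def list.set card_below_singleton
      by (simp add: sum.If_cases Int_def)
    also have "{y \<in> set J. s < y} = {s<..n}"
      unfolding J(1) using assms(3) by auto
    finally show ?thesis
      using word_inversions_append[OF perm(4)] inv0 by simp
  qed
  then have "q_epsilon q n (J @ [s]) = inverse (- q) ^ (n - s)"
    using q_epsilon_eq[of q "J @ [s]"] perm(4) unfolding len by presburger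
  then show "minor (inverse (- q)) M {1..n} (([1..<s] @ [Suc s..<Suc n]) @ [s]) =
      inverse (- q) ^ (n - s) *\<^sub>C qdet q n M"
    using minor_eq_epsilon_qdet[OF assms(1,2) perm(3) len(2)] unfolding J_def[symmetric] by metis
qed

text \<open>
  Multiplication by a power of \<open>p\<close> turns the coefficients of the expansion along column \<open>s\<close> into
  those of the expansion along a column in front.
\<close>

lemma minor_front_column_scaled:
  assumes "q \<noteq> 0" "s \<in> {1..n}"
  shows "inverse (- q) ^ (s - 1) *\<^sub>C (\<Sum>r = 1..n.
      ((- q) powi (int s - int r)) *\<^sub>C (M r t * qdet q (n - 1) (delete_row_col r s M))) =
    minor (inverse (- q)) M {1..n} (t # [1..<s] @ [Suc s..<Suc n])"
proof -
  have "inverse (- q) ^ (s - 1) * (- q) powi (int s - int r) = inverse (- q) ^ (r - 1)"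
    if "r \<in> {1..n}" for r
  proof -
    have "inverse (- q) ^ (s - 1) * (- q) powi (int s - int r) =
        (- q) powi (- int (s - 1) + (int s - int r))"
      using assms(1) power_int_add[of "- q" "- int (s - 1)" "int s - int r"]
      unfolding powi_minus_of_nat by (metis neg_equal_0_iff_equal)
    also have "- int (s - 1) + (int s - int r) = - int (r - 1)"
      using that assms(2) by auto
    finally show ?thesis
      by (simp only: powi_minus_of_nat)
  qed
  then show ?thesis
    unfolding minor_front_column[OF assms(2)] scaleC_sum_right scaleC_scaleC
    by (intro sum.cong refl) (simp only:)
qed

lemma minor_back_column_scaled:
  assumes "q \<noteq> 0" "s \<in> {1..n}"
  shows "inverse (- q) ^ (n - s) *\<^sub>C (\<Sum>r = 1..n.
      ((- q) powi (int r - int s)) *\<^sub>C (qdet q (n - 1) (delete_row_col r s M) * M r t)) =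
    minor (inverse (- q)) M {1..n} (([1..<s] @ [Suc s..<Suc n]) @ [t])"
proof -
  have "inverse (- q) ^ (n - s) * (- q) powi (int r - int s) = inverse (- q) ^ (n - r)"
    if "r \<in> {1..n}" for r
  proof -
    have "inverse (- q) ^ (n - s) * (- q) powi (int r - int s) =
        (- q) powi (- int (n - s) + (int r - int s))"
      using assms(1) power_int_add[of "- q" "- int (n - s)" "int r - int s"]
      unfolding powi_minus_of_nat by (metis neg_equal_0_iff_equal)
    also have "- int (n - s) + (int r - int s) = - int (n - r)"
      using that assms(2) by auto
    finally show ?thesis
      by (simp only: powi_minus_of_nat)
  qed
  then show ?thesis
    unfolding minor_back_column[OF assms(2)] scaleC_sum_right scaleC_scaleC
    by (intro sum.cong refl) (simp only:)
qed

lemma qdet_expand_column: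
  assumes "q \<noteq> 0" "cross_relations q n n M" "s \<in> {1..n}"
  shows "qdet q n M =
      (\<Sum>r = 1..n. ((- q) powi (int s - int r)) *\<^sub>C (M r s * qdet q (n - 1) (delete_row_col r s M)))"
    and "qdet q n M =
      (\<Sum>r = 1..n. ((- q) powi (int r - int s)) *\<^sub>C (qdet q (n - 1) (delete_row_col r s M) * M r s))"
proof -
  note front = minor_front_column_scaled[OF assms(1,3), of M s]
    and last = minor_back_column_scaled[OF assms(1,3), of M s]
  show "qdet q n M =
      (\<Sum>r = 1..n. ((- q) powi (int s - int r)) *\<^sub>C (M r s * qdet q (n - 1) (delete_row_col r s M)))"
    using front[symmetric] unfolding minor_move_column(1)[OF assms]
    by (rule scaleC_cancel[rotated]) (simp add: assms(1))
  show "qdet q n M =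
      (\<Sum>r = 1..n. ((- q) powi (int r - int s)) *\<^sub>C (qdet q (n - 1) (delete_row_col r s M) * M r s))"
    using last[symmetric] unfolding minor_move_column(2)[OF assms]
    by (rule scaleC_cancel[rotated]) (simp add: assms(1))
qed

section \<open>Laplace expansion along increasing multi-indices\<close>

text \<open>
  Below the \<open>l\<close>-th entry \<open>k\<close> of \<open>K\<close> there are \<open>k - 1\<close> positive numbers, of which \<open>l - 1\<close> belong to
  \<open>K\<close>; the remaining \<open>k - l\<close> are inversions with the complement.
\<close>

lemma cross_inversions_complement:
  assumes "K \<in> increasing_multi_indices n m"
  shows "int (cross_inversions (set K) ({1..n} - set K)) = (\<Sum>l = 1..m. int (K ! (l - 1)) - int l)"
proof -
  have K: "length K = m" "sorted_wrt (<) K" "set K \<subseteq> {1..n}" "distinct K"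
    using assms by (auto simp: increasing_multi_indices_def strict_sorted_iff)
  \<comment> \<open>The positions of a list start at \<open>0\<close>, hence \<open>Suc l\<close>.\<close>
  have "int (card {b \<in> {1..n} - set K. b < K ! l}) = int (K ! l) - int (Suc l)" if "l < m" for l
  proof -
    have below: "{x \<in> set K. x < K ! l} = (!) K ` {..<l}"
    proof (intro set_eqI iffI)
      fix x assume "x \<in> {x \<in> set K. x < K ! l}"
      then obtain k where "k < m" "x = K ! k" "K ! k < K ! l"
        using K(1) by (auto simp: in_set_conv_nth)
      then show "x \<in> (!) K ` {..<l}"
        using K(1,2) that sorted_wrt_nth_less[of "(<)" K l k]
        by (cases k l rule: linorder_cases) auto
    qed (use K(1,2) that in \<open>auto simp: sorted_wrt_nth_less\<close>)
    have card_below: "card {x \<in> set K. x < K ! l} = l"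
      unfolding below using K(1,4) that
      by (subst card_image) (auto simp: inj_on_def nth_eq_iff_index_eq)
    have mem: "K ! l \<in> {1..n}"
      using K(1,3) that nth_mem by blast
    have "{b \<in> {1..n} - set K. b < K ! l} = {1..<K ! l} - {x \<in> set K. x < K ! l}"
      using mem by auto
    also have "card \<dots> = (K ! l - 1) - l"
      using K(3) by (subst card_Diff_subset) (auto simp: card_below)
    finally have "card {b \<in> {1..n} - set K. b < K ! l} = (K ! l - 1) - l" .
    moreover have "l \<le> K ! l - 1"
    proof -
      have "{x \<in> set K. x < K ! l} \<subseteq> {1..<K ! l}"
        using K(3) by auto
      from card_mono[OF _ this] show ?thesis
        by (simp add: card_below)
    qed
    moreover have "1 \<le> K ! l"
      using mem by simp
    ultimately show ?thesis
      by linarith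
  qed
  note count = this
  have "int (cross_inversions (set K) ({1..n} - set K)) =
      (\<Sum>a\<in>set K. int (card {b \<in> {1..n} - set K. b < a}))"
    by (simp add: cross_inversions_def)
  also have "\<dots> = (\<Sum>l<m. int (card {b \<in> {1..n} - set K. b < K ! l}))"
    using K(1,4) by (intro sum.reindex_bij_betw[symmetric] bij_betw_nth) auto
  also have "\<dots> = (\<Sum>l<m. int (K ! l) - int (Suc l))"
    by (rule sum.cong[OF refl], rule count) simp
  also have "\<dots> = (\<Sum>l = 1..m. int (K ! (l - 1)) - int l)"
    by (rule sum.reindex_bij_witness[of _ "\<lambda>l. l - 1" Suc]) auto
  finally show ?thesis .
qed

lemma complement_multi_index_props:
  assumes "K \<in> increasing_multi_indices n m"
  shows "sorted_wrt (<) (complement_multi_index n K)"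
    and "set (complement_multi_index n K) = {1..n} - set K"
    and "length (complement_multi_index n K) = n - m"
proof -
  show sorted: "sorted_wrt (<) (complement_multi_index n K)"
    by (simp add: complement_multi_index_def sorted_wrt_filter)
  show set: "set (complement_multi_index n K) = {1..n} - set K"
    by (auto simp: complement_multi_index_def)
  have "length (complement_multi_index n K) = card ({1..n} - set K)"
    using sorted by (simp add: strict_sorted_iff distinct_card flip: set)
  also have "\<dots> = n - m"
    using assms by (subst card_Diff_subset)
      (auto simp: increasing_multi_indices_def strict_sorted_iff distinct_card)
  finally show "length (complement_multi_index n K) = n - m" .
qed

lemma minor_laplace_increasing:
  assumes "m \<le> n" "length I1 = m" "length I2 = n - m"
  shows "minor (inverse (- q)) M {1..n} (I1 @ I2) =
    (\<Sum>K\<in>increasing_multi_indices n m.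
       ((- q) powi (- (\<Sum>l = 1..m. int (K ! (l - 1)) - int l))) *\<^sub>C
         (qdet q m (submat M K I1) *
          qdet q (n - m) (submat M (complement_multi_index n K) I2)))"
proof -
  let ?p = "inverse (- q)"
  let ?F = "\<lambda>B. ?p ^ cross_inversions B ({1..n} - B) *\<^sub>C (minor ?p M B I1 * minor ?p M ({1..n} - B) I2)"
  have "minor ?p M {1..n} (I1 @ I2) = (\<Sum>B | B \<subseteq> {1..n} \<and> card B = m. ?F B)"
    using minor_laplace[of "{1..n}" I1 I2 ?p M] assms by simp
  also have "\<dots> = (\<Sum>K\<in>increasing_multi_indices n m. ?F (set K))"
    by (rule sum.reindex_bij_betw[OF bij_betw_set_increasing, symmetric])
  also have "\<dots> = (\<Sum>K\<in>increasing_multi_indices n m.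
       ((- q) powi (- (\<Sum>l = 1..m. int (K ! (l - 1)) - int l))) *\<^sub>C
         (qdet q m (submat M K I1) * qdet q (n - m) (submat M (complement_multi_index n K) I2)))"
  proof (intro sum.cong refl)
    fix K assume K: "K \<in> increasing_multi_indices n m"
    then have "qdet q m (submat M K I1) = minor ?p M (set K) I1"
      using assms by (intro qdet_submat) (auto simp: increasing_multi_indices_def)
    moreover have "qdet q (n - m) (submat M (complement_multi_index n K) I2) =
        minor ?p M ({1..n} - set K) I2"
      using complement_multi_index_props[OF K] assms by (simp add: qdet_submat)
    moreover have "(- q) powi (- (\<Sum>l = 1..m. int (K ! (l - 1)) - int l)) =
        ?p ^ cross_inversions (set K) ({1..n} - set K)"
      unfolding cross_inversions_complement[OF K, symmetric] by (rule powi_minus_of_nat)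
    ultimately show "?F (set K) = ((- q) powi (- (\<Sum>l = 1..m. int (K ! (l - 1)) - int l))) *\<^sub>C
        (qdet q m (submat M K I1) * qdet q (n - m) (submat M (complement_multi_index n K) I2))"
      by (simp only:)
  qed
  finally show ?thesis .
qed

text \<open>
  With the column relations available, repeated columns are covered too: both sides vanish.
\<close>

lemma minor_eq_epsilon_qdet_manin:
  assumes "q \<noteq> 0" "q_manin q n n M" "set J \<subseteq> {1..n}" "length J = n"
  shows "minor (inverse (- q)) M {1..n} J = q_epsilon q n J *\<^sub>C qdet q n M"
proof (cases "distinct J")
  case True
  then have "set J = {1..n}"
    using assms(3,4) distinct_card[OF True] by (intro card_subset_eq) simp_all
  then show ?thesis
    using assms by (intro minor_eq_epsilon_qdet) (simp_all add: q_manin_def)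
next
  case False
  then obtain J1 J2 J3 r where J: "J = J1 @ [r] @ J2 @ [r] @ J3"
    using not_distinct_decomp by blast
  have sub: "insert r (insert r (set J2)) \<subseteq> {1..n}" "r \<in> {1..n}"
    using assms(3) by (simp_all add: J)
  have "minor (inverse (- q)) M {1..n} (J1 @ r # J2 @ r # J3) = 0"
  proof (rule minor_degenerate_columns)
    show "minors_antisymmetric (inverse (- q)) M {1..n} (insert r (insert r (set J2)))"
      using assms(1,2) sub(1)
      by (auto simp: q_manin_def cross_relations_iff_minors elim: minors_antisymmetric_mono)
    show "minor (inverse (- q)) M {i, k} [r, r] = 0" if "i \<in> {1..n}" "k \<in> {1..n}" "i < k" for i k
      using assms(2) that sub(2)
      unfolding q_manin_def column_relations_def column_q_commutes_iff_minors by blast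
  qed (use assms in \<open>simp_all add: J\<close>)
  with False show ?thesis
    by (simp add: J q_epsilon_def)
qed

text \<open>
  Splitting off the first block by a two-block Laplace expansion leaves the remaining blocks on the
  complementary rows. The increasing list \<open>K\<close> has no inversions of its own, so the inversions of
  the concatenated list are accounted for by the successive splittings.
\<close>

lemma minor_laplace_blocks:
  assumes "finite A" "card A = length (concat Is)"
  shows "minor p M A (concat Is) =
    (\<Sum>Ks | map length Ks = map length Is \<and> (\<forall>K\<in>set Ks. sorted_wrt (<) K) \<and>
        distinct (concat Ks) \<and> set (concat Ks) = A.
      p ^ word_inversions (concat Ks) *\<^sub>C prod_list (map2 (\<lambda>K. minor p M (set K)) Ks Is))"
  using assms
proof (induction Is arbitrary: A)
  case Nil
  then have "{Ks :: nat list list. map length Ks = map length [] \<and> (\<forall>K\<in>set Ks. sorted_wrt (<) K) \<and>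
        distinct (concat Ks) \<and> set (concat Ks) = A} = {[]}"
    by auto
  with Nil show ?case
    by (simp add: scaleC_one)
next
  case (Cons I Is)
  let ?S = "\<lambda>Is A. {Ks. map length Ks = map length Is \<and> (\<forall>K\<in>set Ks. sorted_wrt (<) K) \<and>
        distinct (concat Ks) \<and> set (concat Ks) = A}"
  let ?t = "\<lambda>Is Ks. p ^ word_inversions (concat Ks) *\<^sub>C prod_list (map2 (\<lambda>K. minor p M (set K)) Ks Is)"
  let ?B = "{B. B \<subseteq> A \<and> card B = length I}"
  have fin: "finite (?S Is (A - B))" for B
  proof (rule finite_subset)
    show "?S Is (A - B) \<subseteq> {Ks. set Ks \<subseteq> {K. set K \<subseteq> A \<and> distinct K} \<and> length Ks = length Is}"
      by (auto simp: strict_sorted_iff dest: map_eq_imp_length_eq)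
    show "finite {Ks. set Ks \<subseteq> {K. set K \<subseteq> A \<and> distinct K} \<and> length Ks = length Is}"
      using Cons.prems(1) by (intro finite_lists_length_eq finite_subset_distinct)
  qed
  have "minor p M A (concat (I # Is)) = (\<Sum>B\<in>?B.
      p ^ cross_inversions B (A - B) *\<^sub>C (minor p M B I * minor p M (A - B) (concat Is)))"
    using minor_laplace[of A I "concat Is" p M] Cons.prems by simp
  also have "\<dots> = (\<Sum>B\<in>?B. \<Sum>Ks\<in>?S Is (A - B). ?t (I # Is) (sorted_list_of_set B # Ks))"
  proof (intro sum.cong refl)
    fix B assume B: "B \<in> ?B"
    then have "finite B" "card (A - B) = length (concat Is)"
      using Cons.prems by (auto simp: finite_subset card_Diff_subset)
    then have "minor p M (A - B) (concat Is) = (\<Sum>Ks\<in>?S Is (A - B). ?t Is Ks)"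
      using Cons.prems(1) by (intro Cons.IH) auto
    moreover have "p ^ cross_inversions B (A - B) *\<^sub>C (minor p M B I * ?t Is Ks) =
        ?t (I # Is) (sorted_list_of_set B # Ks)" if "Ks \<in> ?S Is (A - B)" for Ks
    proof -
      have "word_inversions (sorted_list_of_set B @ concat Ks) =
          word_inversions (concat Ks) + cross_inversions B (A - B)"
        using that \<open>finite B\<close> by (subst word_inversions_append) (auto simp: word_inversions_strict_sorted)
      then show ?thesis
        using \<open>finite B\<close> by (simp add: scaleC_algebra power_add mult_ac)
    qed
    ultimately show "p ^ cross_inversions B (A - B) *\<^sub>C (minor p M B I * minor p M (A - B) (concat Is)) =
        (\<Sum>Ks\<in>?S Is (A - B). ?t (I # Is) (sorted_list_of_set B # Ks))"
      by (simp add: sum_distrib_left scaleC_sum_right)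
  qed
  also have "\<dots> = (\<Sum>(B, Ks)\<in>(SIGMA B:?B. ?S Is (A - B)). ?t (I # Is) (sorted_list_of_set B # Ks))"
    using fin Cons.prems(1) by (subst sum.Sigma) auto
  also have "\<dots> = (\<Sum>Ks\<in>?S (I # Is) A. ?t (I # Is) Ks)"
  proof (rule sum.reindex_bij_witness[of _ "\<lambda>Ks. (set (hd Ks), tl Ks)"
        "\<lambda>(B, Ks). sorted_list_of_set B # Ks"])
    fix z assume "z \<in> (SIGMA B:?B. ?S Is (A - B))"
    then obtain B Ks where z: "z = (B, Ks)" "B \<subseteq> A" "card B = length I" "Ks \<in> ?S Is (A - B)"
      by auto
    moreover from this have "finite B"
      using Cons.prems(1) finite_subset by blast
    ultimately show "(\<lambda>Ks. (set (hd Ks), tl Ks)) (case z of (B, Ks) \<Rightarrow> sorted_list_of_set B # Ks) = z"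
      "(case z of (B, Ks) \<Rightarrow> sorted_list_of_set B # Ks) \<in> ?S (I # Is) A"
      "?t (I # Is) (case z of (B, Ks) \<Rightarrow> sorted_list_of_set B # Ks) =
        (case z of (B, Ks) \<Rightarrow> ?t (I # Is) (sorted_list_of_set B # Ks))"
      by auto
  next
    fix Ks assume Ks: "Ks \<in> ?S (I # Is) A"
    then obtain K Ks' where "Ks = K # Ks'"
      by auto
    with Ks show "(case (set (hd Ks), tl Ks) of (B, Ks) \<Rightarrow> sorted_list_of_set B # Ks) = Ks"
      "(set (hd Ks), tl Ks) \<in> (SIGMA B:?B. ?S Is (A - B))"
      by (auto simp: sorted_list_of_set.idem_if_sorted_distinct strict_sorted_iff distinct_card)
  qed
  finally show ?case .
qed

text \<open>
  Lists of blocks with an index occurring twice may be added to the sum, as their weight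
  \<open>q_epsilon\<close> is \<open>0\<close>; all others use every row exactly once because the lengths add up to \<open>n\<close>.
\<close>

lemma minor_laplace_multi:
  assumes "length (concat Is) = n"
  shows "minor (inverse (- q)) M {1..n} (concat Is) =
    (\<Sum>Ks | map length Ks = map length Is \<and> (\<forall>K\<in>set Ks. sorted_wrt (<) K \<and> set K \<subseteq> {1..n}).
       q_epsilon q n (concat Ks) *\<^sub>C
         prod_list (map2 (\<lambda>K I. qdet q (length I) (submat M K I)) Ks Is))"
    (is "_ = sum ?t ?S")
proof -
  let ?p = "inverse (- q)"
  let ?D = "{Ks. map length Ks = map length Is \<and> (\<forall>K\<in>set Ks. sorted_wrt (<) K) \<and>
        distinct (concat Ks) \<and> set (concat Ks) = {1..n}}"
  have len: "length (concat Ks) = n" if "Ks \<in> ?S" for Ks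
    using that assms by (simp add: length_concat)
  have "finite ?S"
  proof (rule finite_subset)
    show "?S \<subseteq> {Ks. set Ks \<subseteq> {K. set K \<subseteq> {1..n} \<and> distinct K} \<and> length Ks = length Is}"
      by (auto simp: strict_sorted_iff dest: map_eq_imp_length_eq)
    show "finite {Ks. set Ks \<subseteq> {K. set K \<subseteq> {1..n} \<and> distinct K} \<and> length Ks = length Is}"
      by (intro finite_lists_length_eq finite_subset_distinct) simp
  qed
  have "minor ?p M {1..n} (concat Is) = (\<Sum>Ks\<in>?D.
      ?p ^ word_inversions (concat Ks) *\<^sub>C prod_list (map2 (\<lambda>K. minor ?p M (set K)) Ks Is))"
    using assms by (intro minor_laplace_blocks) simp_all
  also have "\<dots> = sum ?t ?D"
  proof (intro sum.cong refl)
    fix Ks assume Ks: "Ks \<in> ?D"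
    then have S: "Ks \<in> ?S"
      by auto
    then have "q_epsilon q n (concat Ks) = ?p ^ word_inversions (concat Ks)"
      using Ks len[OF S] q_epsilon_eq[of q "concat Ks"] by simp
    moreover have "map2 (\<lambda>K. minor ?p M (set K)) Ks Is =
        map2 (\<lambda>K I. qdet q (length I) (submat M K I)) Ks Is"
    proof (rule nth_equalityI)
      fix i assume "i < length (map2 (\<lambda>K. minor ?p M (set K)) Ks Is)"
      then have i: "i < length Ks" "i < length Is"
        by simp_all
      have "map length Ks ! i = map length Is ! i"
        using Ks by simp
      with i have "length (Ks ! i) = length (Is ! i)"
        by simp
      moreover have "sorted_wrt (<) (Ks ! i)"
        using Ks i by auto
      ultimately show "map2 (\<lambda>K. minor ?p M (set K)) Ks Is ! i =
          map2 (\<lambda>K I. qdet q (length I) (submat M K I)) Ks Is ! i"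
        using i by (simp add: qdet_submat)
    qed simp
    ultimately show "?p ^ word_inversions (concat Ks) *\<^sub>C
        prod_list (map2 (\<lambda>K. minor ?p M (set K)) Ks Is) = ?t Ks"
      by (simp only:)
  qed
  also have "\<dots> = sum ?t ?S"
  proof (intro sum.mono_neutral_left ballI)
    fix Ks assume Ks: "Ks \<in> ?S - ?D"
    have "\<not> distinct (concat Ks)"
    proof
      assume dist: "distinct (concat Ks)"
      have "set (concat Ks) \<subseteq> {1..n}"
        using Ks by auto
      then have all: "set (concat Ks) = {1..n}"
        using len[of Ks] Ks distinct_card[OF dist] by (intro card_subset_eq) simp_all
      have "map length Ks = map length Is" "\<forall>K\<in>set Ks. sorted_wrt (<) K"
        using Ks by simp_all
      with dist all have "Ks \<in> ?D"
        by (intro CollectI conjI) assumption+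
      with Ks show False
        by (simp only: Diff_iff simp_thms)
    qed
    then show "?t Ks = 0"
      by (simp add: q_epsilon_def)
  qed (use \<open>finite ?S\<close> in auto)
  finally show ?thesis .
qed

section \<open>Quantum matrices\<close>

text \<open>
  In each monomial the factor from the top row \<open>a\<close> can be moved to the front, because all factors
  before it lie in lower rows and in columns further to the left. The induction removes the first
  column: its entry is either in row \<open>a\<close>, or it commutes past the entry of row \<open>a\<close> provided by the
  induction hypothesis.
\<close>

lemma minor_expand_first_row:
  assumes "finite A" "card A = length J" "sorted_wrt (<) J" "a \<in> A" "\<forall>i\<in>A. a \<le> i"
    and "\<forall>i\<in>A - {a}. \<forall>c\<in>set J. \<forall>b\<in>set J. c < b \<longrightarrow> M i c * M a b = M a b * M i c"
  shows "minor p M A J =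
    (\<Sum>b\<in>set J. p ^ card {x\<in>set J. x < b} *\<^sub>C (M a b * minor p M (A - {a}) (remove1 b J)))"
  using assms
proof (induction J arbitrary: A)
  case Nil
  then show ?case
    by auto
next
  case (Cons c J)
  have sorted: "\<forall>b\<in>set J. c < b" "sorted_wrt (<) J" "c \<notin> set J"
    using Cons.prems(3) by auto
  have finA: "finite (A - {a})" "card (A - {a}) = length J"
    using Cons.prems by simp_all
  have rank_min: "card {k\<in>A. k < a} = 0"
  proof -
    have "{k\<in>A. k < a} = {}"
      using Cons.prems(5) by auto
    then show ?thesis
      by (simp only: card.empty)
  qed
  have rank_row: "card {k\<in>A. k < i} = Suc (card {k\<in>A - {a}. k < i})" if "i \<in> A - {a}" for i
  proof -
    have "{k\<in>A. k < i} = insert a {k\<in>A - {a}. k < i}"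
      using Cons.prems(4,5) that le_neq_implies_less by auto
    then show ?thesis
      using finA(1) by simp
  qed
  have rank_c: "card {x\<in>set (c # J). x < c} = 0"
  proof -
    have "{x\<in>set (c # J). x < c} = {}"
      using sorted by auto
    then show ?thesis
      by (simp only: card.empty)
  qed
  have rank_col: "card {x\<in>set (c # J). x < b} = Suc (card {x\<in>set J. x < b})" if "b \<in> set J" for b
  proof -
    have "{x\<in>set (c # J). x < b} = insert c {x\<in>set J. x < b}"
      using sorted that by auto
    then show ?thesis
      using sorted(3) by simp
  qed
  let ?m = "\<lambda>i b. minor p M (A - {a} - {i}) (remove1 b J)"
  let ?r = "\<lambda>i. card {k\<in>A - {a}. k < i}" and ?s = "\<lambda>b. card {x\<in>set J. x < b}"
  have row: "p ^ card {k\<in>A. k < i} *\<^sub>C (M i c * minor p M (A - {i}) J) =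
      (\<Sum>b\<in>set J. p ^ Suc (?s b) *\<^sub>C (M a b * (p ^ ?r i *\<^sub>C (M i c * ?m i b))))"
    if i: "i \<in> A - {a}" for i
  proof -
    have "minor p M (A - {i}) J =
        (\<Sum>b\<in>set J. p ^ ?s b *\<^sub>C (M a b * minor p M (A - {i} - {a}) (remove1 b J)))"
      using Cons.prems i sorted by (intro Cons.IH) auto
    also have "A - {i} - {a} = A - {a} - {i}"
      by auto
    finally have "p ^ card {k\<in>A. k < i} *\<^sub>C (M i c * minor p M (A - {i}) J) =
        (\<Sum>b\<in>set J. (p ^ Suc (?r i) * p ^ ?s b) *\<^sub>C (M i c * M a b * ?m i b))"
      unfolding rank_row[OF i]
      by (simp only: sum_distrib_left scaleC_sum_right mult_scaleC_right scaleC_scaleC mult.assoc)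
    also have "\<dots> = (\<Sum>b\<in>set J. p ^ Suc (?s b) *\<^sub>C (M a b * (p ^ ?r i *\<^sub>C (M i c * ?m i b))))"
    proof (intro sum.cong refl)
      fix b assume "b \<in> set J"
      then have "M i c * M a b = M a b * M i c"
        using Cons.prems(6) i sorted(1) by simp
      then show "(p ^ Suc (?r i) * p ^ ?s b) *\<^sub>C (M i c * M a b * ?m i b) =
          p ^ Suc (?s b) *\<^sub>C (M a b * (p ^ ?r i *\<^sub>C (M i c * ?m i b)))"
        by (simp add: scaleC_algebra mult_ac)
    qed
    finally show ?thesis .
  qed
  have "minor p M A (c # J) =
      (\<Sum>i\<in>A. p ^ card {k\<in>A. k < i} *\<^sub>C (M i c * minor p M (A - {i}) J))"
    using Cons.prems by (intro minor_Cons) simp_all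
  also have "\<dots> = M a c * minor p M (A - {a}) J +
      (\<Sum>i\<in>A - {a}. p ^ card {k\<in>A. k < i} *\<^sub>C (M i c * minor p M (A - {i}) J))"
    using Cons.prems(1,4) by (subst sum.remove[of _ a]) (simp_all only: rank_min power_0 scaleC_one)
  also have "(\<Sum>i\<in>A - {a}. p ^ card {k\<in>A. k < i} *\<^sub>C (M i c * minor p M (A - {i}) J)) =
      (\<Sum>b\<in>set J. p ^ Suc (?s b) *\<^sub>C (M a b * (\<Sum>i\<in>A - {a}. p ^ ?r i *\<^sub>C (M i c * ?m i b))))"
    by (simp only: row sum_distrib_left scaleC_sum_right cong: sum.cong) (rule sum.swap)
  also have "\<dots> = (\<Sum>b\<in>set J. p ^ card {x\<in>set (c # J). x < b} *\<^sub>C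
      (M a b * minor p M (A - {a}) (remove1 b (c # J))))"
  proof (intro sum.cong refl)
    fix b assume b: "b \<in> set J"
    then have "minor p M (A - {a}) (c # remove1 b J) = (\<Sum>i\<in>A - {a}. p ^ ?r i *\<^sub>C (M i c * ?m i b))"
    proof (intro minor_Cons)
      show "card (A - {a}) = Suc (length (remove1 b J))"
        using finA(2) b length_pos_if_in_set[OF b] by (simp add: length_remove1)
    qed (rule finA)
    moreover have "remove1 b (c # J) = c # remove1 b J"
      using b sorted(3) by auto
    ultimately show "p ^ Suc (?s b) *\<^sub>C (M a b * (\<Sum>i\<in>A - {a}. p ^ ?r i *\<^sub>C (M i c * ?m i b))) =
        p ^ card {x\<in>set (c # J). x < b} *\<^sub>C (M a b * minor p M (A - {a}) (remove1 b (c # J)))"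
      by (simp only: rank_col[OF b])
  qed
  also have "M a c * minor p M (A - {a}) J + \<dots> = (\<Sum>b\<in>set (c # J).
      p ^ card {x\<in>set (c # J). x < b} *\<^sub>C (M a b * minor p M (A - {a}) (remove1 b (c # J))))"
  proof -
    have "remove1 c (c # J) = J"
      by simp
    then show ?thesis
      using sorted(3) unfolding list.set(2) by (subst sum.insert)
        (simp_all only: finite_set not_False_eq_True rank_c[unfolded list.set(2)] power_0 scaleC_one)
  qed
  finally show ?case .
qed

text \<open>
  The expansion along the first row of \<open>M\<close> is the expansion along the first column of its transpose.
\<close>

theorem minor_transpose:
  assumes "finite A" "card A = length J" "sorted_wrt (<) J"
    and "\<forall>i\<in>A. \<forall>k\<in>A. \<forall>c\<in>set J. \<forall>b\<in>set J. i < k \<longrightarrow> c < b \<longrightarrow> M k c * M i b = M i b * M k c"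
  shows "minor p (mtranspose M) (set J) (sorted_list_of_set A) = minor p M A J"
  using assms
proof (induction "card A" arbitrary: A J)
  case 0
  then show ?case
    by simp
next
  case (Suc m)
  have "A \<noteq> {}"
    using Suc.hyps(2) by auto
  define a where "a = Min A"
  have a: "a \<in> A" "\<forall>i\<in>A. a \<le> i"
    using \<open>A \<noteq> {}\<close> Suc.prems(1) by (simp_all add: a_def)
  have J: "distinct J" "sorted J"
    using Suc.prems(3) by (simp_all add: strict_sorted_iff)
  have "minor p (mtranspose M) (set J) (sorted_list_of_set A) =
      minor p (mtranspose M) (set J) (a # sorted_list_of_set (A - {a}))"
    unfolding a_def sorted_list_of_set_nonempty[OF Suc.prems(1) \<open>A \<noteq> {}\<close>, symmetric] ..
  also have "\<dots> = (\<Sum>b\<in>set J. p ^ card {x\<in>set J. x < b} *\<^sub>C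
      (mtranspose M b a * minor p (mtranspose M) (set J - {b}) (sorted_list_of_set (A - {a}))))"
    using Suc.prems(1,2) Suc.hyps(2) a(1) J(1) by (intro minor_Cons) (simp_all add: distinct_card)
  also have "\<dots> = (\<Sum>b\<in>set J. p ^ card {x\<in>set J. x < b} *\<^sub>C
      (M a b * minor p M (A - {a}) (remove1 b J)))"
  proof (intro sum.cong refl)
    fix b assume b: "b \<in> set J"
    have "minor p (mtranspose M) (set (remove1 b J)) (sorted_list_of_set (A - {a})) =
        minor p M (A - {a}) (remove1 b J)"
    proof (rule Suc.hyps(1))
      show "m = card (A - {a})" "card (A - {a}) = length (remove1 b J)"
        using Suc.hyps(2) Suc.prems(1,2) a(1) b by (simp_all add: length_remove1)
      show "sorted_wrt (<) (remove1 b J)"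
        using J by (simp add: strict_sorted_iff sorted_remove1)
      show "\<forall>i\<in>A - {a}. \<forall>k\<in>A - {a}. \<forall>c\<in>set (remove1 b J). \<forall>b\<in>set (remove1 b J).
          i < k \<longrightarrow> c < b \<longrightarrow> M k c * M i b = M i b * M k c"
        using Suc.prems(4) J(1) by simp
    qed (use Suc.prems(1) in simp)
    then show "p ^ card {x\<in>set J. x < b} *\<^sub>C
        (mtranspose M b a * minor p (mtranspose M) (set J - {b}) (sorted_list_of_set (A - {a}))) =
      p ^ card {x\<in>set J. x < b} *\<^sub>C (M a b * minor p M (A - {a}) (remove1 b J))"
      using J(1) by (simp add: mtranspose_def)
  qed
  also have "\<dots> = minor p M A J"
  proof (rule minor_expand_first_row[symmetric, OF Suc.prems(1-3) a])
    show "\<forall>i\<in>A - {a}. \<forall>c\<in>set J. \<forall>b\<in>set J. c < b \<longrightarrow> M i c * M a b = M a b * M i c"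
    proof (intro ballI impI)
      fix i c b assume "i \<in> A - {a}" "c \<in> set J" "b \<in> set J" "c < b"
      moreover from this have "a < i"
        using a(2) by (simp add: le_neq_implies_less)
      ultimately show "M i c * M a b = M a b * M i c"
        using Suc.prems(4) a(1) by blast
    qed
  qed
  finally show ?case .
qed

text \<open>
  The cross relations of \<open>T\<close> and of its transpose have the same left-hand side; comparing the
  right-hand sides gives the commutator multiplied by \<open>q\<^sup>-\<^sup>1 + q\<close>.
\<close>

lemma quantum_matrix_antidiagonal_commute:
  assumes "q \<noteq> 0" "q\<^sup>2 \<noteq> - 1" "quantum_matrix q n T"
    and "i \<in> {1..n}" "k \<in> {1..n}" "c \<in> {1..n}" "b \<in> {1..n}" "i < k" "c < b"
  shows "T k c * T i b = T i b * T k c"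
proof -
  have "T i c * T k b - T k b * T i c = inverse q *\<^sub>C (T k c * T i b) - q *\<^sub>C (T i b * T k c)"
    using assms unfolding quantum_matrix_def q_manin_def cross_relations_def by blast
  moreover have "mtranspose T c i * mtranspose T b k - mtranspose T b k * mtranspose T c i =
      inverse q *\<^sub>C (mtranspose T b i * mtranspose T c k) - q *\<^sub>C (mtranspose T c k * mtranspose T b i)"
    using assms unfolding quantum_matrix_def q_manin_def cross_relations_def by blast
  ultimately have "inverse q *\<^sub>C (T k c * T i b) - q *\<^sub>C (T i b * T k c) =
      inverse q *\<^sub>C (T i b * T k c) - q *\<^sub>C (T k c * T i b)"
    by (simp add: mtranspose_def)
  then have "(inverse q + q) *\<^sub>C (T k c * T i b) = (inverse q + q) *\<^sub>C (T i b * T k c)"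
    by (simp add: scaleC_add_left algebra_simps)
  moreover have "inverse q + q \<noteq> 0"
  proof
    assume "inverse q + q = 0"
    then have "q * (inverse q + q) = 0"
      by simp
    then have "1 + q\<^sup>2 = 0"
      using assms(1) by (simp add: distrib_left power2_eq_square)
    with assms(2) show False
      by (simp add: add_eq_0_iff)
  qed
  ultimately show ?thesis
    by (rule scaleC_cancel[rotated])
qed

lemma qdet_delete_row_col_mtranspose:
  assumes "q \<noteq> 0" "q\<^sup>2 \<noteq> - 1" "quantum_matrix q n T" "r \<in> {1..n}" "s \<in> {1..n}"
  shows "qdet q (n - 1) (delete_row_col s r (mtranspose T)) = qdet q (n - 1) (delete_row_col r s T)"
proof -
  have J: "set ([1..<t] @ [Suc t..<Suc n]) = {1..n} - {t}"
    "sorted_wrt (<) ([1..<t] @ [Suc t..<Suc n])" "length ([1..<t] @ [Suc t..<Suc n]) = n - 1"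
    if "t \<in> {1..n}" for t
  proof -
    have "set ([1..<t] @ [Suc t..<Suc n]) = {1..<t} \<union> {Suc t..<Suc n}"
      by simp
    then show "set ([1..<t] @ [Suc t..<Suc n]) = {1..n} - {t}"
      using that by auto
    have "sorted_wrt (<) ([1..<t] @ t # [Suc t..<Suc n])"
      unfolding upt_split_at[OF that, symmetric] by (rule sorted_wrt_upt)
    then show "sorted_wrt (<) ([1..<t] @ [Suc t..<Suc n])"
      unfolding sorted_wrt_append by simp
    show "length ([1..<t] @ [Suc t..<Suc n]) = n - 1"
      using that by auto
  qed
  have "sorted_list_of_set ({1..n} - {r}) = [1..<r] @ [Suc r..<Suc n]"
    unfolding J(1)[OF assms(4), symmetric] using J(2)[OF assms(4)]
    by (intro sorted_list_of_set.idem_if_sorted_distinct) (simp_all only: strict_sorted_iff)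
  moreover have "minor (inverse (- q)) (mtranspose T) (set ([1..<s] @ [Suc s..<Suc n]))
      (sorted_list_of_set ({1..n} - {r})) = minor (inverse (- q)) T ({1..n} - {r}) ([1..<s] @ [Suc s..<Suc n])"
  proof (rule minor_transpose)
    show "sorted_wrt (<) ([1..<s] @ [Suc s..<Suc n])"
      "card ({1..n} - {r}) = length ([1..<s] @ [Suc s..<Suc n])"
      using J(2,3)[OF assms(5)] assms(4) by simp_all
    show "\<forall>i\<in>{1..n} - {r}. \<forall>k\<in>{1..n} - {r}. \<forall>c\<in>set ([1..<s] @ [Suc s..<Suc n]).
        \<forall>b\<in>set ([1..<s] @ [Suc s..<Suc n]). i < k \<longrightarrow> c < b \<longrightarrow> T k c * T i b = T i b * T k c"
      unfolding J(1)[OF assms(5)] using quantum_matrix_antidiagonal_commute[OF assms(1-3)] by blast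
  qed simp
  ultimately show ?thesis
    unfolding qdet_delete_row_col[OF assms(4,5)] qdet_delete_row_col[OF assms(5,4)] J(1)[OF assms(5)]
    by simp
qed

text \<open>
  The off-diagonal sums are minors in which column \<open>t\<close> occurs twice.
\<close>

lemma adjugate_column_sums:
  assumes "q \<noteq> 0" "q_manin q n n M" "s \<in> {1..n}" "t \<in> {1..n}"
  shows "(\<Sum>r = 1..n. ((- q) powi (int s - int r)) *\<^sub>C (M r t * qdet q (n - 1) (delete_row_col r s M))) =
      (if s = t then qdet q n M else 0)"
    and "(\<Sum>r = 1..n. ((- q) powi (int r - int s)) *\<^sub>C (qdet q (n - 1) (delete_row_col r s M) * M r t)) =
      (if s = t then qdet q n M else 0)"
proof -
  have cross: "cross_relations q n n M"
    using assms(2) by (simp add: q_manin_def)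
  let ?J = "[1..<s] @ [Suc s..<Suc n]"
  have "minor (inverse (- q)) M {1..n} (t # ?J) = 0" "minor (inverse (- q)) M {1..n} (?J @ [t]) = 0"
    if "s \<noteq> t"
  proof -
    have "t \<in> set ?J"
      using assms(4) that by auto
    then have "\<not> distinct (t # ?J)" "\<not> distinct (?J @ [t])"
      by auto
    then have "q_epsilon q n (t # ?J) = 0" "q_epsilon q n (?J @ [t]) = 0"
      unfolding q_epsilon_def by (simp_all only: if_False)
    moreover have "set (t # ?J) \<subseteq> {1..n}" "set (?J @ [t]) \<subseteq> {1..n}"
      "length (t # ?J) = n" "length (?J @ [t]) = n"
      using assms(3,4) by auto
    ultimately show "minor (inverse (- q)) M {1..n} (t # ?J) = 0"
      "minor (inverse (- q)) M {1..n} (?J @ [t]) = 0"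
      using minor_eq_epsilon_qdet_manin[OF assms(1,2)] by (metis scaleC_zero_left)+
  qed
  then show "(\<Sum>r = 1..n. ((- q) powi (int s - int r)) *\<^sub>C (M r t * qdet q (n - 1) (delete_row_col r s M))) =
      (if s = t then qdet q n M else 0)"
    "(\<Sum>r = 1..n. ((- q) powi (int r - int s)) *\<^sub>C (qdet q (n - 1) (delete_row_col r s M) * M r t)) =
      (if s = t then qdet q n M else 0)"
    using minor_front_column_scaled[OF assms(1,3), of M t] minor_back_column_scaled[OF assms(1,3), of M t]
      qdet_expand_column[OF assms(1) cross assms(3)] assms(1)
    by (auto simp: scaleC_eq_0_iff)
qed

text \<open>
  The matrix \<open>A\<close> is the adjugate. It is a left inverse of \<open>T\<close> up to the factor \<open>d\<close> by the expansion
  along columns of \<open>T\<close>, and a right inverse up to the factor \<open>d'\<close> by the expansion along columns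
  of the transpose. Since \<open>d' = d\<close>, evaluating \<open>T A T\<close> in two ways gives \<open>d T = T d\<close>.
\<close>

theorem quantum_matrix_qdet_central:
  assumes "q \<noteq> 0" "q\<^sup>2 \<noteq> - 1" "quantum_matrix q n T" "x \<in> generated_algebra (entries n T)"
  shows "commutator (qdet q n T) x = 0"
proof -
  define A where "A s r = ((- q) powi (int r - int s)) *\<^sub>C qdet q (n - 1) (delete_row_col r s T)" for s r
  define d where "d = qdet q n T"
  define d' where "d' = qdet q n (mtranspose T)"
  have manin: "q_manin q n n T" "q_manin q n n (mtranspose T)"
    using assms(3) by (simp_all add: quantum_matrix_def)
  have left: "(\<Sum>r = 1..n. A s r * T r t) = (if s = t then d else 0)"
    if "s \<in> {1..n}" "t \<in> {1..n}" for s t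
    using adjugate_column_sums(2)[OF assms(1) manin(1) that] by (simp add: A_def d_def mult_scaleC_left)
  have right: "(\<Sum>s = 1..n. T t s * A s r) = (if r = t then d' else 0)"
    if "r \<in> {1..n}" "t \<in> {1..n}" for r t
  proof -
    have "(\<Sum>s = 1..n. T t s * A s r) = (\<Sum>s = 1..n. ((- q) powi (int r - int s)) *\<^sub>C
        (mtranspose T s t * qdet q (n - 1) (delete_row_col s r (mtranspose T))))"
      using that(1) qdet_delete_row_col_mtranspose[OF assms(1-3)]
      by (intro sum.cong) (auto simp: A_def mult_scaleC_right mtranspose_def)
    then show ?thesis
      using adjugate_column_sums(1)[OF assms(1) manin(2) that] by (simp add: d'_def)
  qed
  have "d' = d"
  proof -
    have "minor (inverse (- q)) (mtranspose T) (set [1..<Suc n]) (sorted_list_of_set {1..n}) =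
        minor (inverse (- q)) T {1..n} [1..<Suc n]"
      using quantum_matrix_antidiagonal_commute[OF assms(1-3)]
      by (intro minor_transpose) (simp_all add: sorted_wrt_upt)
    then show ?thesis
      unfolding d_def d'_def qdet_eq_minor sorted_list_of_interval
      by (simp add: atLeastLessThanSuc_atLeastAtMost)
  qed
  have entry: "d * T i j = T i j * d" if ij: "i \<in> {1..n}" "j \<in> {1..n}" for i j
  proof -
    have "d * T i j = (\<Sum>r = 1..n. (if r = i then d' else 0) * T r j)"
      using ij(1) \<open>d' = d\<close> by (simp add: if_distrib[of "\<lambda>x. x * _"] cong: if_cong)
    also have "\<dots> = (\<Sum>r = 1..n. (\<Sum>s = 1..n. T i s * A s r) * T r j)"
      using ij(1) right by (intro sum.cong) simp_all
    also have "\<dots> = (\<Sum>s = 1..n. T i s * (\<Sum>r = 1..n. A s r * T r j))"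
      by (simp add: sum_distrib_left sum_distrib_right mult.assoc) (rule sum.swap)
    also have "\<dots> = (\<Sum>s = 1..n. T i s * (if s = j then d else 0))"
      using ij(2) left by (intro sum.cong) simp_all
    also have "\<dots> = T i j * d"
      using ij(2) by (simp add: if_distrib[of "\<lambda>x. _ * x"] cong: if_cong)
    finally show ?thesis .
  qed
  from assms(4) have "d * x = x * d"
  proof induction
    case (gen x)
    then show ?case
      using entry by (auto simp: entries_def)
  next
    case (mult x y)
    then show ?case
      by (metis mult.assoc)
  qed (simp_all add: mult_scaleC_left mult_scaleC_right distrib_left distrib_right)
  then show ?thesis
    by (simp add: commutator_def d_def)
qed

section \<open>Scalar Manin matrices\<close>

text \<open>
  For \<open>q\<^sup>2 \<noteq> 1\<close> a complex matrix is Manin precisely when each column has at most one nonzero entry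
  and the row of that entry weakly increases with the column. Matrices with two entries \<open>1\<close>
  are enough to detect a violation of this order.
\<close>

definition two_units :: "nat \<Rightarrow> nat \<Rightarrow> nat \<Rightarrow> nat \<Rightarrow> complex matrix" where
  "two_units i j k l = (\<lambda>r s. if (r, s) = (i, j) \<or> (r, s) = (k, l) then 1 else 0)"

lemma q_manin_two_units:
  assumes "i < k" "j < l"
  shows "q_manin q n n (two_units i j k l)"
proof -
  let ?M = "two_units i j k l"
  have column: "?M r s * ?M r' s = 0" "?M r' s * ?M r s = 0" if "r < r'" for r r' s
    using assms that by (auto simp: two_units_def)
  have cross: "?M r' s * ?M r s' = 0" "?M r s' * ?M r' s = 0" if "r < r'" "s < s'" for r r' s s'
    using assms that by (auto simp: two_units_def)
  have comm: "?M r s * ?M r' s' - ?M r' s' * ?M r s = 0" for r r' s s'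
    by (simp add: mult.commute)
  show ?thesis
    unfolding q_manin_def column_relations_def column_q_commutes_def cross_relations_def
    by (intro conjI ballI impI) (simp_all only: column cross comm scaleC_zero_right diff_zero)
qed

lemma not_q_manin_complex:
  fixes N :: "complex matrix"
  assumes "q \<noteq> 0" "q\<^sup>2 \<noteq> 1" "{i, k, j, l} \<subseteq> {1..n}" "i < k" "j < l" "N k j \<noteq> 0" "N i l \<noteq> 0"
  shows "\<not> q_manin q n n N"
proof
  assume "q_manin q n n N"
  then have "N i j * N k l - N k l * N i j = inverse q *\<^sub>C (N k j * N i l) - q *\<^sub>C (N i l * N k j)"
    using assms(3-5) unfolding q_manin_def cross_relations_def by blast
  \<comment> \<open>Scalars commute, so the cross relation forces \<open>(q\<^sup>-\<^sup>1 - q) N\<^sub>k\<^sub>j N\<^sub>i\<^sub>l = 0\<close>.\<close>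
  then have "inverse q * (N k j * N i l) - q * (N i l * N k j) = N i j * N k l - N k l * N i j"
    by (simp only: scaleC_complex_def)
  also have "\<dots> = 0"
    by (simp add: mult.commute)
  finally have "(inverse q - q) * (N k j * N i l) = 0"
    by (simp only: left_diff_distrib mult.commute[of "N i l"])
  then have "inverse q = q"
    using assms(6,7) by auto
  then have "q * q = 1"
    using assms(1) by (metis right_inverse)
  with assms(2) show False
    by (simp add: power2_eq_square)
qed

text \<open>
  A permutation without descents maps the increasing list of all indices to an increasing list of
  all indices, that is, to itself.
\<close>

lemma permutes_descent:
  fixes n :: nat
  assumes "\<sigma> permutes {1..n}" "\<sigma> \<noteq> id"
  shows "\<exists>j\<in>{1..n}. \<exists>l\<in>{1..n}. j < l \<and> \<sigma> l < \<sigma> j"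
proof (rule ccontr)
  assume no_descent: "\<not> ?thesis"
  have mono: "strict_mono_on {1..n} \<sigma>"
  proof (rule strict_mono_onI)
    fix j l assume "j \<in> {1..n}" "l \<in> {1..n}" "j < l"
    moreover from this have "\<sigma> j \<noteq> \<sigma> l"
      using inj_eq[OF permutes_inj[OF assms(1)], of j l] by simp
    ultimately show "\<sigma> j < \<sigma> l"
      using no_descent by (metis linorder_less_linear)
  qed
  have "sorted_wrt (<) (map \<sigma> [1..<Suc n])"
    unfolding sorted_wrt_map
  proof (rule sorted_wrt_mono_rel[OF _ sorted_wrt_upt])
    fix x y assume "x \<in> set [1..<Suc n]" "y \<in> set [1..<Suc n]" "x < y"
    then show "\<sigma> x < \<sigma> y"
      using mono by (simp add: strict_mono_on_def)
  qed
  moreover have "set (map \<sigma> [1..<Suc n]) = set [1..<Suc n]"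
    using assms(1) by (simp add: atLeastLessThanSuc_atLeastAtMost permutes_image)
  ultimately have eq: "map \<sigma> [1..<Suc n] = map id [1..<Suc n]"
    by (metis list.map_id strict_sorted_equal sorted_wrt_upt)
  have "\<sigma> j = j" if "j \<in> {1..n}" for j
    using eq[unfolded map_eq_conv] that by (simp add: atLeastLessThanSuc_atLeastAtMost)
  moreover have "\<sigma> j = j" if "j \<notin> {1..n}" for j
    using assms(1) that by (rule permutes_not_in)
  ultimately have "\<sigma> = id"
    by (metis eq_id_iff)
  with assms(2) show False
    by simp
qed

lemma permuted_columns_not_manin:
  assumes "q \<noteq> 0" "q\<^sup>2 \<noteq> 1" "\<sigma> permutes {1..n}" "\<sigma> \<noteq> id"
  shows "\<exists>M :: complex matrix. q_manin q n n M \<and> \<not> q_manin q n n (\<lambda>i j. M i (\<sigma> j))"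
proof -
  obtain j l where jl: "j \<in> {1..n}" "l \<in> {1..n}" "j < l" "\<sigma> l < \<sigma> j"
    using permutes_descent[OF assms(3,4)] by blast
  show ?thesis
  proof (intro exI conjI)
    show "q_manin q n n (two_units 1 (\<sigma> l) 2 (\<sigma> j))"
      using jl by (intro q_manin_two_units) simp_all
    show "\<not> q_manin q n n (\<lambda>a b. two_units 1 (\<sigma> l) 2 (\<sigma> j) a (\<sigma> b))"
      using assms(1,2) jl(1-3) by (intro not_q_manin_complex[of q 1 2 j l]) (simp_all add: two_units_def)
  qed
qed

lemma permuted_rows_not_manin:
  assumes "q \<noteq> 0" "q\<^sup>2 \<noteq> 1" "\<sigma> permutes {1..n}" "\<sigma> \<noteq> id"
  shows "\<exists>M :: complex matrix. q_manin q n n M \<and> \<not> q_manin q n n (\<lambda>i j. M (\<sigma> i) j)"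
proof -
  obtain i k where ik: "i \<in> {1..n}" "k \<in> {1..n}" "i < k" "\<sigma> k < \<sigma> i"
    using permutes_descent[OF assms(3,4)] by blast
  show ?thesis
  proof (intro exI conjI)
    show "q_manin q n n (two_units (\<sigma> k) 1 (\<sigma> i) 2)"
      using ik by (intro q_manin_two_units) simp_all
    show "\<not> q_manin q n n (\<lambda>a b. two_units (\<sigma> k) 1 (\<sigma> i) 2 (\<sigma> a) b)"
      using assms(1,2) ik(1-3) by (intro not_q_manin_complex[of q i k 1 2]) (simp_all add: two_units_def)
  qed
qed

text \<open>
  The copied entry \<open>1\<close> and the entry \<open>1\<close> in a column strictly between \<open>r\<close> and \<open>s\<close> end up in the wrong
  order. Such a column exists because \<open>\<bar>s - r\<bar> \<ge> 2\<close>.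
\<close>

lemma replaced_column_not_manin:
  assumes "q \<noteq> 0" "q\<^sup>2 \<noteq> 1" "r \<in> {1..n}" "s \<in> {1..n}" "2 \<le> \<bar>int s - int r\<bar>"
  shows "\<exists>M :: complex matrix. q_manin q n n M \<and> \<not> q_manin q n n (replace_column s (\<lambda>i. M i r) M)"
proof (cases "r < s")
  case True
  have rs: "1 \<le> r" "r + 1 < s" "r + 1 \<noteq> s" "s \<le> n"
  proof -
    show "r + 1 < s" "r + 1 \<noteq> s"
      using assms(5) True by arith+
  qed (use assms(3,4) in simp_all)
  let ?M = "two_units 1 r 2 (r + 1)"
  have "q_manin q n n ?M"
    by (intro q_manin_two_units) simp_all
  moreover have "\<not> q_manin q n n (replace_column s (\<lambda>i. ?M i r) ?M)"
    using assms(1,2) rs by (intro not_q_manin_complex[of q 1 2 "r + 1" s])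
      (simp_all add: two_units_def replace_column_def)
  ultimately show ?thesis
    by blast
next
  case False
  have rs: "1 \<le> s" "s + 1 < r" "s + 1 \<noteq> r" "r \<le> n"
  proof -
    show "s + 1 < r" "s + 1 \<noteq> r"
      using assms(5) False by arith+
  qed (use assms(3,4) in simp_all)
  let ?M = "two_units 1 (s + 1) 2 r"
  have "q_manin q n n ?M"
    using rs by (intro q_manin_two_units) simp_all
  moreover have "\<not> q_manin q n n (replace_column s (\<lambda>i. ?M i r) ?M)"
    using assms(1,2) rs by (intro not_q_manin_complex[of q 1 2 s "s + 1"])
      (simp_all add: two_units_def replace_column_def)
  ultimately show ?thesis
    by blast
qed


section \<open>Manin matrices with one block of size two\<close>

text \<open>
  The matrix with rows \<open>(a, b)\<close> and \<open>(c, d)\<close> in the upper left corner, continued by an identity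
  matrix. It transports examples of size two to any larger size.
\<close>

definition block_matrix :: "'a::zero_neq_one \<Rightarrow> 'a \<Rightarrow> 'a \<Rightarrow> 'a \<Rightarrow> 'a matrix" where
  "block_matrix a b c d = (\<lambda>i j.
     if i = 1 \<and> j = 1 then a else if i = 1 \<and> j = 2 then b
     else if i = 2 \<and> j = 1 then c else if i = 2 \<and> j = 2 then d
     else if i = j then 1 else 0)"

lemma block_matrix_simps:
  "block_matrix a b c d 1 1 = a" "block_matrix a b c d 1 2 = b"
  "block_matrix a b c d 2 1 = c" "block_matrix a b c d 2 2 = d"
  by (simp_all add: block_matrix_def)

lemma block_matrix_outside:
  assumes "3 \<le> i \<or> 3 \<le> j"
  shows "block_matrix a b c d i j = (if i = j then 1 else 0)"
proof -
  have "\<not> (i = 1 \<and> j = 1)" "\<not> (i = 1 \<and> j = 2)" "\<not> (i = 2 \<and> j = 1)" "\<not> (i = 2 \<and> j = 2)"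
    using assms by linarith+
  then show ?thesis
    by (simp only: block_matrix_def if_False)
qed

lemma q_manin_block_matrix:
  fixes a b c d :: "'a::complex_algebra_1"
  assumes "a * c = inverse q *\<^sub>C (c * a)" "b * d = inverse q *\<^sub>C (d * b)"
    and "a * d - d * a = inverse q *\<^sub>C (c * b) - q *\<^sub>C (b * c)"
  shows "q_manin q n n (block_matrix a b c d)"
proof -
  let ?M = "block_matrix a b c d"
  have column: "?M i j * ?M k j = inverse q *\<^sub>C (?M k j * ?M i j)" if "1 \<le> i" "i < k" "1 \<le> j" for i k j
  proof (cases "k = 2 \<and> j \<le> 2")
    case True
    then have ik: "i = 1" "k = 2"
      using that by auto
    from True that have "j = 1 \<or> j = 2"
      by auto
    then show ?thesis
      unfolding ik using assms(1,2) by (elim disjE) (simp_all only: block_matrix_simps)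
  next
    case False
    then have "3 \<le> k \<or> 3 \<le> j"
      using that by auto
    with that(2) show ?thesis
      by (auto simp: block_matrix_outside)
  qed
  have cross: "?M i j * ?M k l - ?M k l * ?M i j =
      inverse q *\<^sub>C (?M k j * ?M i l) - q *\<^sub>C (?M i l * ?M k j)"
    if "1 \<le> i" "i < k" "1 \<le> j" "j < l" for i k j l
  proof (cases "k = 2 \<and> l = 2")
    case True
    then have "i = 1" "k = 2" "j = 1" "l = 2"
      using that by auto
    with assms(3) show ?thesis
      by (simp only: block_matrix_simps)
  next
    case False
    then have "3 \<le> k \<or> 3 \<le> l"
      using that by arith
    with that show ?thesis
      by (auto simp: block_matrix_outside)
  qed
  show ?thesis
    unfolding q_manin_def column_relations_def column_q_commutes_def cross_relations_def
    by (intro conjI ballI impI; rule column cross; simp)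
qed

lemma qdet_block_matrix:
  fixes a b c d :: "'a::complex_algebra_1"
  assumes "2 \<le> n"
  shows "qdet q n (block_matrix a b c d) = a * d - inverse q *\<^sub>C (c * b)"
  using assms
proof (induction n rule: dec_induct)
  case base
  have "{1..2} = {1, 2::nat}" "[1..<Suc 2] = [1, 2]"
    by (auto simp: upt_rec)
  then have "qdet q 2 (block_matrix a b c d) = minor (inverse (- q)) (block_matrix a b c d) {1, 2} [1, 2]"
    by (simp only: qdet_eq_minor)
  also have "\<dots> = a * d + inverse (- q) *\<^sub>C (c * b)"
    by (simp add: minor_two_rows block_matrix_simps)
  finally show ?case
    by (simp add: inverse_minus_eq scaleC_minus_left)
next
  case (step n)
  let ?M = "block_matrix a b c d" and ?n = "Suc n"
  have "qdet q ?n ?M = (\<Sum>r = 1..?n. ((- q) powi (int r - int ?n)) *\<^sub>C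
      (qdet q (?n - 1) (delete_row_col r ?n ?M) * ?M r ?n))"
    by (rule qdet_expand_last_column) simp
  also have "\<dots> = (\<Sum>r = 1..?n. if r = ?n then qdet q (?n - 1) (delete_row_col r ?n ?M) else 0)"
    using step.hyps by (intro sum.cong) (auto simp: block_matrix_outside scaleC_one)
  also have "\<dots> = qdet q (?n - 1) (delete_row_col ?n ?n ?M)"
    by simp
  also have "\<dots> = minor (inverse (- q)) ?M ({1..?n} - {?n}) ([1..<?n] @ [Suc ?n..<Suc ?n])"
    by (rule qdet_delete_row_col) simp_all
  also have "{1..?n} - {?n} = {1..n}"
    by auto
  also have "minor (inverse (- q)) ?M {1..n} ([1..<?n] @ [Suc ?n..<Suc ?n]) = qdet q n ?M"
    by (simp add: qdet_eq_minor)
  finally show ?case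
    using step.IH by simp
qed

lemma mtrace_block_matrix:
  fixes a b c d :: "'a::complex_algebra_1"
  assumes "2 \<le> n"
  shows "mtrace n (block_matrix a b c d) = a + d + of_nat (n - 2)"
  using assms
proof (induction n rule: dec_induct)
  case base
  have "{1..2} = {1, 2::nat}"
    by auto
  then show ?case
    by (simp add: mtrace_def block_matrix_simps)
next
  case (step n)
  then show ?case
    by (simp add: mtrace_def block_matrix_outside Suc_diff_le add_ac)
qed

section \<open>Matrix units\<close>

text \<open>
  The operator that sends the basis vector \<open>j\<close> to the basis vector \<open>i\<close> and all others to \<open>0\<close>.
\<close>

lift_definition matrix_unit :: "'k \<Rightarrow> 'k \<Rightarrow> 'k linop" is
  "\<lambda>i j v. Poly_Mapping.single i (Poly_Mapping.lookup v j)"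
  by (auto simp: lookup_add single_add lookup_vscale intro!: poly_mapping_eqI)
     (simp add: lookup_single when_def)

lemma matrix_unit_mult: "matrix_unit i j * matrix_unit k l = (if j = k then matrix_unit i l else 0)"
  by transfer (auto simp: lookup_single)

lemma matrix_unit_nonzero: "matrix_unit i j \<noteq> 0"
proof
  assume "matrix_unit i j = 0"
  then have "apply_linop (matrix_unit i j) (Poly_Mapping.single j 1) = apply_linop 0 (Poly_Mapping.single j 1)"
    by simp
  then have "Poly_Mapping.single i (1::complex) = 0"
    by (simp add: matrix_unit.rep_eq zero_linop.rep_eq)
  then show False
    by (metis lookup_single_eq lookup_zero zero_neq_one)
qed

text \<open>
  Two equal rows \<open>(a, b)\<close> form a Manin matrix if \<open>a\<^sup>2 = b\<^sup>2 = 0\<close> and \<open>a b = -q b a\<close>, and then the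
  determinant is \<open>(1 - q\<^sup>-\<^sup>1) a b\<close>. The operators below satisfy these relations; their basis
  vectors \<open>0, 1, 2, 3\<close> stand for \<open>1, a, b, b a\<close>.
\<close>

lemma coincident_rows_nonzero_qdet:
  assumes "2 \<le> n" "q \<noteq> 0" "q \<noteq> 1"
  shows "\<exists>M :: nat linop matrix. \<exists>r\<in>{1..n}. \<exists>s\<in>{1..n}. r \<noteq> s \<and> q_manin q n n M \<and>
    (\<forall>j\<in>{1..n}. M r j = M s j) \<and> qdet q n M \<noteq> 0"
proof -
  define a b :: "nat linop" where "a = matrix_unit 1 0 + (- q) *\<^sub>C matrix_unit 3 2"
    and "b = matrix_unit 2 0 + matrix_unit 3 1"
  let ?M = "block_matrix a b a b"
  have mult: "a * a = 0" "b * b = 0" "a * b = (- q) *\<^sub>C matrix_unit 3 0" "b * a = matrix_unit 3 0"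
    by (simp_all add: a_def b_def distrib_left distrib_right mult_scaleC_left mult_scaleC_right matrix_unit_mult)
  have "q_manin q n n ?M"
    using assms(2) by (intro q_manin_block_matrix) (simp_all add: mult scaleC_algebra)
  moreover have "qdet q n ?M = (1 - q) *\<^sub>C matrix_unit 3 0"
    using assms(1,2) scaleC_add_left[of 1 "- q" "matrix_unit (3::nat) 0"]
    by (simp add: qdet_block_matrix mult scaleC_algebra)
  then have "qdet q n ?M \<noteq> 0"
    using assms(3) by (simp add: scaleC_eq_0_iff matrix_unit_nonzero)
  moreover have "?M 1 j = ?M 2 j" if "1 \<le> j" for j
    using that by (cases "3 \<le> j") (auto simp: block_matrix_def)
  ultimately show ?thesis
    using assms(1) by (intro exI[of _ ?M] bexI[of _ 1] bexI[of _ 2]) auto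
qed

text \<open>
  With \<open>d = 0\<close> the Manin relations reduce to \<open>a c = q\<^sup>-\<^sup>1 c a\<close> and \<open>c b = q\<^sup>2 b c\<close>, and leave
  \<open>a b\<close> and \<open>b a\<close> unrelated. They hold if \<open>c\<close> multiplies vectors of degree \<open>m\<close> by \<open>q\<^sup>m\<close> while \<open>a\<close> and
  \<open>b\<close> raise the degree by \<open>1\<close> and \<open>2\<close>. Here the basis vector \<open>m\<close> has degree \<open>m\<close>, with
  \<open>a\<close> sending \<open>0\<close> to \<open>1\<close> and \<open>b\<close> sending \<open>1\<close> to \<open>3\<close>, so \<open>b a \<noteq> 0 = a b\<close>.
\<close>

definition noncentral_matrix :: "complex \<Rightarrow> nat linop matrix" where
  "noncentral_matrix q = block_matrix (matrix_unit 1 0) (matrix_unit 3 1)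
     (matrix_unit 0 0 + q *\<^sub>C matrix_unit 1 1 + q ^ 3 *\<^sub>C matrix_unit 3 3) 0"

lemma noncentral_matrix_products:
  fixes a b c :: "nat linop" and q :: complex
  defines "a \<equiv> matrix_unit 1 0" and "b \<equiv> matrix_unit 3 1"
    and "c \<equiv> matrix_unit 0 0 + q *\<^sub>C matrix_unit 1 1 + q ^ 3 *\<^sub>C matrix_unit 3 3"
  shows "a * c = matrix_unit 1 0" "c * a = q *\<^sub>C matrix_unit 1 0"
    "c * b = q ^ 3 *\<^sub>C matrix_unit 3 1" "b * c = q *\<^sub>C matrix_unit 3 1"
    "a * b = 0" "b * a = matrix_unit 3 0"
  unfolding a_def b_def c_def
  by (simp_all add: distrib_left distrib_right mult_scaleC_left mult_scaleC_right matrix_unit_mult)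

lemma q_manin_noncentral_matrix:
  assumes "q \<noteq> 0"
  shows "q_manin q n n (noncentral_matrix q)"
proof -
  have "inverse q * q ^ 3 = q * q"
    using assms by (simp add: power3_eq_cube)
  then show ?thesis
    using assms noncentral_matrix_products(1-4)[where q = q] unfolding noncentral_matrix_def
    by (intro q_manin_block_matrix) (simp_all only: scaleC_scaleC scaleC_one left_inverse[OF assms]
        mult_zero_left mult_zero_right scaleC_zero_right diff_self)
qed

lemma noncentral_matrix_commutator:
  assumes "2 \<le> n" "q \<noteq> 0"
  shows "commutator (qdet q n (noncentral_matrix q)) (mtrace n (noncentral_matrix q)) \<noteq> 0"
proof -
  have "inverse q * q ^ 3 = q\<^sup>2"
    using assms(2) by (simp add: power3_eq_cube power2_eq_square)
  then have "qdet q n (noncentral_matrix q) = - (q\<^sup>2 *\<^sub>C matrix_unit 3 1)"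
    unfolding noncentral_matrix_def qdet_block_matrix[OF assms(1)] noncentral_matrix_products(3)
    by (simp add: scaleC_scaleC)
  moreover have "mtrace n (noncentral_matrix q) = matrix_unit 1 0 + of_nat (n - 2)"
    unfolding noncentral_matrix_def mtrace_block_matrix[OF assms(1)] by simp
  ultimately have "commutator (qdet q n (noncentral_matrix q)) (mtrace n (noncentral_matrix q)) =
      - (q\<^sup>2 *\<^sub>C matrix_unit 3 0)"
    by (simp add: commutator_def algebra_simps mult_scaleC_left mult_scaleC_right matrix_unit_mult
        mult_of_nat_commute)
  then show ?thesis
    using assms(2) by (simp add: scaleC_eq_0_iff matrix_unit_nonzero)
qed

lemma noncentral_matrix_not_quantum:
  assumes "2 \<le> n" "q \<noteq> 0"
  shows "\<not> quantum_matrix q n (noncentral_matrix q)"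
proof
  let ?M = "noncentral_matrix q"
  assume "quantum_matrix q n ?M"
  then have "mtranspose ?M 1 1 * mtranspose ?M 2 1 = inverse q *\<^sub>C (mtranspose ?M 2 1 * mtranspose ?M 1 1)"
    using assms(1) unfolding quantum_matrix_def q_manin_def column_relations_def column_q_commutes_def
    by simp
  then have "inverse q *\<^sub>C (matrix_unit 3 0 :: nat linop) = 0"
    by (simp add: mtranspose_def noncentral_matrix_def block_matrix_simps matrix_unit_mult)
  with assms(2) show False
    by (simp add: scaleC_eq_0_iff matrix_unit_nonzero)
qed


section \<open>Evaluation of noncommutative polynomials\<close>

lemma vscale_eq_mult: "vscale c f = free_scalar c * f"
  by (simp add: vscale_def free_scalar_def mult_map_scale_conv_mult)

lemma poly_mapping_sum_single:
  "(\<Sum>w\<in>Poly_Mapping.keys f. Poly_Mapping.single w (Poly_Mapping.lookup f w)) = f"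
proof (rule poly_mapping_eqI)
  fix k
  show "Poly_Mapping.lookup (\<Sum>w\<in>Poly_Mapping.keys f. Poly_Mapping.single w (Poly_Mapping.lookup f w)) k =
      Poly_Mapping.lookup f k"
    by (simp add: lookup_sum lookup_single when_def sum.delta' in_keys_iff)
qed

definition monomial_value :: "'a::complex_algebra_1 matrix \<Rightarrow> (nat \<times> nat) word \<Rightarrow> 'a" where
  "monomial_value M w = prod_list (map (\<lambda>(i, j). M i j) (letters w))"

lemma monomial_value_plus: "monomial_value M (u + v) = monomial_value M u * monomial_value M v"
  by (simp add: monomial_value_def plus_word_def)

lemma evaluate_superset:
  assumes "finite S" "Poly_Mapping.keys f \<subseteq> S"
  shows "evaluate M f = (\<Sum>w\<in>S. Poly_Mapping.lookup f w *\<^sub>C monomial_value M w)"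
  unfolding evaluate_def monomial_value_def[symmetric] using assms
  by (intro sum.mono_neutral_left) (auto simp: in_keys_iff)

lemma evaluate_zero: "evaluate M 0 = 0"
  by (simp add: evaluate_def)

lemma evaluate_add: "evaluate M (f + g) = evaluate M f + evaluate M g"
proof -
  let ?S = "Poly_Mapping.keys f \<union> Poly_Mapping.keys g"
  have "finite ?S"
    by simp
  moreover have "Poly_Mapping.keys (f + g) \<subseteq> ?S"
    by (rule keys_add)
  ultimately show ?thesis
    by (simp add: evaluate_superset[of ?S] lookup_add scaleC_add_left sum.distrib)
qed

lemma evaluate_uminus: "evaluate M (- f) = - evaluate M f"
  using evaluate_add[of M f "- f"] by (simp add: evaluate_zero eq_neg_iff_add_eq_0 add.commute)

lemma evaluate_diff: "evaluate M (f - g) = evaluate M f - evaluate M g"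
  using evaluate_add[of M f "- g"] by (simp add: evaluate_uminus)

lemma evaluate_sum: "evaluate M (sum f A) = (\<Sum>x\<in>A. evaluate M (f x))"
  by (induction A rule: infinite_finite_induct) (simp_all add: evaluate_zero evaluate_add)

lemma evaluate_single: "evaluate M (Poly_Mapping.single w c) = c *\<^sub>C monomial_value M w"
  using evaluate_superset[of "{w}" "Poly_Mapping.single w c" M] by simp

lemma evaluate_mult: "evaluate M (f * g) = evaluate M f * evaluate M g"
proof -
  have "f * g = (\<Sum>u\<in>Poly_Mapping.keys f. \<Sum>v\<in>Poly_Mapping.keys g.
      Poly_Mapping.single (u + v) (Poly_Mapping.lookup f u * Poly_Mapping.lookup g v))"
    by (subst (1 2) poly_mapping_sum_single[symmetric]) (simp add: sum_product mult_single)
  then have "evaluate M (f * g) = (\<Sum>u\<in>Poly_Mapping.keys f. \<Sum>v\<in>Poly_Mapping.keys g.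
      (Poly_Mapping.lookup f u *\<^sub>C monomial_value M u) * (Poly_Mapping.lookup g v *\<^sub>C monomial_value M v))"
    by (simp add: evaluate_sum evaluate_single monomial_value_plus scaleC_algebra mult_ac)
  then show ?thesis
    by (simp add: evaluate_def monomial_value_def sum_product)
qed

lemma evaluate_free_gen: "evaluate M (free_gen (i, j)) = M i j"
  by (simp add: free_gen_def evaluate_single monomial_value_def scaleC_one)

lemma evaluate_free_scalar: "evaluate M (free_scalar c) = c *\<^sub>C 1"
  by (simp add: free_scalar_def evaluate_single monomial_value_def zero_word_def)

lemmas evaluate_simps = evaluate_zero evaluate_add evaluate_diff evaluate_mult evaluate_free_gen
  evaluate_free_scalar

text \<open>
  Relations that follow from the Manin relations hold for every Manin matrix.
\<close>

lemma evaluate_ideal_q_manin: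
  assumes "q_manin q n n N" "f \<in> two_sided_ideal (q_manin_relators q n)"
  shows "evaluate N f = 0"
  using assms(2)
proof induction
  case (gen f)
  then show ?case
    unfolding q_manin_relators_def Let_def
  proof (elim UnE CollectE exE conjE)
    fix i j k assume "f = free_gen (i, j) * free_gen (k, j) -
        free_scalar (inverse q) * (free_gen (k, j) * free_gen (i, j))"
      "i \<in> {1..n}" "j \<in> {1..n}" "k \<in> {1..n}" "i < k"
    moreover from this have "N i j * N k j = inverse q *\<^sub>C (N k j * N i j)"
      using assms(1) unfolding q_manin_def column_relations_def column_q_commutes_def by blast
    ultimately show "evaluate N f = 0"
      by (simp add: evaluate_simps mult_scaleC_left)
  next
    fix i j k l assume "f = free_gen (i, j) * free_gen (k, l) - free_gen (k, l) * free_gen (i, j) -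
        (free_scalar (inverse q) * (free_gen (k, j) * free_gen (i, l)) -
         free_scalar q * (free_gen (i, l) * free_gen (k, j)))"
      "i \<in> {1..n}" "j \<in> {1..n}" "k \<in> {1..n}" "l \<in> {1..n}" "i < k" "j < l"
    moreover from this have "N i j * N k l - N k l * N i j =
        inverse q *\<^sub>C (N k j * N i l) - q *\<^sub>C (N i l * N k j)"
      using assms(1) unfolding q_manin_def cross_relations_def by blast
    ultimately show "evaluate N f = 0"
      by (simp add: evaluate_simps mult_scaleC_left)
  qed
qed (simp_all add: evaluate_simps)


section \<open>The commutator of the generic determinant and trace\<close>

text \<open>
  The determinant and the trace as noncommutative polynomials, so that a relation between the
  entries of one matrix can be carried over to another.
\<close>

definition generic_qdet :: "complex \<Rightarrow> nat \<Rightarrow> (nat \<times> nat) free_algebra" where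
  "generic_qdet q n = (\<Sum>\<tau> | \<tau> permutes {1..n}.
     Poly_Mapping.single (Word (map (\<lambda>j. (\<tau> j, j)) [1..<Suc n])) ((- q) powi (- int (inversions n \<tau>))))"

definition generic_trace :: "nat \<Rightarrow> (nat \<times> nat) free_algebra" where
  "generic_trace n = (\<Sum>i = 1..n. free_gen (i, i))"

lemma evaluate_generic_qdet: "evaluate M (generic_qdet q n) = qdet q n M"
  by (simp add: generic_qdet_def qdet_def evaluate_sum evaluate_single monomial_value_def comp_def)

lemma evaluate_generic_trace: "evaluate M (generic_trace n) = mtrace n M"
  by (simp add: generic_trace_def mtrace_def evaluate_sum evaluate_free_gen)

definition polynomials_in :: "'g set \<Rightarrow> 'g free_algebra set" where
  "polynomials_in X = {f. \<forall>w\<in>Poly_Mapping.keys f. set (letters w) \<subseteq> X}"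

lemma polynomials_in_single: "set (letters w) \<subseteq> X \<Longrightarrow> Poly_Mapping.single w c \<in> polynomials_in X"
  by (simp add: polynomials_in_def)

lemma polynomials_in_diff:
  assumes "f \<in> polynomials_in X" "g \<in> polynomials_in X"
  shows "f - g \<in> polynomials_in X"
  using assms keys_diff[of f g] by (auto simp: polynomials_in_def)

lemma polynomials_in_sum:
  assumes "\<And>x. x \<in> A \<Longrightarrow> f x \<in> polynomials_in X"
  shows "sum f A \<in> polynomials_in X"
  using assms keys_sum[of f A] by (fastforce simp: polynomials_in_def)

lemma polynomials_in_mult:
  assumes "f \<in> polynomials_in X" "g \<in> polynomials_in X"
  shows "f * g \<in> polynomials_in X"
  using assms keys_mult[of f g] by (fastforce simp: polynomials_in_def plus_word_def)

lemma generic_qdet_in: "generic_qdet q n \<in> polynomials_in ({1..n} \<times> {1..n})"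
  unfolding generic_qdet_def
proof (intro polynomials_in_sum polynomials_in_single)
  fix \<tau> assume "\<tau> \<in> {\<tau>. \<tau> permutes {1..n}}"
  then show "set (letters (Word (map (\<lambda>j. (\<tau> j, j)) [1..<Suc n]))) \<subseteq> {1..n} \<times> {1..n}"
    using permutes_in_image[of \<tau> "{1..n}"]
    by (simp add: atLeastLessThanSuc_atLeastAtMost image_subset_iff del: atLeastAtMost_iff)
qed

lemma generic_trace_in: "generic_trace n \<in> polynomials_in ({1..n} \<times> {1..n})"
  unfolding generic_trace_def free_gen_def by (intro polynomials_in_sum polynomials_in_single) simp

text \<open>
  If the commutator vanished for a generic matrix, then it would lie in the ideal of the Manin
  relations and vanish for every Manin matrix, in particular for \<open>noncentral_matrix\<close>.
\<close>

theorem generic_commutator_nonzero: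
  fixes M :: "'a::complex_algebra_1 matrix"
  assumes "2 \<le> n" "q \<noteq> 0" "generic_q_manin q n M"
  shows "commutator (qdet q n M) (mtrace n M) \<noteq> 0"
proof
  let ?f = "generic_qdet q n * generic_trace n - generic_trace n * generic_qdet q n"
  have "?f \<in> polynomials_in ({1..n} \<times> {1..n})"
    by (intro polynomials_in_diff polynomials_in_mult generic_qdet_in generic_trace_in)
  moreover assume "commutator (qdet q n M) (mtrace n M) = 0"
  then have "evaluate M ?f = 0"
    by (simp only: evaluate_diff evaluate_mult evaluate_generic_qdet evaluate_generic_trace commutator_def)
  ultimately have "?f \<in> two_sided_ideal (q_manin_relators q n)"
    using assms(3) unfolding generic_q_manin_def polynomials_in_def by blast
  then have "evaluate (noncentral_matrix q) ?f = 0"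
    using evaluate_ideal_q_manin[OF q_manin_noncentral_matrix[OF assms(2)]] by blast
  then have "commutator (qdet q n (noncentral_matrix q)) (mtrace n (noncentral_matrix q)) = 0"
    by (simp only: evaluate_diff evaluate_mult evaluate_generic_qdet evaluate_generic_trace commutator_def)
  with noncentral_matrix_commutator[OF assms(1,2)] show False
    by contradiction
qed

lemma generated_algebra_sum:
  assumes "finite A" "\<And>x. x \<in> A \<Longrightarrow> f x \<in> generated_algebra S"
  shows "sum f A \<in> generated_algebra S"
  using assms
proof (induction A rule: finite_induct)
  case empty
  have "0 *\<^sub>C 1 \<in> generated_algebra S"
    by (intro generated_algebra.scale generated_algebra.one)
  then show ?case
    by simp
qed (simp add: generated_algebra.add)

lemma mtrace_in_generated_algebra: "mtrace n M \<in> generated_algebra (entries n M)"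
  unfolding mtrace_def entries_def by (intro generated_algebra_sum generated_algebra.gen) auto


section \<open>Existence of a generic Manin matrix\<close>

lemma vector_space_vscale: "vector_space (vscale :: complex \<Rightarrow> ('k \<Rightarrow>\<^sub>0 complex) \<Rightarrow> _)"
  by (simp add: vector_space_def vscale_simps)

text \<open>
  A basis of \<open>I\<close> is extended to a basis of the whole space; \<open>P\<close> kills the former and fixes the
  added vectors.
\<close>

lemma exists_projection_along:
  fixes I :: "('k \<Rightarrow>\<^sub>0 complex) set"
  assumes "0 \<in> I" "\<And>x y. x \<in> I \<Longrightarrow> y \<in> I \<Longrightarrow> x + y \<in> I" "\<And>c x. x \<in> I \<Longrightarrow> vscale c x \<in> I"
  obtains P where "\<And>x y. P (x + y) = P x + P y" "\<And>c x. P (vscale c x) = vscale c (P x)"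
    "\<And>x. P x = 0 \<longleftrightarrow> x \<in> I" "\<And>x. x - P x \<in> I"
proof -
  interpret vector_space "vscale :: complex \<Rightarrow> ('k \<Rightarrow>\<^sub>0 complex) \<Rightarrow> _"
    by (rule vector_space_vscale)
  interpret pair: vector_space_pair "vscale :: complex \<Rightarrow> ('k \<Rightarrow>\<^sub>0 complex) \<Rightarrow> _"
    "vscale :: complex \<Rightarrow> ('k \<Rightarrow>\<^sub>0 complex) \<Rightarrow> _" ..
  have I: "subspace I"
    using assms by (simp add: subspace_def)
  obtain B where B: "B \<subseteq> I" "independent B" "I \<subseteq> span B"
    using maximal_independent_subset[of I] by blast
  let ?E = "extend_basis B"
  have E: "independent ?E" "span ?E = UNIV"
    using independent_extend_basis[OF B(2)] span_extend_basis[OF B(2)] by simp_all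
  obtain P where P: "Vector_Spaces.linear vscale vscale P"
    "\<forall>x\<in>?E. P x = (if x \<in> B then 0 else x)"
    using pair.linear_independent_extend[OF E(1), of "\<lambda>x. if x \<in> B then 0 else x"] by blast
  have add: "P (x + y) = P x + P y" and scale: "P (vscale c x) = vscale c (P x)" for x y c
    using P(1) by (simp_all add: pair.linear_add pair.linear_scale)
  have diff: "x - P x \<in> I" for x
  proof -
    have "x \<in> span ?E"
      using E(2) by simp
    then show ?thesis
    proof (induction rule: span_induct_alt)
      case base
      have "P 0 = 0"
        using add[of 0 0] by simp
      then show ?case
        using assms(1) by simp
    next
      case (step c x y)
      have "x - P x \<in> I"
        using step(1) P(2) B(1) assms(1) by auto
      then have "vscale c (x - P x) + (y - P y) \<in> I"
        using step(2) assms(2,3) by blast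
      then show ?case
        by (simp add: add scale vscale_simps algebra_simps)
    qed
  qed
  have zero: "P x = 0 \<longleftrightarrow> x \<in> I" for x
  proof
    assume "P x = 0"
    then show "x \<in> I"
      using diff[of x] by simp
  next
    assume "x \<in> I"
    then have "x \<in> span B"
      using B(3) by blast
    moreover have "P b = 0" if "b \<in> B" for b
      using P(2) that extend_basis_superset[OF B(2)] by auto
    ultimately show "P x = 0"
      using pair.linear_eq_0_on_span[OF P(1)] by blast
  qed
  show ?thesis
    using that[of P] add scale zero diff by blast
qed

text \<open>
  The quotient of the free algebra by the ideal \<open>I\<close> is identified with the range of a projection
  \<open>P\<close> with kernel \<open>I\<close>, so that its elements act on the free algebra itself: \<open>L x\<close> is
  \<open>v \<mapsto> P (x * P v)\<close>. As \<open>I\<close> is an ideal, \<open>L\<close> is linear and multiplicative and kills \<open>I\<close>, hence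
  the operators of the generators satisfy the Manin relations. It does not preserve the unit, as
  \<open>L 1 = P\<close>, but on the range of \<open>P\<close> this makes no difference: the evaluation of \<open>f\<close>
  sends \<open>P 1\<close> to \<open>P f\<close>, which vanishes only for \<open>f \<in> I\<close>.
\<close>

theorem exists_generic_q_manin:
  "\<exists>M :: (nat \<times> nat) word linop matrix. generic_q_manin q n M"
proof -
  define I where "I = two_sided_ideal (q_manin_relators q n)"
  note ideal = two_sided_ideal.intros[where S = "q_manin_relators q n", folded I_def]
  obtain P :: "(nat \<times> nat) free_algebra \<Rightarrow> (nat \<times> nat) free_algebra"
    where add: "\<And>x y. P (x + y) = P x + P y" and scale: "\<And>c x. P (vscale c x) = vscale c (P x)"
      and zero: "\<And>x. P x = 0 \<longleftrightarrow> x \<in> I" and proj: "\<And>x. x - P x \<in> I"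
    using exists_projection_along[of I] ideal unfolding vscale_eq_mult by blast
  have diff: "P (x - y) = P x - P y" for x y
    using add[of "x - y" y] by (simp add: algebra_simps)
  have inner: "P (x * P y) = P (x * y)" for x y
  proof -
    have "x * (y - P y) \<in> I"
      using proj ideal(4) by blast
    then have "P (x * y - x * P y) = 0"
      by (simp add: zero right_diff_distrib)
    then show ?thesis
      by (simp add: diff)
  qed
  define L where "L x = Linop (\<lambda>v. P (x * P v))" for x
  have "(\<lambda>v. P (x * P v)) \<in> {T. (\<forall>u v. T (u + v) = T u + T v) \<and> (\<forall>c v. T (vscale c v) = vscale c (T v))}" for x
  proof -
    have "x * vscale c v = vscale c (x * v)" for c and v :: "(nat \<times> nat) free_algebra"
    proof -
      have "x * Poly_Mapping.single 0 c = Poly_Mapping.single 0 c * x" for c :: complex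
        by (subst (1 2) poly_mapping_sum_single[symmetric, of x])
          (simp add: sum_distrib_left sum_distrib_right mult_single mult.commute)
      then show ?thesis
        by (simp add: vscale_eq_mult free_scalar_def mult.assoc[symmetric])
    qed
    then show ?thesis
      by (simp add: add scale distrib_left)
  qed
  then have apply_L: "apply_linop (L x) v = P (x * P v)" for x v
    by (simp add: L_def Linop_inverse)
  have L_mult: "L x * L y = L (x * y)" for x y
    by (simp add: apply_linop_inject[symmetric] times_linop.rep_eq apply_L inner
        inner[of "x * y" for x y, unfolded mult.assoc] mult.assoc fun_eq_iff)
  have L_diff: "L x - L y = L (x - y)" for x y
    by (simp add: apply_linop_inject[symmetric] minus_linop.rep_eq apply_L diff left_diff_distrib fun_eq_iff)
  have L_scale: "c *\<^sub>C L x = L (free_scalar c * x)" for c x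
    using scale[unfolded vscale_eq_mult, symmetric]
    by (simp add: apply_linop_inject[symmetric] scaleC_linop.rep_eq apply_L fun_eq_iff mult.assoc
        vscale_eq_mult)
  have L_zero: "L x = 0" if "x \<in> I" for x
    using that ideal(5) by (simp add: apply_linop_inject[symmetric] zero_linop.rep_eq apply_L fun_eq_iff zero)
  define M where "M i j = L (free_gen (i, j))" for i j
  have "q_manin q n n M"
  proof -
    have "M i j * M k j = inverse q *\<^sub>C (M k j * M i j)"
      if "i \<in> {1..n}" "j \<in> {1..n}" "k \<in> {1..n}" "i < k" for i j k
    proof -
      have "free_gen (i, j) * free_gen (k, j) -
          free_scalar (inverse q) * (free_gen (k, j) * free_gen (i, j)) \<in> I"
        using that unfolding q_manin_relators_def Let_def
        by (intro ideal(1)[unfolded q_manin_relators_def Let_def] UnI1) blast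
      then have "M i j * M k j - inverse q *\<^sub>C (M k j * M i j) = 0"
        by (simp only: M_def L_mult L_scale L_diff L_zero)
      then show ?thesis
        by simp
    qed
    moreover have "M i j * M k l - M k l * M i j = inverse q *\<^sub>C (M k j * M i l) - q *\<^sub>C (M i l * M k j)"
      if "i \<in> {1..n}" "j \<in> {1..n}" "k \<in> {1..n}" "l \<in> {1..n}" "i < k" "j < l" for i j k l
    proof -
      have "free_gen (i, j) * free_gen (k, l) - free_gen (k, l) * free_gen (i, j) -
          (free_scalar (inverse q) * (free_gen (k, j) * free_gen (i, l)) -
           free_scalar q * (free_gen (i, l) * free_gen (k, j))) \<in> I"
        using that unfolding q_manin_relators_def Let_def
        by (intro ideal(1)[unfolded q_manin_relators_def Let_def] UnI2) blast
      then have "M i j * M k l - M k l * M i j -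
          (inverse q *\<^sub>C (M k j * M i l) - q *\<^sub>C (M i l * M k j)) = 0"
        by (simp only: M_def L_mult L_scale L_diff L_zero)
      then show ?thesis
        by simp
    qed
    ultimately show ?thesis
      unfolding q_manin_def column_relations_def column_q_commutes_def cross_relations_def by blast
  qed
  moreover have "f \<in> I" if "evaluate M f = 0" for f
  proof -
    have word: "apply_linop (prod_list (map (\<lambda>(i, j). M i j) xs)) (P v) =
        P (Poly_Mapping.single (Word xs) 1 * v)" for xs v
    proof (induction xs)
      case Nil
      have "Poly_Mapping.single (Word []) 1 = (1 :: (nat \<times> nat) free_algebra)"
        by (metis zero_word_def single_one)
      then show ?case
        by (simp add: one_linop.rep_eq)
    next
      case (Cons x xs)
      have "Poly_Mapping.single (Word (x # xs)) 1 =
          free_gen x * (Poly_Mapping.single (Word xs) 1 :: (nat \<times> nat) free_algebra)"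
        by (simp add: free_gen_def mult_single plus_word_def)
      then show ?case
        using Cons.IH
        by (simp add: times_linop.rep_eq M_def apply_L inner mult.assoc case_prod_beta)
    qed
    have single_scale: "vscale c (Poly_Mapping.single w 1) = Poly_Mapping.single w c"
      for c and w :: "(nat \<times> nat) word"
      by (rule poly_mapping_eqI) (simp add: lookup_vscale lookup_single when_def)
    have P_sum: "P (sum g A) = (\<Sum>x\<in>A. P (g x))" for g and A :: "(nat \<times> nat) word set"
    proof -
      have "P 0 = 0"
        using add[of 0 0] by simp
      then show ?thesis
        by (induction A rule: infinite_finite_induct) (simp_all add: add)
    qed
    have apply_sum: "apply_linop (sum g A) v = (\<Sum>x\<in>A. apply_linop (g x) v)"
      for g :: "(nat \<times> nat) word \<Rightarrow> (nat \<times> nat) word linop" and A v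
      by (induction A rule: infinite_finite_induct) (simp_all add: zero_linop.rep_eq plus_linop.rep_eq)
    have "apply_linop (evaluate M f) (P 1) =
        (\<Sum>w\<in>Poly_Mapping.keys f. P (Poly_Mapping.single w (Poly_Mapping.lookup f w)))"
      unfolding evaluate_def apply_sum
    proof (intro sum.cong refl)
      fix w assume "w \<in> Poly_Mapping.keys f"
      have "Word (letters w) = w"
        by simp
      then show "apply_linop (Poly_Mapping.lookup f w *\<^sub>C prod_list (map (\<lambda>(i, j). M i j) (letters w))) (P 1) =
          P (Poly_Mapping.single w (Poly_Mapping.lookup f w))"
        by (simp only: scaleC_linop.rep_eq word mult_1_right scale[symmetric] single_scale)
    qed
    also have "\<dots> = P f"
      by (simp only: P_sum[symmetric] poly_mapping_sum_single)
    finally have "P f = 0"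
      using that by (simp add: zero_linop.rep_eq)
    then show ?thesis
      by (simp add: zero)
  qed
  ultimately show ?thesis
    unfolding generic_q_manin_def I_def by blast
qed


section \<open>Properties of the \<open>q\<close>-determinant\<close>

theorem proposition3p3:
  fixes q :: complex
  assumes "q \<noteq> 0"
  shows
    \<comment> \<open>1. Linearity in columns and rows\<close>
    "(\<forall>n (p::nat) s. \<forall>M :: 'a::complex_algebra_1 matrix. \<forall>v.
        s \<in> {1..n} \<longrightarrow> (\<forall>i\<in>{1..n}. M i s = (\<Sum>t = 1..p. v t i)) \<longrightarrow>
        qdet q n M = (\<Sum>t = 1..p. qdet q n (replace_column s (v t) M))) \<and>
     (\<forall>n (p::nat) r. \<forall>M :: 'a matrix. \<forall>v.
        r \<in> {1..n} \<longrightarrow> (\<forall>j\<in>{1..n}. M r j = (\<Sum>t = 1..p. v t j)) \<longrightarrow>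
        qdet q n M = (\<Sum>t = 1..p. qdet q n (replace_row r (v t) M))) \<and>

     \<comment> \<open>2. Permutation of columns\<close>
     (\<forall>n \<sigma>. \<forall>M :: 'a matrix.
        cross_relations q n n M \<longrightarrow> \<sigma> permutes {1..n} \<longrightarrow>
        qdet q n (\<lambda>i j. M i (\<sigma> j)) = ((- q) powi (- int (inversions n \<sigma>))) *\<^sub>C qdet q n M) \<and>
     (\<forall>n \<sigma>. q\<^sup>2 \<noteq> 1 \<longrightarrow> \<sigma> permutes {1..n} \<longrightarrow> \<sigma> \<noteq> id \<longrightarrow>
        (\<exists>M :: complex matrix. q_manin q n n M \<and> \<not> q_manin q n n (\<lambda>i j. M i (\<sigma> j)))) \<and>
     (\<forall>n \<sigma>. q\<^sup>2 \<noteq> 1 \<longrightarrow> \<sigma> permutes {1..n} \<longrightarrow> \<sigma> \<noteq> id \<longrightarrow>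
        (\<exists>M :: complex matrix. q_manin q n n M \<and> \<not> q_manin q n n (\<lambda>i j. M (\<sigma> i) j))) \<and>

     \<comment> \<open>3. Matrices with coincident columns\<close>
     (\<forall>n r s. \<forall>M :: 'a matrix.
        q_manin q n n M \<longrightarrow> r \<in> {1..n} \<longrightarrow> s \<in> {1..n} \<longrightarrow> r \<noteq> s \<longrightarrow>
        (\<forall>i\<in>{1..n}. M i r = M i s) \<longrightarrow> qdet q n M = 0) \<and>
     (\<forall>n r s. \<forall>M :: 'a matrix.
        q \<noteq> - 1 \<longrightarrow> cross_relations q n n M \<longrightarrow> r \<in> {1..n} \<longrightarrow> s \<in> {1..n} \<longrightarrow> r \<noteq> s \<longrightarrow>
        (\<forall>i\<in>{1..n}. M i r = M i s) \<longrightarrow> qdet q n M = 0) \<and>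
     (\<forall>n r s. \<forall>M :: 'a matrix.
        q_manin q n n M \<longrightarrow> r \<in> {1..n} \<longrightarrow> s \<in> {1..n} \<longrightarrow> s \<noteq> r \<longrightarrow>
        qdet q n (replace_column s (\<lambda>i. M i r) M) = 0) \<and>
     (\<forall>n r s. \<forall>M :: 'a matrix.
        cross_relations q n n M \<longrightarrow> r \<in> {1..n} \<longrightarrow> s \<in> {1..n} \<longrightarrow> s \<noteq> r \<longrightarrow>
        column_q_commutes q n M r \<longrightarrow>
        qdet q n (replace_column s (\<lambda>i. M i r) M) = 0) \<and>
     (\<forall>n r s. q\<^sup>2 \<noteq> 1 \<longrightarrow> r \<in> {1..n} \<longrightarrow> s \<in> {1..n} \<longrightarrow> 2 \<le> \<bar>int s - int r\<bar> \<longrightarrow>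
        (\<exists>M :: complex matrix. q_manin q n n M \<and>
           \<not> q_manin q n n (replace_column s (\<lambda>i. M i r) M))) \<and>
     (\<forall>n\<ge>2. q \<noteq> 1 \<longrightarrow>
        (\<exists>M :: nat linop matrix. \<exists>r\<in>{1..n}. \<exists>s\<in>{1..n}. r \<noteq> s \<and> q_manin q n n M \<and>
           (\<forall>j\<in>{1..n}. M r j = M s j) \<and> qdet q n M \<noteq> 0)) \<and>

     \<comment> \<open>4. Determinant multiplicativity and Cauchy--Binet formula\<close>
     (\<forall>n. \<forall>M N :: 'a matrix.
        q_manin q n n M \<longrightarrow>
        (\<forall>i\<in>{1..n}. \<forall>j\<in>{1..n}. \<forall>k\<in>{1..n}. \<forall>l\<in>{1..n}. commutator (M i j) (N k l) = 0) \<longrightarrow>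
        qdet q n (mmult n M N) = qdet q n M * qdet q n N) \<and>
     (\<forall>m p n r. \<forall>M N :: 'a matrix. \<forall>I J.
        q_manin q m p M \<longrightarrow>
        (\<forall>i\<in>{1..m}. \<forall>j\<in>{1..p}. \<forall>k\<in>{1..p}. \<forall>l\<in>{1..n}. commutator (M i j) (N k l) = 0) \<longrightarrow>
        I \<in> increasing_multi_indices m r \<longrightarrow> length J = r \<longrightarrow> set J \<subseteq> {1..n} \<longrightarrow>
        qdet q r (submat (mmult p M N) I J) =
          (\<Sum>L\<in>increasing_multi_indices p r. qdet q r (submat M I L) * qdet q r (submat N L J))) \<and>
     (\<forall>m p n. \<forall>M N :: 'a matrix.
        q_manin q m p M \<longrightarrow> q_manin q p n N \<longrightarrow>
        (\<forall>i\<in>{1..m}. \<forall>j\<in>{1..p}. \<forall>k\<in>{1..p}. \<forall>l\<in>{1..n}. commutator (M i j) (N k l) = 0) \<longrightarrow>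
        q_manin q m n (mmult p M N)) \<and>

     \<comment> \<open>5. Column expansion\<close>
     (\<forall>n\<ge>1. \<forall>M :: 'a matrix.
        qdet q n M =
          (\<Sum>r = 1..n. ((- q) powi (1 - int r)) *\<^sub>C (M r 1 * qdet q (n - 1) (delete_row_col r 1 M))) \<and>
        qdet q n M =
          (\<Sum>r = 1..n. ((- q) powi (int r - int n)) *\<^sub>C (qdet q (n - 1) (delete_row_col r n M) * M r n))) \<and>
     (\<forall>n. \<forall>M :: 'a matrix. \<forall>s\<in>{1..n}.
        cross_relations q n n M \<longrightarrow>
        qdet q n M =
          (\<Sum>r = 1..n. ((- q) powi (int s - int r)) *\<^sub>C (M r s * qdet q (n - 1) (delete_row_col r s M))) \<and>
        qdet q n M =
          (\<Sum>r = 1..n. ((- q) powi (int r - int s)) *\<^sub>C (qdet q (n - 1) (delete_row_col r s M) * M r s))) \<and>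

     \<comment> \<open>6. Laplace expansion\<close>
     (\<forall>n m. \<forall>M :: 'a matrix.
        m \<le> n \<longrightarrow>
        qdet q n M =
          (\<Sum>K\<in>increasing_multi_indices n m.
             ((- q) powi (- (\<Sum>l = 1..m. int (K ! (l - 1)) - int l))) *\<^sub>C
               (qdet q m (submat M K [1..<Suc m]) *
                qdet q (n - m) (submat M (complement_multi_index n K) [Suc m..<Suc n])))) \<and>
     (\<forall>n m. \<forall>M :: 'a matrix. \<forall>I1 I2.
        q_manin q n n M \<longrightarrow> m \<le> n \<longrightarrow>
        length I1 = m \<longrightarrow> set I1 \<subseteq> {1..n} \<longrightarrow> length I2 = n - m \<longrightarrow> set I2 \<subseteq> {1..n} \<longrightarrow>
        q_epsilon q n (I1 @ I2) *\<^sub>C qdet q n M =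
          (\<Sum>K\<in>increasing_multi_indices n m.
             ((- q) powi (- (\<Sum>l = 1..m. int (K ! (l - 1)) - int l))) *\<^sub>C
               (qdet q m (submat M K I1) *
                qdet q (n - m) (submat M (complement_multi_index n K) I2)))) \<and>
     (\<forall>n. \<forall>M :: 'a matrix. \<forall>ls :: nat list. \<forall>Is :: nat list list.
        sum_list ls = n \<longrightarrow> map length Is = ls \<longrightarrow> set (concat Is) \<subseteq> {1..n} \<longrightarrow>
        q_manin q n n M \<or> concat Is = [1..<Suc n] \<longrightarrow>
        q_epsilon q n (concat Is) *\<^sub>C qdet q n M =
          (\<Sum>Ks | map length Ks = ls \<and> (\<forall>K\<in>set Ks. sorted_wrt (<) K \<and> set K \<subseteq> {1..n}).
             q_epsilon q n (concat Ks) *\<^sub>C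
               prod_list (map2 (\<lambda>K I. qdet q (length I) (submat M K I)) Ks Is))) \<and>

     \<comment> \<open>7. Non-centrality of the q-determinant\<close>
     (\<forall>n\<ge>2. \<exists>M :: (nat \<times> nat) word linop matrix. generic_q_manin q n M) \<and>
     (\<forall>n\<ge>2. \<forall>M :: 'a matrix. generic_q_manin q n M \<longrightarrow>
        (\<exists>x\<in>generated_algebra (entries n M). commutator (qdet q n M) x \<noteq> 0) \<and>
        commutator (qdet q n M) (mtrace n M) \<noteq> 0) \<and>
     (\<forall>n. \<forall>T :: 'a matrix. q\<^sup>2 \<noteq> - 1 \<longrightarrow> quantum_matrix q n T \<longrightarrow>
        (\<forall>x\<in>generated_algebra (entries n T). commutator (qdet q n T) x = 0)) \<and>
     (\<forall>n\<ge>2. \<exists>M :: nat linop matrix. q_manin q n n M \<and> \<not> quantum_matrix q n M)"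
proof (intro conjI, goal_cases)
  case 1
  show ?case
    using qdet_column_sum by blast
next
  case 2
  show ?case
    using qdet_row_sum by blast
next
  case 3
  show ?case
    using qdet_permute_columns[OF assms] by blast
next
  case 4
  show ?case
    using permuted_columns_not_manin[OF assms] by blast
next
  case 5
  show ?case
    using permuted_rows_not_manin[OF assms] by blast
next
  case 6
  show ?case
  proof (intro allI impI)
    fix n r s :: nat and M :: "'a matrix"
    assume *: "q_manin q n n M" "r \<in> {1..n}" "s \<in> {1..n}" "r \<noteq> s" "\<forall>i\<in>{1..n}. M i r = M i s"
    then have "cross_relations q n n M" "column_q_commutes q n M r"
      by (simp_all add: q_manin_def column_relations_def)
    with * show "qdet q n M = 0"
      using qdet_coincident_columns[OF assms] by blast
  qed
next
  case 7
  show ?case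
    using qdet_coincident_columns[OF assms] by blast
next
  case 8
  show ?case
  proof (intro allI impI)
    fix n r s :: nat and M :: "'a matrix"
    assume *: "q_manin q n n M" "r \<in> {1..n}" "s \<in> {1..n}" "s \<noteq> r"
    then have "cross_relations q n n M" "column_q_commutes q n M r"
      by (simp_all add: q_manin_def column_relations_def)
    with * show "qdet q n (replace_column s (\<lambda>i. M i r) M) = 0"
      using qdet_replace_column_by_commuting[OF assms] by blast
  qed
next
  case 9
  show ?case
    using qdet_replace_column_by_commuting[OF assms] by blast
next
  case 10
  show ?case
    using replaced_column_not_manin[OF assms] by blast
next
  case 11
  show ?case
    using coincident_rows_nonzero_qdet[OF _ assms] by blast
next
  case 12
  show ?case
    using qdet_mmult[OF assms] by blast
next
  case 13
  show ?case
    using qdet_submat_mmult[OF assms] by blast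
next
  case 14
  show ?case
    using q_manin_mmult[OF assms] by blast
next
  case 15
  show ?case
    using qdet_expand_first_column qdet_expand_last_column by blast
next
  case 16
  show ?case
    using qdet_expand_column[OF assms] by blast
next
  case 17
  show ?case
  proof (intro allI impI)
    fix n m :: nat and M :: "'a matrix"
    assume "m \<le> n"
    then have "[1..<Suc n] = [1..<Suc m] @ [Suc m..<Suc n]"
      by (intro upt_split) simp_all
    with \<open>m \<le> n\<close> show "qdet q n M =
        (\<Sum>K\<in>increasing_multi_indices n m.
           ((- q) powi (- (\<Sum>l = 1..m. int (K ! (l - 1)) - int l))) *\<^sub>C
             (qdet q m (submat M K [1..<Suc m]) *
              qdet q (n - m) (submat M (complement_multi_index n K) [Suc m..<Suc n])))"
      unfolding qdet_eq_minor[of q n]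
      by (simp only:) (rule minor_laplace_increasing; simp)
  qed
next
  case 18
  show ?case
  proof (intro allI impI)
    fix n m :: nat and M :: "'a matrix" and I1 I2 :: "nat list"
    assume *: "q_manin q n n M" "m \<le> n" "length I1 = m" "set I1 \<subseteq> {1..n}"
      "length I2 = n - m" "set I2 \<subseteq> {1..n}"
    then have "minor (inverse (- q)) M {1..n} (I1 @ I2) = q_epsilon q n (I1 @ I2) *\<^sub>C qdet q n M"
      using assms by (intro minor_eq_epsilon_qdet_manin) simp_all
    then show "q_epsilon q n (I1 @ I2) *\<^sub>C qdet q n M =
        (\<Sum>K\<in>increasing_multi_indices n m.
           ((- q) powi (- (\<Sum>l = 1..m. int (K ! (l - 1)) - int l))) *\<^sub>C
             (qdet q m (submat M K I1) * qdet q (n - m) (submat M (complement_multi_index n K) I2)))"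
      using minor_laplace_increasing[OF *(2,3,5), of q M] by (simp only:)
  qed
next
  case 19
  show ?case
  proof (intro allI impI)
    fix n :: nat and M :: "'a matrix" and ls :: "nat list" and Is :: "nat list list"
    assume *: "sum_list ls = n" "map length Is = ls" "set (concat Is) \<subseteq> {1..n}"
      "q_manin q n n M \<or> concat Is = [1..<Suc n]"
    then have len: "length (concat Is) = n"
      by (simp add: length_concat)
    have "minor (inverse (- q)) M {1..n} (concat Is) = q_epsilon q n (concat Is) *\<^sub>C qdet q n M"
      using *(4)
    proof
      assume "q_manin q n n M"
      then show ?thesis
        using assms *(3) len by (intro minor_eq_epsilon_qdet_manin)
    next
      assume eq: "concat Is = [1..<Suc n]"
      have "q_epsilon q n [1..<Suc n] = 1"
        using q_epsilon_eq[of q "[1..<Suc n]"] by (simp add: word_inversions_strict_sorted)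
      then show ?thesis
        unfolding eq by (simp add: qdet_eq_minor scaleC_one)
    qed
    then show "q_epsilon q n (concat Is) *\<^sub>C qdet q n M =
        (\<Sum>Ks | map length Ks = ls \<and> (\<forall>K\<in>set Ks. sorted_wrt (<) K \<and> set K \<subseteq> {1..n}).
           q_epsilon q n (concat Ks) *\<^sub>C
             prod_list (map2 (\<lambda>K I. qdet q (length I) (submat M K I)) Ks Is))"
      using minor_laplace_multi[OF len, of q M] *(2) by (simp only:)
  qed
next
  case 20
  show ?case
    using exists_generic_q_manin by blast
next
  case 21
  show ?case
  proof (intro allI impI)
    fix n :: nat and M :: "'a matrix"
    assume "2 \<le> n" "generic_q_manin q n M"
    then have "commutator (qdet q n M) (mtrace n M) \<noteq> 0"
      using assms by (intro generic_commutator_nonzero)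
    then show "(\<exists>x\<in>generated_algebra (entries n M). commutator (qdet q n M) x \<noteq> 0) \<and>
        commutator (qdet q n M) (mtrace n M) \<noteq> 0"
      using mtrace_in_generated_algebra by blast
  qed
next
  case 22
  show ?case
    using quantum_matrix_qdet_central[OF assms] by blast
next
  case 23
  show ?case
    using q_manin_noncentral_matrix[OF assms] noncentral_matrix_not_quantum[OF _ assms] by blast
qed

end
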